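(* Under the hypotheses of Theorem 8.2 (a bounded domain $\Omega$ with $C^\infty$ boundary curves, positive $C^\infty$ weight $\phi$ on $b\Omega$, proper holomorphic map $f$ of $\Omega$ onto the unit disc with simple zeroes $a_1,\dots,a_N$, and $[c_{ij}]$ the inverse of the matrix $[\sigma(a_k,a_j)]$), the weighted Garabedian kernel satisfies, for each fixed $z\in\Omega$, the identity of meromorphic functions of $w\in\Omega$ $$\lambda(w,z)=\frac{f(w)}{f(w)-f(z)}\sum_{i,j=1}^N c_{ij}\,\sigma(z,a_i)\,\lambda(w,a_j).$$
   Context: $T(z)$ is the complex unit tangent vector at $z\in b\Omega$ (positive orientation). $H^2(b\Omega)$ is the closure in $L^2(b\Omega,ds)$ of boundary values of holomorphic functions smooth up to $b\Omega$. $\sigma(z,w)$ is the weighted Szegő kernel: the kernel of the orthogonal projection $P_\phi$ of $L^2(b\Omega,\phi\,ds)$ onto $H^2(b\Omega)$. For $a\in\Omega$ let $C_a(z)=\overline{\frac{1}{2\pi i}\frac{\phi(z)^{-1}T(z)}{z-a}}$; then $C_a=\sigma(\cdot,a)+\phi^{-1}\overline{H_aT}$ on $b\Omega$ for a unique $H_a\in H^2(b\Omega)$, and the weighted Garabedian kernel is $\lambda(z,a)=\frac{1}{2\pi}\frac{1}{z-a}-iH_a(z)$. It satisfies $\overline{\sigma(z,a)}=\frac{1}{i\phi(z)}\lambda(z,a)T(z)$ for $z\in b\Omega$, $a\in\Omega$. *)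

theory Defs
  imports "HOL-Complex_Analysis.Complex_Analysis"
begin

definition vd :: "(real \<Rightarrow> 'a::real_normed_vector) \<Rightarrow> real \<Rightarrow> 'a" where
  "vd c t = vector_derivative c (at t)"

definition C_inf :: "(real \<Rightarrow> 'a::real_normed_vector) \<Rightarrow> bool" where
  "C_inf c \<longleftrightarrow> (\<forall>m t. ((\<lambda>g. vd g) ^^ m) c differentiable (at t))"

definition smooth_bdry_domain :: "complex set \<Rightarrow> nat \<Rightarrow> (nat \<Rightarrow> real \<Rightarrow> complex) \<Rightarrow> bool" where
  "smooth_bdry_domain \<Omega> n \<gamma> \<longleftrightarrow>
     open \<Omega> \<and> connected \<Omega> \<and> bounded \<Omega> \<and> \<Omega> \<noteq> {} \<and>
     (\<forall>k<n. C_inf (\<gamma> k) \<and> (\<forall>t. \<gamma> k (t + 1) = \<gamma> k t) \<and> (\<forall>t. vd (\<gamma> k) t \<noteq> 0)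
            \<and> inj_on (\<gamma> k) {0..<1}) \<and>
     (\<forall>k<n. \<forall>l<n. k \<noteq> l \<longrightarrow> \<gamma> k ` {0..1} \<inter> \<gamma> l ` {0..1} = {}) \<and>
     frontier \<Omega> = (\<Union>k<n. \<gamma> k ` {0..1}) \<and>
     (\<forall>a\<in>\<Omega>. (\<Sum>k<n. winding_number (\<gamma> k) a) = 1) \<and>
     (\<forall>a. a \<notin> closure \<Omega> \<longrightarrow> (\<Sum>k<n. winding_number (\<gamma> k) a) = 0)"

definition utan :: "(real \<Rightarrow> complex) \<Rightarrow> real \<Rightarrow> complex" where
  "utan c t = vd c t / complex_of_real (cmod (vd c t))"

definition bint :: "nat \<Rightarrow> (nat \<Rightarrow> real \<Rightarrow> complex) \<Rightarrow> (complex \<Rightarrow> complex \<Rightarrow> complex) \<Rightarrow> complex" where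
  "bint n \<gamma> F = (\<Sum>k<n. integral {0..1}
      (\<lambda>t. F (\<gamma> k t) (utan (\<gamma> k) t) * complex_of_real (cmod (vd (\<gamma> k) t))))"

definition L2b :: "nat \<Rightarrow> (nat \<Rightarrow> real \<Rightarrow> complex) \<Rightarrow> (complex \<Rightarrow> complex) \<Rightarrow> bool" where
  "L2b n \<gamma> h \<longleftrightarrow> (\<forall>k<n. (\<lambda>t. h (\<gamma> k t)) measurable_on {0..1} \<and>
                           (\<lambda>t. (cmod (h (\<gamma> k t)))\<^sup>2) integrable_on {0..1})"

text \<open>Holomorphic functions on Omega smooth up to the boundary (all complex derivatives
  extend continuously to the closure); their boundary values are their values on the frontier.\<close>
definition Ainf :: "complex set \<Rightarrow> (complex \<Rightarrow> complex) set" where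
  "Ainf \<Omega> = {g. g holomorphic_on \<Omega> \<and> continuous_on (closure \<Omega>) g \<and>
      (\<forall>m. \<exists>G. continuous_on (closure \<Omega>) G \<and> (\<forall>z\<in>\<Omega>. G z = (deriv ^^ m) g z))}"

definition H2 :: "complex set \<Rightarrow> nat \<Rightarrow> (nat \<Rightarrow> real \<Rightarrow> complex) \<Rightarrow> (complex \<Rightarrow> complex) set" where
  "H2 \<Omega> n \<gamma> = {h. L2b n \<gamma> h \<and>
      (\<exists>G. (\<forall>j. G j \<in> Ainf \<Omega>) \<and>
           (\<lambda>j. bint n \<gamma> (\<lambda>z T. complex_of_real ((cmod (G j z - h z))\<^sup>2))) \<longlonglongrightarrow> 0)}"

definition winner :: "nat \<Rightarrow> (nat \<Rightarrow> real \<Rightarrow> complex) \<Rightarrow> (complex \<Rightarrow> real) \<Rightarrow>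
    (complex \<Rightarrow> complex) \<Rightarrow> (complex \<Rightarrow> complex) \<Rightarrow> complex" where
  "winner n \<gamma> \<phi> g h = bint n \<gamma> (\<lambda>z T. g z * cnj (h z) * complex_of_real (\<phi> z))"

text \<open>Holomorphic extension to Omega of an H^2 function via the Cauchy integral.\<close>
definition cext :: "nat \<Rightarrow> (nat \<Rightarrow> real \<Rightarrow> complex) \<Rightarrow> (complex \<Rightarrow> complex) \<Rightarrow> complex \<Rightarrow> complex" where
  "cext n \<gamma> h w = bint n \<gamma> (\<lambda>z T. h z * T / (z - w)) / (2 * pi * \<i>)"

text \<open>S a is (a representative of) the boundary function sigma(., a) of the weighted
  Szego kernel: it lies in H^2 and reproduces values at a w.r.t. the phi-weighted inner
  product (on the dense subspace of boundary values of Ainf functions).\<close>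
definition is_wszego :: "complex set \<Rightarrow> nat \<Rightarrow> (nat \<Rightarrow> real \<Rightarrow> complex) \<Rightarrow> (complex \<Rightarrow> real) \<Rightarrow>
    (complex \<Rightarrow> complex \<Rightarrow> complex) \<Rightarrow> bool" where
  "is_wszego \<Omega> n \<gamma> \<phi> S \<longleftrightarrow> (\<forall>a\<in>\<Omega>. S a \<in> H2 \<Omega> n \<gamma> \<and>
      (\<forall>g\<in>Ainf \<Omega>. g a = winner n \<gamma> \<phi> g (S a)))"

definition wsigma :: "nat \<Rightarrow> (nat \<Rightarrow> real \<Rightarrow> complex) \<Rightarrow> (complex \<Rightarrow> complex \<Rightarrow> complex) \<Rightarrow>
    complex \<Rightarrow> complex \<Rightarrow> complex" where
  "wsigma n \<gamma> S z a = cext n \<gamma> (S a) z"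

text \<open>Hg a = H_a from the decomposition C_a = sigma(., a) + phi^{-1} conj(H_a T) on the boundary.\<close>
definition is_wgarab :: "complex set \<Rightarrow> nat \<Rightarrow> (nat \<Rightarrow> real \<Rightarrow> complex) \<Rightarrow> (complex \<Rightarrow> real) \<Rightarrow>
    (complex \<Rightarrow> complex \<Rightarrow> complex) \<Rightarrow> (complex \<Rightarrow> complex \<Rightarrow> complex) \<Rightarrow> bool" where
  "is_wgarab \<Omega> n \<gamma> \<phi> S Hg \<longleftrightarrow> (\<forall>a\<in>\<Omega>. Hg a \<in> H2 \<Omega> n \<gamma> \<and>
      (\<forall>k<n. \<forall>t\<in>{0..1}.
         cnj ((1 / (2 * pi * \<i>)) * (utan (\<gamma> k) t / complex_of_real (\<phi> (\<gamma> k t))) / (\<gamma> k t - a))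
         = S a (\<gamma> k t) + cnj (Hg a (\<gamma> k t) * utan (\<gamma> k) t) / complex_of_real (\<phi> (\<gamma> k t))))"

definition wlambda :: "nat \<Rightarrow> (nat \<Rightarrow> real \<Rightarrow> complex) \<Rightarrow> (complex \<Rightarrow> complex \<Rightarrow> complex) \<Rightarrow>
    complex \<Rightarrow> complex \<Rightarrow> complex" where
  "wlambda n \<gamma> Hg w a = 1 / (2 * complex_of_real pi * (w - a)) - \<i> * cext n \<gamma> (Hg a) w"

end

theory Submission
  imports Defs
begin

text \<open>Fix \<open>z\<close>. Multiplied by \<open>f w - f z\<close>, the claimed identity says that a function \<open>L\<close>, holomorphic
  on the domain once the poles at \<open>z\<close> and at the zeros of \<open>f\<close> have cancelled, vanishes. Let \<open>K\<close> be the
  corresponding combination of Szego kernels,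
  \<open>K = \<sigma>(\<cdot>,z) (1 - cnj (f z) f) - (\<Sum>i j. cnj (c i j \<sigma>(z,a i)) \<sigma>(\<cdot>,a j))\<close>.
  On the boundary \<open>|f| = 1\<close>, so the relation between the two kernels gives \<open>\<i> L T = - \<phi> f cnj K\<close>. By the choice
  of \<open>c\<close> the function \<open>K\<close> vanishes at the zeros of \<open>f\<close>, so \<open>K L / f\<close> is holomorphic and Cauchy's theorem
  yields \<open>\<integral> \<phi> |K|\<^sup>2 ds = 0\<close>; hence \<open>L = 0\<close> on the boundary, and then inside.

  No boundary regularity of \<open>f\<close> is needed: the argument is run on curves shifted into the domain along
  the normal, where \<open>|f|\<close> tends to 1 uniformly because \<open>f\<close> is proper, and all boundary identities hold up to
  errors tending to 0 in \<open>L\<^sup>2\<close>. What this requires is that functions in the Hardy space converge in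
  \<open>L\<^sup>2\<close> along the shifted curves. For \<open>g\<close> holomorphic up to the boundary, subtracting the (vanishing) Cauchy
  integral at the point reflected in the boundary turns the Cauchy kernel into a Poisson-like kernel, and this
  bounds the \<open>L\<^sup>2\<close> norms on the shifted curves by that on the boundary.\<close>

section \<open>Square-integrable families\<close>

text \<open>The factor \<open>1 - cnj (f z) * f\<close> in \<open>K\<close> is dictated by
  \<open>|f| = 1\<close>: there \<open>f * cnj (1 - cnj (f z) * f) = f - f z\<close>, the factor
  that clears the denominator of the identity. The relation
  \<open>\<i> L T = - \<phi> f cnj K\<close> then gives
  \<open>K L T / f = \<i> \<phi> |K|^2\<close>, so a vanishing contour integral becomes a vanishing
  norm. The obstacle is integrability. The kernels are given only through elements of
  \<open>H2\<close>, hence near the boundary only through \<open>L^2\<close> limits; sup bounds are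
  used for \<open>f\<close>, \<open>1 / f\<close>, the weight and the tangent. Integrands are
  therefore kept products of two \<open>L^2\<close> families with bounded factors, and a boundary
  identity is stated as \<open>L2_null\<close> of its error along the filter
  \<open>at_right 0\<close> of shifts. Shifting inwards needs to know the inner side. Only the sum
  of the winding numbers of the curves is prescribed; since the winding number of one curve jumps
  across that curve, by the Jordan curve theorem, exactly one of its two sides lies in the
  domain.\<close>

definition square_integrable :: "'a measure \<Rightarrow> ('a \<Rightarrow> complex) \<Rightarrow> bool" where
  "square_integrable M f \<longleftrightarrow> f \<in> borel_measurable M \<and> integrable M (\<lambda>x. (cmod (f x))\<^sup>2)"

abbreviation sqnorm :: "'a measure \<Rightarrow> ('a \<Rightarrow> complex) \<Rightarrow> real" where
  "sqnorm M f \<equiv> (\<integral>x. (cmod (f x))\<^sup>2 \<partial>M)"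

text \<open>Both clauses are eventual because a shifted curve lies in the domain for small shifts
  only. Square integrability is asked for separately: the integral of a non-integrable function is 0
  by convention, so the limit alone would say nothing.\<close>

definition L2_null :: "'a measure \<Rightarrow> 'b filter \<Rightarrow> ('b \<Rightarrow> 'a \<Rightarrow> complex) \<Rightarrow> bool" where
  "L2_null M F u \<longleftrightarrow> (\<forall>\<^sub>F e in F. square_integrable M (u e)) \<and>
     ((\<lambda>e. sqnorm M (u e)) \<longlongrightarrow> 0) F"

definition L2_bounded :: "'a measure \<Rightarrow> 'b filter \<Rightarrow> ('b \<Rightarrow> 'a \<Rightarrow> complex) \<Rightarrow> bool" where
  "L2_bounded M F u \<longleftrightarrow>
     (\<exists>B. \<forall>\<^sub>F e in F. square_integrable M (u e) \<and> (sqnorm M (u e)) \<le> B)"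

text \<open>One sup bound for all late members of the family, so that multiplication preserves both
  \<open>L2_null\<close> and \<open>L2_bounded\<close>.\<close>

definition multiplier :: "'a measure \<Rightarrow> 'b filter \<Rightarrow> ('b \<Rightarrow> 'a \<Rightarrow> complex) \<Rightarrow> bool" where
  "multiplier M F b \<longleftrightarrow>
     (\<exists>B. \<forall>\<^sub>F e in F. b e \<in> borel_measurable M \<and> (\<forall>x\<in>space M. cmod (b e x) \<le> B))"

text \<open>Uniform convergence to 0. Such a factor turns a merely bounded family into a null one;
  this is how \<open>f * cnj f - 1\<close> is absorbed on the shifted curves.\<close>

definition null_multiplier :: "'a measure \<Rightarrow> 'b filter \<Rightarrow> ('b \<Rightarrow> 'a \<Rightarrow> complex) \<Rightarrow> bool" where
  "null_multiplier M F b \<longleftrightarrow>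
     (\<forall>\<eta>>0. \<forall>\<^sub>F e in F. b e \<in> borel_measurable M \<and> (\<forall>x\<in>space M. cmod (b e x) \<le> \<eta>))"

lemma norm_add_square_le: "(cmod (x + y))\<^sup>2 \<le> 2 * (cmod x)\<^sup>2 + 2 * (cmod y)\<^sup>2"
proof -
  have "(cmod (x + y))\<^sup>2 \<le> (cmod x + cmod y)\<^sup>2"
    by (simp add: norm_triangle_ineq power_mono)
  also have "\<dots> \<le> 2 * (cmod x)\<^sup>2 + 2 * (cmod y)\<^sup>2"
    using sum_squares_bound[of "cmod x" "cmod y"] by (simp add: power2_sum)
  finally show ?thesis .
qed

lemma square_integrable_add:
  assumes "square_integrable M f" "square_integrable M g"
  shows "square_integrable M (\<lambda>x. f x + g x)"
    and "(sqnorm M (\<lambda>x. f x + g x)) \<le> 2 * (sqnorm M f) + 2 * (sqnorm M g)"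
proof -
  have [measurable]: "f \<in> borel_measurable M" "g \<in> borel_measurable M"
    and i: "integrable M (\<lambda>x. (cmod (f x))\<^sup>2)" "integrable M (\<lambda>x. (cmod (g x))\<^sup>2)"
    using assms by (auto simp: square_integrable_def)
  have "integrable M (\<lambda>x. (cmod (f x + g x))\<^sup>2)"
    by (rule Bochner_Integration.integrable_bound[where f = "\<lambda>x. 2 * (cmod (f x))\<^sup>2 + 2 * (cmod (g x))\<^sup>2"])
       (use i norm_add_square_le in auto)
  then show "square_integrable M (\<lambda>x. f x + g x)"
    by (simp add: square_integrable_def)
  have "(sqnorm M (\<lambda>x. f x + g x)) \<le> (\<integral>x. 2 * (cmod (f x))\<^sup>2 + 2 * (cmod (g x))\<^sup>2 \<partial>M)"
    by (rule integral_mono) (use i norm_add_square_le \<open>integrable M (\<lambda>x. (cmod (f x + g x))\<^sup>2)\<close> in auto)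
  also have "\<dots> = 2 * (sqnorm M f) + 2 * (sqnorm M g)"
    using i by simp
  finally show "(sqnorm M (\<lambda>x. f x + g x)) \<le> 2 * (sqnorm M f) + 2 * (sqnorm M g)" .
qed

lemma square_integrable_bounded_mult:
  assumes "square_integrable M f" and [measurable]: "b \<in> borel_measurable M"
    and B: "\<And>x. x \<in> space M \<Longrightarrow> cmod (b x) \<le> B"
  shows "square_integrable M (\<lambda>x. b x * f x)"
    and "(sqnorm M (\<lambda>x. b x * f x)) \<le> B\<^sup>2 * (sqnorm M f)"
proof -
  have [measurable]: "f \<in> borel_measurable M" and i: "integrable M (\<lambda>x. (cmod (f x))\<^sup>2)"
    using assms(1) by (auto simp: square_integrable_def)
  have le: "(cmod (b x * f x))\<^sup>2 \<le> B\<^sup>2 * (cmod (f x))\<^sup>2" if "x \<in> space M" for x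
    using B[OF that] by (auto simp: norm_mult power_mult_distrib intro!: mult_right_mono power_mono)
  have int: "integrable M (\<lambda>x. (cmod (b x * f x))\<^sup>2)"
    by (rule Bochner_Integration.integrable_bound[where f = "\<lambda>x. B\<^sup>2 * (cmod (f x))\<^sup>2"])
       (use i le in \<open>auto intro!: AE_I2\<close>)
  then show "square_integrable M (\<lambda>x. b x * f x)"
    by (simp add: square_integrable_def)
  have "(sqnorm M (\<lambda>x. b x * f x)) \<le> (\<integral>x. B\<^sup>2 * (cmod (f x))\<^sup>2 \<partial>M)"
    by (rule integral_mono) (use i int le in auto)
  then show "(sqnorm M (\<lambda>x. b x * f x)) \<le> B\<^sup>2 * (sqnorm M f)"
    using i by simp
qed

lemma square_integrable_cnj:
  "square_integrable M f \<Longrightarrow> square_integrable M (\<lambda>x. cnj (f x))"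
  unfolding square_integrable_def
  using borel_measurable_continuous_on[OF continuous_on_cnj[OF continuous_on_id], of f M] by auto

lemma square_integrable_cmult:
  "square_integrable M f \<Longrightarrow> square_integrable M (\<lambda>x. c * f x)"
  by (rule square_integrable_bounded_mult(1)[where B = "cmod c"]) auto

lemma square_integrable_diff:
  assumes "square_integrable M f" "square_integrable M g"
  shows "square_integrable M (\<lambda>x. f x - g x)"
  using square_integrable_add(1)[OF assms(1) square_integrable_cmult[OF assms(2), of "-1"]] by simp

lemma square_integrable_mult_integrable:
  assumes "square_integrable M f" "square_integrable M g"
  shows "integrable M (\<lambda>x. f x * g x)"
proof -
  have [measurable]: "f \<in> borel_measurable M" "g \<in> borel_measurable M"
    and i: "integrable M (\<lambda>x. (cmod (f x))\<^sup>2)" "integrable M (\<lambda>x. (cmod (g x))\<^sup>2)"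
    using assms by (auto simp: square_integrable_def)
  have le: "cmod (f x * g x) \<le> (cmod (f x))\<^sup>2 + (cmod (g x))\<^sup>2" for x
  proof -
    have "2 * (cmod (f x) * cmod (g x)) \<le> (cmod (f x))\<^sup>2 + (cmod (g x))\<^sup>2"
      using sum_squares_bound[of "cmod (f x)" "cmod (g x)"] by simp
    moreover have "0 \<le> cmod (f x) * cmod (g x)" by simp
    ultimately show ?thesis unfolding norm_mult by linarith
  qed
  show ?thesis
    by (rule Bochner_Integration.integrable_bound[where f = "\<lambda>x. (cmod (f x))\<^sup>2 + (cmod (g x))\<^sup>2"])
       (use i le in auto)
qed

text \<open>The quadratic form in \<open>quad\<close> is nonnegative; at \<open>s = ?Y\<close>,
  \<open>t = ?B\<close> it equals \<open>?Y * (?X * ?Y - ?B\<^sup>2)\<close>. If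
  \<open>?Y = 0\<close>, a large \<open>t\<close> with \<open>s = 1\<close> would make it negative
  unless \<open>?B = 0\<close>.\<close>

lemma Cauchy_Schwarz_L2:
  assumes "square_integrable M f" "square_integrable M g"
  shows "(\<integral>x. cmod (f x * g x) \<partial>M)\<^sup>2 \<le> (sqnorm M f) * (sqnorm M g)"
proof -
  let ?X = "sqnorm M f" and ?Y = "sqnorm M g" and ?B = "\<integral>x. cmod (f x * g x) \<partial>M"
  have i: "integrable M (\<lambda>x. (cmod (f x))\<^sup>2)" "integrable M (\<lambda>x. (cmod (g x))\<^sup>2)"
    using assms by (auto simp: square_integrable_def)
  have ifg: "integrable M (\<lambda>x. cmod (f x * g x))"
    using square_integrable_mult_integrable[OF assms] by auto
  have quad: "0 \<le> s\<^sup>2 * ?X - 2 * s * t * ?B + t\<^sup>2 * ?Y" for s t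
  proof -
    have "0 \<le> (\<integral>x. (s * cmod (f x) - t * cmod (g x))\<^sup>2 \<partial>M)" by simp
    also have "\<dots> = (\<integral>x. s\<^sup>2 * (cmod (f x))\<^sup>2 - 2 * s * t * cmod (f x * g x) + t\<^sup>2 * (cmod (g x))\<^sup>2 \<partial>M)"
      by (rule Bochner_Integration.integral_cong) (auto simp: power2_eq_square algebra_simps norm_mult)
    also have "\<dots> = s\<^sup>2 * ?X - 2 * s * t * ?B + t\<^sup>2 * ?Y"
      using i ifg by simp
    finally show ?thesis .
  qed
  have X: "?X \<ge> 0" and Y: "?Y \<ge> 0" and B: "?B \<ge> 0" by simp_all
  show ?thesis
  proof (cases "?Y > 0")
    case True
    have "0 \<le> ?Y * (?X * ?Y - ?B\<^sup>2)"
      using quad[of ?Y ?B] by (simp add: power2_eq_square algebra_simps)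
    then show ?thesis using True by (simp add: zero_le_mult_iff)
  next
    case False
    then have Y0: "?Y = 0" using Y by linarith
    have "?B = 0"
    proof (rule ccontr)
      assume "?B \<noteq> 0"
      then have "?B > 0" using B by linarith
      then show False
        using quad[of 1 "(?X + 1) / (2 * ?B)"] X by (simp add: Y0)
    qed
    then show ?thesis by (simp add: Y0)
  qed
qed

lemma L2_null_imp_bounded:
  assumes "L2_null M F u"
  shows "L2_bounded M F u"
proof -
  have "\<forall>\<^sub>F e in F. (sqnorm M (u e)) < 1"
    using assms unfolding L2_null_def by (auto dest: order_tendstoD(2)[where a = 1])
  then have "\<forall>\<^sub>F e in F. square_integrable M (u e) \<and> (sqnorm M (u e)) \<le> 1"
    using assms[unfolded L2_null_def, THEN conjunct1] by eventually_elim auto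
  then show ?thesis unfolding L2_bounded_def by blast
qed

lemma L2_null_add:
  assumes "L2_null M F u" "L2_null M F v"
  shows "L2_null M F (\<lambda>e x. u e x + v e x)"
  unfolding L2_null_def
proof
  have ev: "\<forall>\<^sub>F e in F. square_integrable M (u e) \<and> square_integrable M (v e)"
    using assms by (auto simp: L2_null_def eventually_conj_iff)
  then show "\<forall>\<^sub>F e in F. square_integrable M (\<lambda>x. u e x + v e x)"
    by eventually_elim (simp add: square_integrable_add)
  have lim: "((\<lambda>e. 2 * (sqnorm M (u e)) + 2 * (sqnorm M (v e))) \<longlongrightarrow> 2 * 0 + 2 * 0) F"
    using assms unfolding L2_null_def by (intro tendsto_intros) auto
  show "((\<lambda>e. sqnorm M (\<lambda>x. u e x + v e x)) \<longlongrightarrow> 0) F"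
    by (rule tendsto_sandwich[OF _ _ tendsto_const lim[simplified]])
       (use ev in \<open>eventually_elim, simp add: square_integrable_add(2)\<close>)+
qed

lemma L2_bounded_add:
  assumes "L2_bounded M F u" "L2_bounded M F v"
  shows "L2_bounded M F (\<lambda>e x. u e x + v e x)"
proof -
  obtain A B where
    A: "\<forall>\<^sub>F e in F. square_integrable M (u e) \<and> (sqnorm M (u e)) \<le> A" and
    B: "\<forall>\<^sub>F e in F. square_integrable M (v e) \<and> (sqnorm M (v e)) \<le> B"
    using assms unfolding L2_bounded_def by blast
  have "\<forall>\<^sub>F e in F. square_integrable M (\<lambda>x. u e x + v e x) \<and> (sqnorm M (\<lambda>x. u e x + v e x)) \<le> 2 * A + 2 * B"
    using A B
  proof eventually_elim
    case (elim e)
    then show ?case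
      using square_integrable_add[of M "u e" "v e"] by force
  qed
  then show ?thesis unfolding L2_bounded_def by blast
qed

lemma L2_null_mult:
  assumes "multiplier M F b" "L2_null M F u"
  shows "L2_null M F (\<lambda>e x. b e x * u e x)"
proof -
  obtain B where B: "\<forall>\<^sub>F e in F. b e \<in> borel_measurable M \<and> (\<forall>x\<in>space M. cmod (b e x) \<le> B)"
    using assms unfolding multiplier_def by blast
  have ev: "\<forall>\<^sub>F e in F. square_integrable M (\<lambda>x. b e x * u e x) \<and>
      (sqnorm M (\<lambda>x. b e x * u e x)) \<le> B\<^sup>2 * (sqnorm M (u e))"
    using B assms(2)[unfolded L2_null_def, THEN conjunct1]
    by eventually_elim (auto intro!: square_integrable_bounded_mult)
  have lim: "((\<lambda>e. B\<^sup>2 * (sqnorm M (u e))) \<longlongrightarrow> B\<^sup>2 * 0) F"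
    using assms unfolding L2_null_def by (intro tendsto_intros) auto
  show ?thesis unfolding L2_null_def
    by (intro conjI tendsto_sandwich[OF _ _ tendsto_const lim[simplified]])
       (use ev in \<open>eventually_elim, simp\<close>)+
qed

lemma L2_bounded_mult:
  assumes "multiplier M F b" "L2_bounded M F u"
  shows "L2_bounded M F (\<lambda>e x. b e x * u e x)"
proof -
  obtain B where B: "\<forall>\<^sub>F e in F. b e \<in> borel_measurable M \<and> (\<forall>x\<in>space M. cmod (b e x) \<le> B)"
    using assms unfolding multiplier_def by blast
  obtain A where A: "\<forall>\<^sub>F e in F. square_integrable M (u e) \<and> (sqnorm M (u e)) \<le> A"
    using assms unfolding L2_bounded_def by blast
  have "\<forall>\<^sub>F e in F. square_integrable M (\<lambda>x. b e x * u e x) \<and>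
      (sqnorm M (\<lambda>x. b e x * u e x)) \<le> B\<^sup>2 * A"
    using B A
  proof eventually_elim
    case (elim e)
    then show ?case
      using square_integrable_bounded_mult[of M "u e" "b e" B]
        mult_left_mono[of "sqnorm M (u e)" A "B\<^sup>2"] by force
  qed
  then show ?thesis unfolding L2_bounded_def by blast
qed

lemma L2_null_mult_bounded:
  assumes "null_multiplier M F b" "L2_bounded M F u"
  shows "L2_null M F (\<lambda>e x. b e x * u e x)"
proof -
  obtain A where A: "\<forall>\<^sub>F e in F. square_integrable M (u e) \<and> (sqnorm M (u e)) \<le> A"
    using assms unfolding L2_bounded_def by blast
  have *: "\<forall>\<^sub>F e in F. square_integrable M (\<lambda>x. b e x * u e x) \<and>
      (sqnorm M (\<lambda>x. b e x * u e x)) \<le> \<eta>\<^sup>2 * \<bar>A\<bar>" if "\<eta> > 0" for \<eta>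
    using assms(1)[unfolded null_multiplier_def, rule_format, OF that] A
  proof eventually_elim
    case (elim e)
    then show ?case
      using square_integrable_bounded_mult[of M "u e" "b e" \<eta>]
        mult_left_mono[of "sqnorm M (u e)" "\<bar>A\<bar>" "\<eta>\<^sup>2"] by force
  qed
  show ?thesis unfolding L2_null_def
  proof
    show "\<forall>\<^sub>F e in F. square_integrable M (\<lambda>x. b e x * u e x)"
      using *[of 1] by (auto elim: eventually_mono)
    show "((\<lambda>e. sqnorm M (\<lambda>x. b e x * u e x)) \<longlongrightarrow> 0) F"
    proof (rule tendstoI)
      fix r :: real assume "r > 0"
      \<comment> \<open>Makes \<open>\<eta>\<^sup>2 * \<bar>A\<bar>\<close> at most
        \<open>r / 2\<close>; the \<open>+ 1\<close> avoids division by 0 when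
        \<open>A = 0\<close>.\<close>
      define \<eta> where "\<eta> = sqrt (r / (2 * (\<bar>A\<bar> + 1)))"
      have "\<eta> > 0" using \<open>r > 0\<close> by (simp add: \<eta>_def)
      have "\<eta>\<^sup>2 = r / (2 * (\<bar>A\<bar> + 1))" using \<open>r > 0\<close> by (simp add: \<eta>_def)
      then have "\<eta>\<^sup>2 * \<bar>A\<bar> = (r / 2) * (\<bar>A\<bar> / (\<bar>A\<bar> + 1))" by simp
      also have "\<dots> \<le> (r / 2) * 1"
        using \<open>r > 0\<close> by (intro mult_left_mono) (auto simp: divide_simps)
      finally have "\<eta>\<^sup>2 * \<bar>A\<bar> < r" using \<open>r > 0\<close> by simp
      then show "\<forall>\<^sub>F e in F. dist (sqnorm M (\<lambda>x. b e x * u e x)) 0 < r"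
        using *[OF \<open>\<eta> > 0\<close>] by (auto elim!: eventually_mono)
    qed
  qed
qed

text \<open>Cauchy-Schwarz with one null and one bounded factor. Error terms under an integral
  disappear in this way, without a pointwise bound on the kernels near the boundary.\<close>

lemma L2_inner_null:
  assumes "L2_null M F u" "L2_bounded M F v"
  shows "((\<lambda>e. \<integral>x. u e x * v e x \<partial>M) \<longlongrightarrow> 0) F"
proof -
  obtain A where A: "\<forall>\<^sub>F e in F. square_integrable M (v e) \<and> (sqnorm M (v e)) \<le> A"
    using assms unfolding L2_bounded_def by blast
  have ev: "\<forall>\<^sub>F e in F. cmod (\<integral>x. u e x * v e x \<partial>M) \<le> sqrt ((sqnorm M (u e)) * \<bar>A\<bar>)"
    using A assms(1)[unfolded L2_null_def, THEN conjunct1]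
  proof eventually_elim
    case (elim e)
    have "(\<integral>x. cmod (u e x * v e x) \<partial>M)\<^sup>2 \<le> (sqnorm M (u e)) * (sqnorm M (v e))"
      using elim by (intro Cauchy_Schwarz_L2) auto
    also have "\<dots> \<le> (sqnorm M (u e)) * \<bar>A\<bar>"
      using elim by (intro mult_left_mono) auto
    finally have "(\<integral>x. cmod (u e x * v e x) \<partial>M) \<le> sqrt ((sqnorm M (u e)) * \<bar>A\<bar>)"
      by (rule real_le_rsqrt)
    then show ?case
      using integral_norm_bound[of M "\<lambda>x. u e x * v e x"] by linarith
  qed
  have "((\<lambda>e. sqrt ((sqnorm M (u e)) * \<bar>A\<bar>)) \<longlongrightarrow> sqrt (0 * \<bar>A\<bar>)) F"
    using assms unfolding L2_null_def by (intro tendsto_intros) auto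
  then show ?thesis
    using ev by (intro Lim_null_comparison[OF ev]) simp
qed

lemma L2_null_cnj:
  assumes "L2_null M F u" shows "L2_null M F (\<lambda>e x. cnj (u e x))"
proof -
  have "\<forall>\<^sub>F e in F. square_integrable M (\<lambda>x. cnj (u e x))"
    using assms[unfolded L2_null_def, THEN conjunct1] by eventually_elim (rule square_integrable_cnj)
  then show ?thesis using assms by (simp add: L2_null_def)
qed

lemma L2_bounded_cnj:
  assumes "L2_bounded M F u" shows "L2_bounded M F (\<lambda>e x. cnj (u e x))"
proof -
  obtain B where
    B: "\<forall>\<^sub>F e in F. square_integrable M (u e) \<and> (sqnorm M (u e)) \<le> B"
    using assms unfolding L2_bounded_def by blast
  have "\<forall>\<^sub>F e in F. square_integrable M (\<lambda>x. cnj (u e x)) \<and> (sqnorm M (\<lambda>x. cnj (u e x))) \<le> B"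
    using B by eventually_elim (simp add: square_integrable_cnj)
  then show ?thesis unfolding L2_bounded_def by blast
qed

lemma L2_null_zero: "L2_null M F (\<lambda>e x. 0)"
  by (auto simp: L2_null_def square_integrable_def)

lemma L2_null_sum:
  assumes "finite I" "\<And>i. i \<in> I \<Longrightarrow> L2_null M F (u i)"
  shows "L2_null M F (\<lambda>e x. \<Sum>i\<in>I. u i e x)"
  using assms by (induction I rule: finite_induct) (auto simp: L2_null_zero intro!: L2_null_add)

lemma L2_bounded_sum:
  assumes "finite I" "\<And>i. i \<in> I \<Longrightarrow> L2_bounded M F (u i)"
  shows "L2_bounded M F (\<lambda>e x. \<Sum>i\<in>I. u i e x)"
  using assms
  by (induction I rule: finite_induct)
     (auto simp: L2_null_zero L2_null_imp_bounded intro!: L2_bounded_add)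

lemma multiplier_const: "multiplier M F (\<lambda>e x. c)"
  unfolding multiplier_def by (rule exI[of _ "cmod c"]) auto

lemma L2_bounded_const:
  assumes "square_integrable M f"
  shows "L2_bounded M F (\<lambda>e. f)"
  unfolding L2_bounded_def by (rule exI[of _ "sqnorm M f"]) (simp add: assms)

text \<open>Equality is needed for late \<open>e\<close> only: rewritings that cancel a pole are
  valid once the shifted curves avoid that pole.\<close>

lemma L2_null_cong:
  assumes "L2_null M F u" "\<forall>\<^sub>F e in F. \<forall>x\<in>space M. u e x = v e x"
  shows "L2_null M F v"
proof -
  have ev: "\<forall>\<^sub>F e in F. square_integrable M (v e) \<and> (sqnorm M (u e)) = (sqnorm M (v e))"
    using assms(1)[unfolded L2_null_def, THEN conjunct1] assms(2)
  proof eventually_elim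
    case (elim e)
    have "v e \<in> borel_measurable M"
      using elim by (subst measurable_cong[of _ _ "u e"]) (auto simp: square_integrable_def)
    moreover have "integrable M (\<lambda>x. (cmod (v e x))\<^sup>2)"
      using elim by (subst Bochner_Integration.integrable_cong[of _ _ _ "\<lambda>x. (cmod (u e x))\<^sup>2"])
        (auto simp: square_integrable_def)
    ultimately show ?case
      using elim by (auto simp: square_integrable_def intro!: Bochner_Integration.integral_cong)
  qed
  have "((\<lambda>e. sqnorm M (v e)) \<longlongrightarrow> 0) F"
    by (rule Lim_transform_eventually[OF assms(1)[unfolded L2_null_def, THEN conjunct2]])
       (use ev in \<open>eventually_elim, simp\<close>)
  moreover have "\<forall>\<^sub>F e in F. square_integrable M (v e)"
    using ev by eventually_elim simp
  ultimately show ?thesis by (simp add: L2_null_def)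
qed

section \<open>Collars of smooth boundary curves\<close>

definition regular_loop :: "(real \<Rightarrow> complex) \<Rightarrow> bool" where
  "regular_loop c \<longleftrightarrow> C_inf c \<and> (\<forall>t. c (t + 1) = c t) \<and> (\<forall>t. vd c t \<noteq> 0) \<and> inj_on c {0..<1}"

section \<open>Calculus of smooth curves of period 1\<close>

lemma C_inf_vd:
  assumes "C_inf c" shows "C_inf (vd c)"
  unfolding C_inf_def
proof (intro allI)
  fix m t
  have "(vd ^^ Suc m) c differentiable at t" using assms unfolding C_inf_def by blast
  then show "(vd ^^ m) (vd c) differentiable at t" by (simp add: funpow_swap1)
qed

lemma C_inf_has_vector_derivative: "C_inf c \<Longrightarrow> (c has_vector_derivative vd c t) (at t)"
  unfolding C_inf_def vd_def vector_derivative_works[symmetric]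
  by (drule spec[of _ 0]) simp

lemma C_inf_continuous: "C_inf c \<Longrightarrow> continuous_on A c"
  by (intro continuous_at_imp_continuous_on ballI has_vector_derivative_continuous[OF C_inf_has_vector_derivative])

lemma periodic_of_int:
  fixes g :: "real \<Rightarrow> 'a"
  assumes "\<And>t. g (t + 1) = g t"
  shows "g (t + of_int k) = g t"
proof -
  have nat: "g (s + of_nat n) = g s" for s n
  proof (induction n)
    case (Suc n)
    have "g (s + of_nat (Suc n)) = g ((s + of_nat n) + 1)" by (simp add: algebra_simps)
    with Suc assms show ?case by simp
  qed simp
  show ?thesis
  proof (cases "k \<ge> 0")
    case True
    then show ?thesis using nat[of t "nat k"] by simp
  next
    case False
    then show ?thesis using nat[of "t + of_int k" "nat (-k)"] by simp
  qed
qed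

lemma periodic_frac:
  fixes g :: "real \<Rightarrow> 'a"
  assumes "\<And>t. g (t + 1) = g t"
  shows "g (frac t) = g t"
  using periodic_of_int[of g "frac t" "\<lfloor>t\<rfloor>", OF assms] by (simp add: frac_def)

lemma frac_in_unit: "frac t \<in> {0..1::real}" "frac t \<in> {0..<1}"
  by (auto simp: frac_ge_0 frac_lt_1 less_imp_le)

lemma periodic_range:
  assumes "\<And>t. g (t + 1) = g t"
  shows "range g = g ` {0..1::real}"
proof (intro subset_antisym image_subsetI)
  fix t show "g t \<in> g ` {0..1}"
    by (rule image_eqI[where x = "frac t"])
       (auto simp: periodic_frac[of g t, OF assms] frac_ge_0 frac_lt_1 less_imp_le)
qed auto

lemma vd_periodic:
  assumes "\<And>t. c (t + 1) = c t" "C_inf c"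
  shows "vd c (t + 1) = vd c t"
proof -
  have "((\<lambda>s. c (s + 1)) has_vector_derivative 1 *\<^sub>R vd c (t + 1)) (at t)"
    by (rule vector_diff_chain_at[of "\<lambda>s. s + 1" 1 t c, unfolded o_def])
       (auto intro!: derivative_eq_intros C_inf_has_vector_derivative assms)
  then have "(c has_vector_derivative vd c (t + 1)) (at t)"
    by (simp add: assms)
  then show ?thesis
    by (simp add: vd_def vector_derivative_at)
qed

lemma periodic_bound:
  fixes g :: "real \<Rightarrow> 'a::real_normed_vector"
  assumes "\<And>t. g (t + 1) = g t" "continuous_on UNIV g"
  obtains M where "M > 0" "\<And>t. norm (g t) \<le> M"
proof -
  have "compact (g ` {0..1})"
    using assms(2) by (intro compact_continuous_image) (auto intro: continuous_on_subset)
  then obtain M where "M > 0" "\<forall>x\<in>g ` {0..1}. norm x \<le> M"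
    using compact_imp_bounded bounded_pos by blast
  with periodic_range[of g, OF assms(1)] that show ?thesis by blast
qed

lemma periodic_lower_bound:
  fixes g :: "real \<Rightarrow> 'a::real_normed_vector"
  assumes "\<And>t. g (t + 1) = g t" "continuous_on UNIV g" "\<And>t. g t \<noteq> 0"
  obtains m where "m > 0" "\<And>t. m \<le> norm (g t)"
proof -
  have "continuous_on {0..1} (\<lambda>t. norm (g t))"
    using assms(2) by (intro continuous_intros) (auto intro: continuous_on_subset)
  then obtain s where s: "\<forall>t\<in>{0..1}. norm (g s) \<le> norm (g t)"
    using continuous_attains_inf[of "{0..1::real}" "\<lambda>t. norm (g t)"] by auto
  have "norm (g s) \<le> norm (g t)" for t
    using s periodic_frac[of g t, OF assms(1)] frac_in_unit(1)[of t] by metis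
  with assms(3)[of s] that[of "norm (g s)"] show ?thesis by simp
qed

section \<open>Distances near a single loop, and its normal tube\<close>

context
  fixes c assumes c: "regular_loop c"
begin

lemma loop_C_inf: "C_inf c" and loop_periodic: "c (t + 1) = c t" and loop_vd_nz: "vd c t \<noteq> 0"
  using c by (auto simp: regular_loop_def)

lemma loop_vd_periodic: "vd c (t + 1) = vd c t"
  by (rule vd_periodic) (simp_all add: loop_C_inf loop_periodic)

lemma loop_deriv: "(c has_vector_derivative vd c t) (at t)"
  by (rule C_inf_has_vector_derivative[OF loop_C_inf])

lemma loop_deriv2: "(vd c has_vector_derivative vd (vd c) t) (at t)"
  by (rule C_inf_has_vector_derivative[OF C_inf_vd[OF loop_C_inf]])

lemma loop_cont: "continuous_on A c" "continuous_on A (vd c)" "continuous_on A (vd (vd c))"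
  by (rule C_inf_continuous, simp add: C_inf_vd loop_C_inf)+

lemma loop_inj:
  assumes "c u = c t" shows "u - t \<in> \<int>"
proof -
  have "c (frac u) = c (frac t)"
    using assms periodic_frac[of c, OF loop_periodic] by simp
  then have "frac u = frac t"
    using c frac_in_unit(2) unfolding regular_loop_def inj_on_def by blast
  then have "u - t = of_int (\<lfloor>u\<rfloor> - \<lfloor>t\<rfloor>)"
    by (simp add: frac_def)
  then show ?thesis by (metis Ints_of_int)
qed

text \<open>Compactness over base points in one period and offsets \<open>h\<close> with
  \<open>\<delta> \<le> \<bar>h\<bar> \<le> 1/2\<close>: a zero of \<open>c (t + h) - c t\<close>
  would make \<open>h\<close> a nonzero integer of absolute value below 1. Modulo the period, two
  parameters are never more than \<open>1/2\<close> apart.\<close>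

lemma loop_separation:
  assumes "\<delta> > 0"
  obtains \<mu> where "\<mu> > 0" "\<And>t u. \<delta> \<le> \<bar>u - t\<bar> \<Longrightarrow> \<bar>u - t\<bar> \<le> 1/2 \<Longrightarrow> \<mu> \<le> cmod (c u - c t)"
proof (cases "\<delta> \<le> 1/2")
  case False
  show ?thesis by (rule that[of 1]) (use False in auto)
next
  case True
  define K where "K = {0..1::real} \<times> ({-1/2..-\<delta>} \<union> {\<delta>..1/2})"
  have "compact K" unfolding K_def by (intro compact_Times compact_Un) auto
  moreover have "K \<noteq> {}" using True by (auto simp: K_def)
  moreover have "continuous_on K (\<lambda>p. cmod (c (fst p + snd p) - c (fst p)))"
    by (intro continuous_intros continuous_on_compose2[OF loop_cont(1)[of UNIV]]) auto
  ultimately obtain p where p: "p \<in> K"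
    "\<forall>q\<in>K. cmod (c (fst p + snd p) - c (fst p)) \<le> cmod (c (fst q + snd q) - c (fst q))"
    using continuous_attains_inf by blast
  have "c (fst p + snd p) \<noteq> c (fst p)"
  proof
    assume "c (fst p + snd p) = c (fst p)"
    then have "snd p \<in> \<int>" using loop_inj by fastforce
    moreover have "\<bar>snd p\<bar> < 1" "snd p \<noteq> 0" using p(1) assms by (auto simp: K_def)
    ultimately show False using Ints_nonzero_abs_less1 by blast
  qed
  moreover have "cmod (c (fst p + snd p) - c (fst p)) \<le> cmod (c u - c t)"
    if "\<delta> \<le> \<bar>u - t\<bar>" "\<bar>u - t\<bar> \<le> 1/2" for t u
  proof -
    have "(frac t, u - t) \<in> K" using that frac_in_unit(1)[of t] by (auto simp: K_def)
    then have "cmod (c (fst p + snd p) - c (fst p)) \<le> cmod (c (frac t + (u - t)) - c (frac t))"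
      using p(2) by fastforce
    also have "c (frac t + (u - t)) = c u"
      using periodic_of_int[of c "frac t + (u - t)" "\<lfloor>t\<rfloor>", OF loop_periodic] by (simp add: frac_def)
    finally show ?thesis using periodic_frac[of c t, OF loop_periodic] by simp
  qed
  ultimately show ?thesis using that by (metis zero_less_norm_iff right_minus_eq)
qed

text \<open>\<open>vd c\<close> is Lipschitz because its derivative is continuous and periodic,
  hence bounded; for the same reason one \<open>M\<close> serves all base points.\<close>

lemma loop_taylor:
  obtains M where "M > 0" "\<And>t u. cmod (c u - c t - (u - t) *\<^sub>R vd c t) \<le> M * (u - t)\<^sup>2"
proof -
  obtain M where M: "M > 0" "\<And>t. cmod (vd (vd c) t) \<le> M"
    using periodic_bound[of "vd (vd c)"] vd_periodic[of "vd c"] loop_vd_periodic loop_cont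
      C_inf_vd[OF loop_C_inf] by metis
  have lip: "cmod (vd c s - vd c t) \<le> M * \<bar>s - t\<bar>" for s t
    using differentiable_bound[of UNIV "vd c" "\<lambda>s h. h *\<^sub>R vd (vd c) s" M s t] loop_deriv2 M(2)
    by (auto simp: has_vector_derivative_def onorm_le norm_mult mult.commute[of M] mult_left_mono intro!: onorm_le)
  have "cmod (c u - c t - (u - t) *\<^sub>R vd c t) \<le> M * (u - t)\<^sup>2" for t u
  proof -
    have "cmod (c u - c t - (u - t) *\<^sub>R vd c t) \<le> norm (u - t) * (M * \<bar>u - t\<bar>)"
    proof (rule vector_differentiable_bound_linearization[where S = "closed_segment t u"])
      show "(c has_vector_derivative vd c x) (at x within closed_segment t u)" for x
        by (rule has_vector_derivative_at_within[OF loop_deriv])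
      show "cmod (vd c x - vd c t) \<le> M * \<bar>u - t\<bar>" if "x \<in> closed_segment t u" for x
      proof -
        have "\<bar>x - t\<bar> \<le> \<bar>u - t\<bar>"
          using that by (auto simp: closed_segment_eq_real_ivl split: if_splits)
        then show ?thesis using lip[of x t] M(1) by (meson mult_left_mono order_trans less_imp_le)
      qed
    qed auto
    then show ?thesis by (simp add: power2_eq_square mult_ac abs_mult_self_eq flip: abs_mult)
  qed
  with M(1) that show ?thesis by blast
qed

text \<open>The normal \<open>\<i> * vd c t\<close> is not normalised. This avoids any division when
  the curve is differentiated, and \<open>s\<close> stays comparable to a distance since
  \<open>vd c\<close> is bounded and bounded away from 0.\<close>

definition "tube t s = c t + complex_of_real s * (\<i> * vd c t)"

text \<open>Near the diagonal, \<open>c u - tube t s\<close> is close to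
  \<open>(u - t - \<i> * s) * vd c t\<close>, whose modulus is exactly the square root times
  \<open>cmod (vd c t)\<close>, and the Taylor error is quadratic in \<open>u - t\<close>. Away from
  the diagonal the curve keeps a distance from itself that a small \<open>s\<close> cannot
  close.\<close>

lemma tube_lower_bound:
  obtains \<kappa> \<epsilon> where "\<kappa> > 0" "\<epsilon> > 0"
    "\<And>t u s. \<bar>u - t\<bar> \<le> 1/2 \<Longrightarrow> \<bar>s\<bar> \<le> \<epsilon> \<Longrightarrow> \<kappa> * sqrt ((u - t)\<^sup>2 + s\<^sup>2) \<le> cmod (c u - tube t s)"
proof -
  obtain M where M: "M > 0" "\<And>t u. cmod (c u - c t - (u - t) *\<^sub>R vd c t) \<le> M * (u - t)\<^sup>2"
    using loop_taylor by blast
  obtain m where m: "m > 0" "\<And>t. m \<le> cmod (vd c t)"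
    using periodic_lower_bound[of "vd c"] loop_vd_periodic loop_cont loop_vd_nz by metis
  obtain D where D: "D > 0" "\<And>t. cmod (vd c t) \<le> D"
    using periodic_bound[of "vd c"] loop_vd_periodic loop_cont by metis
  \<comment> \<open>Below this distance the Taylor error is at most half of the lower bound for the
    main term.\<close>
  define \<delta> where "\<delta> = m / (2 * M)"
  have "\<delta> > 0" using m M by (simp add: \<delta>_def)
  obtain \<mu> where \<mu>: "\<mu> > 0" "\<And>t u. \<delta> \<le> \<bar>u - t\<bar> \<Longrightarrow> \<bar>u - t\<bar> \<le> 1/2 \<Longrightarrow> \<mu> \<le> cmod (c u - c t)"
    using loop_separation[OF \<open>\<delta> > 0\<close>] by blast
  \<comment> \<open>\<open>\<mu> / (2 * D)\<close> keeps the normal displacement at most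
    \<open>\<mu> / 2\<close>. With \<open>\<epsilon> \<le> 1\<close> the square root is at most 2,
    whence \<open>\<mu> / 4\<close> in \<open>\<kappa>\<close>.\<close>
  define \<epsilon> where "\<epsilon> = min 1 (\<mu> / (2 * D))"
  define \<kappa> where "\<kappa> = min (m / 2) (\<mu> / 4)"
  show ?thesis
  proof (rule that)
    show "\<kappa> > 0" "\<epsilon> > 0" using m \<mu> D by (auto simp: \<kappa>_def \<epsilon>_def)
    fix t u s :: real assume ut: "\<bar>u - t\<bar> \<le> 1/2" and s: "\<bar>s\<bar> \<le> \<epsilon>"
    let ?r = "sqrt ((u - t)\<^sup>2 + s\<^sup>2)"
    show "\<kappa> * ?r \<le> cmod (c u - tube t s)"
    proof (cases "\<delta> \<le> \<bar>u - t\<bar>")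
      case True
      have "cmod (complex_of_real s * (\<i> * vd c t)) \<le> \<epsilon> * D"
        using s D by (auto simp: norm_mult intro!: mult_mono)
      also have "\<dots> \<le> \<mu> / 2" using D \<mu> by (auto simp: \<epsilon>_def min_def field_simps)
      finally have "\<mu> / 2 \<le> cmod (c u - c t) - cmod (complex_of_real s * (\<i> * vd c t))"
        using \<mu>(2)[OF True ut] by simp
      also have "\<dots> \<le> cmod (c u - tube t s)"
        using norm_triangle_ineq2[of "c u - c t" "complex_of_real s * (\<i> * vd c t)"]
        by (simp add: tube_def diff_diff_eq)
      finally have "\<mu> / 2 \<le> cmod (c u - tube t s)" .
      moreover have "?r \<le> 2"
      proof -
        have "(u - t)\<^sup>2 \<le> 1\<^sup>2" by (rule abs_le_square_iff[THEN iffD1]) (use ut in auto)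
        moreover have "s\<^sup>2 \<le> 1\<^sup>2" by (rule abs_le_square_iff[THEN iffD1]) (use s in \<open>auto simp: \<epsilon>_def\<close>)
        ultimately show ?thesis by (intro real_le_lsqrt) auto
      qed
      then have "\<kappa> * ?r \<le> (\<mu> / 4) * 2"
        using \<open>\<kappa> > 0\<close> by (intro mult_mono) (auto simp: \<kappa>_def)
      ultimately show ?thesis by simp
    next
      case False
      let ?h = "u - t"
      have "cmod (?h *\<^sub>R vd c t - complex_of_real s * (\<i> * vd c t)) = cmod (Complex ?h (- s)) * cmod (vd c t)"
        unfolding norm_mult[symmetric] by (rule arg_cong[of _ _ cmod]) (simp add: complex_eq_iff algebra_simps)
      also have "\<dots> = ?r * cmod (vd c t)" by (simp add: cmod_def)
      finally have 1: "m * ?r \<le> cmod (?h *\<^sub>R vd c t - complex_of_real s * (\<i> * vd c t))"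
        using mult_right_mono[OF m(2)[of t], of ?r] by (simp add: mult.commute)
      have "M * ?h\<^sup>2 = M * \<bar>?h\<bar> * \<bar>?h\<bar>" by (simp add: power2_eq_square)
      also have "\<dots> \<le> M * \<delta> * ?r"
        using False M \<open>\<delta> > 0\<close> by (intro mult_mono) (auto intro: real_le_rsqrt)
      also have "\<dots> = m / 2 * ?r" using M by (simp add: \<delta>_def)
      finally have 2: "cmod (c u - c t - ?h *\<^sub>R vd c t) \<le> m / 2 * ?r"
        using M(2)[of u t] by simp
      have "m * ?r - m / 2 * ?r \<le> cmod (c u - tube t s)"
        using 1 2 norm_triangle_ineq2[of "?h *\<^sub>R vd c t - complex_of_real s * (\<i> * vd c t)" "-(c u - c t - ?h *\<^sub>R vd c t)"]
        unfolding norm_minus_cancel by (simp add: tube_def algebra_simps)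
      moreover have "\<kappa> * ?r \<le> m / 2 * ?r" by (intro mult_right_mono) (auto simp: \<kappa>_def)
      ultimately show ?thesis by simp
    qed
  qed
qed

text \<open>The point of the curve nearest to \<open>p\<close> is the foot of a normal through \<open>p\<close>.\<close>

lemma tube_covers:
  obtains t s where "p = tube t s" "\<bar>s\<bar> * cmod (vd c t) \<le> cmod (p - c t0)"
proof -
  have "continuous_on {0..1} (\<lambda>t. cmod (p - c t))"
    by (intro continuous_intros loop_cont)
  then obtain t where t: "\<forall>u\<in>{0..1}. cmod (p - c t) \<le> cmod (p - c u)"
    using continuous_attains_inf[of "{0..1::real}" "\<lambda>t. cmod (p - c t)"] by auto
  \<comment> \<open>By periodicity the minimum over one period is global, so the derivative test
    applies even if \<open>t\<close> is an end point of \<open>{0..1}\<close>.\<close>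
  have min: "cmod (p - c t) \<le> cmod (p - c u)" for u
    using t periodic_frac[of c u, OF loop_periodic] frac_in_unit(1)[of u] by metis
  have d: "((\<lambda>u. (p - c u) \<bullet> (p - c u)) has_real_derivative (- 2 * ((p - c t) \<bullet> vd c t))) (at t)"
    unfolding has_real_derivative_iff_has_vector_derivative has_vector_derivative_def
    by (rule derivative_eq_intros loop_deriv[unfolded has_vector_derivative_def] refl)+
       (auto simp: inner_commute algebra_simps)
  have "- 2 * ((p - c t) \<bullet> vd c t) = 0"
    by (rule DERIV_local_min[OF d, of 1]) (use min in \<open>auto simp: dot_square_norm\<close>)
  then have orth: "(p - c t) \<bullet> vd c t = 0" by simp
  \<comment> \<open>Orthogonality to the tangent makes the quotient by the normal vector real; it is
    the required \<open>s\<close>.\<close>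
  define q where "q = (p - c t) / (\<i> * vd c t)"
  have pq: "p - c t = q * (\<i> * vd c t)" using loop_vd_nz by (simp add: q_def)
  have "Im q * (cmod (vd c t))\<^sup>2 = 0"
    using orth unfolding pq cmod_power2 by (simp add: inner_complex_def algebra_simps power2_eq_square)
  then have "Im q = 0" using loop_vd_nz by simp
  then have "q = complex_of_real (Re q)" by (simp add: complex_eq_iff)
  then have p: "p = tube t (Re q)" using pq unfolding tube_def by (metis add.commute diff_add_cancel)
  moreover have "\<bar>Re q\<bar> * cmod (vd c t) = cmod (p - c t)"
    unfolding p tube_def by (simp add: norm_mult)
  ultimately show ?thesis using that min by metis
qed

end

text \<open>\<open>qk e\<close> is the part of the 1-periodization of \<open>pk e\<close> that matters for \<open>u - t\<close> with \<open>u, t \<in> {0..1}\<close>.\<close>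

definition pk :: "real \<Rightarrow> real \<Rightarrow> real" where
  "pk e x = e / (e\<^sup>2 + x\<^sup>2)"

definition qk :: "real \<Rightarrow> real \<Rightarrow> real" where
  "qk e x = pk e x + pk e (x + 1) + pk e (x - 1)"

section \<open>Constants common to all boundary curves\<close>

lemma exists_uniform_bound:
  fixes P :: "nat \<Rightarrow> real \<Rightarrow> bool"
  assumes "\<And>k. k < n \<Longrightarrow> \<exists>e>0. P k e" "\<And>k e e'. P k e \<Longrightarrow> 0 < e' \<Longrightarrow> e' \<le> e \<Longrightarrow> P k e'"
  shows "\<exists>e>0. \<forall>k<n. P k e"
  using assms(1)
proof (induction n)
  case 0
  show ?case by (rule exI[of _ 1]) auto
next
  case (Suc n)
  then obtain e e' where "e > 0" "\<forall>k<n. P k e" "e' > 0" "P n e'" by (metis less_Suc_eq)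
  then show ?case using assms(2)
    by (intro exI[of _ "min e e'"]) (auto simp: less_Suc_eq)
qed

lemma domain_loops:
  assumes "smooth_bdry_domain \<Omega> n \<gamma>" "k < n"
  shows "regular_loop (\<gamma> k)"
  using assms by (simp add: smooth_bdry_domain_def regular_loop_def)

lemma domain_vd_bound:
  assumes dom: "smooth_bdry_domain \<Omega> n \<gamma>"
  obtains D where "D > 0" "\<And>k t. k < n \<Longrightarrow> cmod (vd (\<gamma> k) t) \<le> D"
proof -
  have loops: "regular_loop (\<gamma> k)" if "k < n" for k using domain_loops[OF dom that] .
  \<comment> \<open>An upper bound is encoded by its reciprocal: \<open>exists_uniform_bound\<close>
    takes minima and needs a property that passes to smaller numbers.\<close>
  have "\<exists>d>0. \<forall>k<n. \<forall>t. d * cmod (vd (\<gamma> k) t) \<le> 1"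
  proof (rule exists_uniform_bound)
    fix k assume "k < n"
    obtain D where D: "D > 0" "\<And>t. cmod (vd (\<gamma> k) t) \<le> D"
      using periodic_bound[of "vd (\<gamma> k)"] loop_vd_periodic[OF loops[OF \<open>k < n\<close>]] loop_cont(2)[OF loops[OF \<open>k < n\<close>]]
      by metis
    then show "\<exists>d>0. \<forall>t. d * cmod (vd (\<gamma> k) t) \<le> 1"
      by (intro exI[of _ "1 / D"]) auto
  next
    fix k and e e' :: real assume "\<forall>t. e * cmod (vd (\<gamma> k) t) \<le> 1" "0 < e'" "e' \<le> e"
    then show "\<forall>t. e' * cmod (vd (\<gamma> k) t) \<le> 1"
      by (meson mult_right_mono norm_ge_zero order_trans)
  qed
  then obtain d where d: "d > 0" "\<And>k t. k < n \<Longrightarrow> d * cmod (vd (\<gamma> k) t) \<le> 1" by blast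
  show ?thesis by (rule that[of "1 / d"]) (use d in \<open>auto simp: field_simps\<close>)
qed

lemma shift_within_half:
  fixes x :: real
  obtains m where "\<bar>x + of_int m\<bar> \<le> 1/2"
proof (rule that)
  show "\<bar>x + of_int (- round x)\<bar> \<le> 1/2"
    using of_int_round_abs_le[of x] by (simp add: abs_minus_commute)
qed

lemma domain_tubes:
  assumes dom: "smooth_bdry_domain \<Omega> n \<gamma>"
  obtains \<kappa> \<epsilon> where "\<kappa> > 0" "\<epsilon> > 0" "\<epsilon> \<le> 1"
    "\<And>k t u s. k < n \<Longrightarrow> \<bar>u - t\<bar> \<le> 1/2 \<Longrightarrow> \<bar>s\<bar> \<le> \<epsilon> \<Longrightarrow>
       \<kappa> * sqrt ((u - t)\<^sup>2 + s\<^sup>2) \<le> cmod (\<gamma> k u - tube (\<gamma> k) t s)"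
    "\<And>k l t u s. k < n \<Longrightarrow> l < n \<Longrightarrow> k \<noteq> l \<Longrightarrow> \<bar>s\<bar> \<le> \<epsilon> \<Longrightarrow> \<kappa> \<le> cmod (\<gamma> l u - tube (\<gamma> k) t s)"
proof -
  have loops: "regular_loop (\<gamma> k)" if "k < n" for k using domain_loops[OF dom that] .
  \<comment> \<open>One number serves as slope and as thickness, so that the property is inherited
    by smaller numbers.\<close>
  define Q where "Q k e \<longleftrightarrow> (\<forall>t u s. \<bar>u - t\<bar> \<le> 1/2 \<longrightarrow> \<bar>s\<bar> \<le> e \<longrightarrow>
       e * sqrt ((u - t)\<^sup>2 + s\<^sup>2) \<le> cmod (\<gamma> k u - tube (\<gamma> k) t s))" for k e
  have "\<exists>e>0. \<forall>k<n. Q k e"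
  proof (rule exists_uniform_bound)
    fix k assume "k < n"
    obtain a b where ab: "a > 0" "b > 0" "\<And>t u s. \<bar>u - t\<bar> \<le> 1/2 \<Longrightarrow> \<bar>s\<bar> \<le> b \<Longrightarrow>
        a * sqrt ((u - t)\<^sup>2 + s\<^sup>2) \<le> cmod (\<gamma> k u - tube (\<gamma> k) t s)"
      using tube_lower_bound[OF loops[OF \<open>k < n\<close>]] by blast
    show "\<exists>e>0. Q k e"
    proof (intro exI[of _ "min a b"] conjI)
      show "Q k (min a b)"
        unfolding Q_def
      proof (intro allI impI)
        fix t u s :: real assume *: "\<bar>u - t\<bar> \<le> 1 / 2" "\<bar>s\<bar> \<le> min a b"
        have "min a b * sqrt ((u - t)\<^sup>2 + s\<^sup>2) \<le> a * sqrt ((u - t)\<^sup>2 + s\<^sup>2)"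
          by (intro mult_right_mono) auto
        with ab(3)[OF *(1)] *(2) show "min a b * sqrt ((u - t)\<^sup>2 + s\<^sup>2) \<le> cmod (\<gamma> k u - tube (\<gamma> k) t s)"
          by fastforce
      qed
    qed (use ab in auto)
  next
    fix k and e e' :: real assume *: "Q k e" "0 < e'" "e' \<le> e"
    show "Q k e'" unfolding Q_def
    proof (intro allI impI)
      fix t u s :: real assume **: "\<bar>u - t\<bar> \<le> 1 / 2" "\<bar>s\<bar> \<le> e'"
      have "e' * sqrt ((u - t)\<^sup>2 + s\<^sup>2) \<le> e * sqrt ((u - t)\<^sup>2 + s\<^sup>2)"
        using * by (intro mult_right_mono) auto
      also have "\<dots> \<le> cmod (\<gamma> k u - tube (\<gamma> k) t s)"
        using * ** unfolding Q_def by auto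
      finally show "e' * sqrt ((u - t)\<^sup>2 + s\<^sup>2) \<le> cmod (\<gamma> k u - tube (\<gamma> k) t s)" .
    qed
  qed
  then obtain e1 where e1: "e1 > 0" "\<And>k. k < n \<Longrightarrow> Q k e1" by blast
  define R where "R k e \<longleftrightarrow> (\<forall>l<n. k \<noteq> l \<longrightarrow> (\<forall>t u s. \<bar>s\<bar> \<le> e \<longrightarrow> e \<le> cmod (\<gamma> l u - tube (\<gamma> k) t s)))" for k e
  have "\<exists>e>0. \<forall>k<n. R k e"
  proof (rule exists_uniform_bound)
    fix k assume "k < n"
    obtain D where D: "D > 0" "\<And>t. cmod (vd (\<gamma> k) t) \<le> D"
      using periodic_bound[of "vd (\<gamma> k)"] loop_vd_periodic[OF loops[OF \<open>k < n\<close>]] loop_cont(2)[OF loops[OF \<open>k < n\<close>]]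
      by metis
    define R' where "R' l e \<longleftrightarrow> (k \<noteq> l \<longrightarrow> (\<forall>t u. e \<le> cmod (\<gamma> l u - \<gamma> k t)))" for l e
    have "\<exists>e>0. \<forall>l<n. R' l e"
    proof (rule exists_uniform_bound)
      fix l assume "l < n"
      show "\<exists>e>0. R' l e"
      proof (cases "k = l")
        case False
        have "\<gamma> k ` {0..1} \<inter> \<gamma> l ` {0..1} = {}"
          using dom False \<open>k < n\<close> \<open>l < n\<close> unfolding smooth_bdry_domain_def by blast
        moreover have "compact (\<gamma> k ` {0..1})" "compact (\<gamma> l ` {0..1})"
          using \<open>k < n\<close> \<open>l < n\<close> by (auto intro!: compact_continuous_image loop_cont loops)
        ultimately obtain d where d: "d > 0" "\<forall>x\<in>\<gamma> k ` {0..1}. \<forall>y\<in>\<gamma> l ` {0..1}. d \<le> dist x y"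
          using separate_compact_closed compact_imp_closed by metis
        have "\<gamma> k t \<in> \<gamma> k ` {0..1}" "\<gamma> l t \<in> \<gamma> l ` {0..1}" for t
          using periodic_range[of "\<gamma> k"] periodic_range[of "\<gamma> l"] loop_periodic[OF loops]
            \<open>k < n\<close> \<open>l < n\<close> by auto
        then have "d \<le> cmod (\<gamma> l u - \<gamma> k t)" for t u
          using d(2) by (metis dist_norm norm_minus_commute)
        with d(1) show ?thesis unfolding R'_def by blast
      qed (auto simp: R'_def intro: exI[of _ 1])
    qed (unfold R'_def, meson order_trans)
    then obtain d where d: "d > 0" "\<forall>l<n. R' l d" by blast
    show "\<exists>e>0. R k e"
    \<comment> \<open>The second entry bounds the normal displacement by \<open>d / 2\<close>, which
      leaves half of the gap \<open>d\<close> between the curves.\<close>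
    proof (intro exI[of _ "min (d / 2) (d / (2 * D))"] conjI)
      show "R k (min (d / 2) (d / (2 * D)))" unfolding R_def
      proof (intro allI impI)
        fix l t u and s :: real
        assume l: "l < n" "k \<noteq> l" and s: "\<bar>s\<bar> \<le> min (d / 2) (d / (2 * D))"
        have "cmod (complex_of_real s * (\<i> * vd (\<gamma> k) t)) \<le> d / (2 * D) * D"
          unfolding norm_mult using s D d by (intro mult_mono) auto
        moreover have "d \<le> cmod (\<gamma> l u - \<gamma> k t)" using d l unfolding R'_def by blast
        ultimately show "min (d / 2) (d / (2 * D)) \<le> cmod (\<gamma> l u - tube (\<gamma> k) t s)"
          using norm_triangle_ineq2[of "\<gamma> l u - \<gamma> k t" "complex_of_real s * (\<i> * vd (\<gamma> k) t)"] D
          by (simp add: tube_def[OF loops[OF \<open>k < n\<close>]] diff_diff_eq)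
      qed
    qed (use d D in auto)
  next
    fix k and e e' :: real assume *: "R k e" "0 < e'" "e' \<le> e"
    show "R k e'" unfolding R_def
    proof (intro allI impI)
      fix l t u and s :: real assume "l < n" "k \<noteq> l" "\<bar>s\<bar> \<le> e'"
      then have "e \<le> cmod (\<gamma> l u - tube (\<gamma> k) t s)" using * unfolding R_def by auto
      with * show "e' \<le> cmod (\<gamma> l u - tube (\<gamma> k) t s)" by simp
    qed
  qed
  then obtain e2 where e2: "e2 > 0" "\<And>k. k < n \<Longrightarrow> R k e2" by blast
  show ?thesis
  proof (rule that[of "min e1 e2" "min 1 (min e1 e2)"])
    fix k l t u and s :: real assume "k < n" "l < n" "k \<noteq> l" "\<bar>s\<bar> \<le> min 1 (min e1 e2)"
    then have "e2 \<le> cmod (\<gamma> l u - tube (\<gamma> k) t s)"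
      using e2(2)[of k] unfolding R_def by simp
    then show "min e1 e2 \<le> cmod (\<gamma> l u - tube (\<gamma> k) t s)" by simp
  next
    fix k and t u s :: real assume *: "k < n" "\<bar>u - t\<bar> \<le> 1 / 2" "\<bar>s\<bar> \<le> min 1 (min e1 e2)"
    have "min e1 e2 * sqrt ((u - t)\<^sup>2 + s\<^sup>2) \<le> e1 * sqrt ((u - t)\<^sup>2 + s\<^sup>2)"
      by (intro mult_right_mono) auto
    also have "\<dots> \<le> cmod (\<gamma> k u - tube (\<gamma> k) t s)"
      using * e1(2)[of k] unfolding Q_def by auto
    finally show "min e1 e2 * sqrt ((u - t)\<^sup>2 + s\<^sup>2) \<le> cmod (\<gamma> k u - tube (\<gamma> k) t s)" .
  qed (use e1 e2 in auto)
qed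

section \<open>On which side of each boundary curve the domain lies\<close>

lemma tube_continuous:
  assumes "regular_loop c"
  shows "continuous_on A (\<lambda>(t, s). tube c t s)"
  unfolding tube_def[OF assms] case_prod_unfold
  by (intro continuous_intros continuous_on_compose2[OF loop_cont(1)[OF assms, of UNIV]]
        continuous_on_compose2[OF loop_cont(2)[OF assms, of UNIV]]) auto

lemma connected_tube_image:
  assumes "regular_loop c" "convex I"
  shows "connected ((\<lambda>(t, s). tube c t s) ` (UNIV \<times> I))"
  by (intro connected_continuous_image tube_continuous assms convex_connected convex_Times) auto

lemma loop_simple_path:
  assumes "regular_loop c"
  shows "simple_path c" "pathfinish c = pathstart c" "path c" "path_image c = range c"
proof -
  show p: "path c" using loop_cont[OF assms] by (simp add: path_def)
  show "pathfinish c = pathstart c"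
    using loop_periodic[OF assms, of 0] by (simp add: pathfinish_def pathstart_def)
  show "path_image c = range c"
    unfolding path_image_def by (rule periodic_range[symmetric]) (rule loop_periodic[OF assms])
  have "loop_free c" unfolding loop_free_def
  proof (intro ballI impI)
    fix x y :: real assume *: "x \<in> {0..1}" "y \<in> {0..1}" "c x = c y"
    have "x - y \<in> \<int>" using loop_inj[OF assms *(3)] .
    then obtain m where "x - y = of_int m" by (auto elim: Ints_cases)
    moreover have "-1 \<le> x - y" "x - y \<le> 1" using * by auto
    ultimately have "m = -1 \<or> m = 0 \<or> m = 1" by linarith
    then show "x = y \<or> x = 0 \<and> y = 1 \<or> x = 1 \<and> y = 0"
      using * \<open>x - y = of_int m\<close> by auto
  qed
  with p show "simple_path c" by (simp add: simple_path_def)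
qed

text \<open>By the Jordan curve theorem both components of the complement accumulate at every point of the curve, and
  the tube covers a neighbourhood of it; so the two sides of the tube lie in different components.\<close>

lemma winding_number_jump:
  assumes c: "regular_loop c" and "\<epsilon> > 0"
    and disj: "\<And>t s. s \<noteq> 0 \<Longrightarrow> \<bar>s\<bar> \<le> \<epsilon> \<Longrightarrow> tube c t s \<notin> range c"
    and P: "P = (\<lambda>(t, s). tube c t s) ` (UNIV \<times> {0<..\<epsilon>})"
    and N: "N = (\<lambda>(t, s). tube c t s) ` (UNIV \<times> {-\<epsilon>..<0})"
    and "p \<in> P" "q \<in> N"
  shows "winding_number c p \<noteq> winding_number c q"
proof -
  note sp = loop_simple_path[OF c]
  have img: "P \<inter> path_image c = {}" "N \<inter> path_image c = {}"
    using disj sp(4) unfolding P N by (fastforce dest: sym)+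
  have conn: "connected P" "connected N"
    unfolding P N by (intro connected_tube_image c convex_real_interval)+
  note J = Jordan_inside_outside[OF sp(1,2)]
  have J0: "inside (path_image c) \<inter> outside (path_image c) = {}" using J by blast
  have split: "A \<subseteq> inside (path_image c) \<or> A \<subseteq> outside (path_image c)"
    if "connected A" "A \<inter> path_image c = {}" for A
  proof (rule ccontr)
    assume *: "\<not> ?thesis"
    moreover have "A \<subseteq> inside (path_image c) \<union> outside (path_image c)" using J that(2) by blast
    ultimately have "A \<inter> inside (path_image c) \<noteq> {}" "A \<inter> outside (path_image c) \<noteq> {}" by blast+
    moreover have "open (inside (path_image c))" "open (outside (path_image c))"
      "inside (path_image c) \<inter> outside (path_image c) \<inter> A = {}" using J by blast+
    ultimately show False
      using connectedD[OF that(1)] \<open>A \<subseteq> _\<close> by blast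
  qed
  obtain m where m: "m > 0" "\<And>t. m \<le> cmod (vd c t)"
    using periodic_lower_bound[of "vd c"] loop_vd_periodic[OF c] loop_cont[OF c] loop_vd_nz[OF c] by metis
  have near: "A \<inter> (P \<union> N) \<noteq> {}" if A: "frontier A = path_image c" "A \<inter> path_image c = {}" for A
  proof -
    have "c 0 \<in> closure A" using A sp(4) unfolding frontier_def by blast
    then obtain x where x: "x \<in> A" "dist x (c 0) < \<epsilon> * m"
      using closure_approachable[of "c 0" A] \<open>\<epsilon> > 0\<close> m(1) by (meson mult_pos_pos)
    obtain t s where ts: "x = tube c t s" "\<bar>s\<bar> * cmod (vd c t) \<le> cmod (x - c 0)"
      using tube_covers[OF c, of x 0] by blast
    have "\<bar>s\<bar> * m \<le> \<bar>s\<bar> * cmod (vd c t)" using m by (intro mult_left_mono) auto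
    also have "\<dots> < \<epsilon> * m" using ts x by (simp add: dist_norm)
    finally have "\<bar>s\<bar> < \<epsilon>" using m(1) by simp
    moreover have "s \<noteq> 0"
    proof
      assume "s = 0"
      then have "x = c t" using ts by (simp add: tube_def[OF c])
      then show False using x A sp(4) by blast
    qed
    ultimately have "x \<in> P \<union> N" unfolding P N ts by (cases "s > 0") auto
    with x show ?thesis by blast
  qed
  have I: "inside (path_image c) \<inter> (P \<union> N) \<noteq> {}" and O: "outside (path_image c) \<inter> (P \<union> N) \<noteq> {}"
    by (rule near; use J in blast)+
  \<comment> \<open>If both strips lay in one component, the other one would miss
    \<open>P \<union> N\<close>, against \<open>I\<close> or \<open>O\<close>.\<close>
  have "\<not> (P \<subseteq> inside (path_image c) \<and> N \<subseteq> inside (path_image c))"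
    "\<not> (P \<subseteq> outside (path_image c) \<and> N \<subseteq> outside (path_image c))" using I O J0 by blast+
  then have sides: "(p \<in> inside (path_image c) \<and> q \<in> outside (path_image c)) \<or>
      (q \<in> inside (path_image c) \<and> p \<in> outside (path_image c))"
    using split[OF conn(1) img(1)] split[OF conn(2) img(2)] \<open>p \<in> P\<close> \<open>q \<in> N\<close> by blast
  have "winding_number c x \<noteq> 0" if "x \<in> inside (path_image c)" for x
    using simple_closed_path_winding_number_inside[OF sp(1)] that by force
  moreover have "winding_number c x = 0" if "x \<in> outside (path_image c)" for x
    by (rule winding_number_zero_in_outside[OF sp(3,2) that])
  ultimately show ?thesis using sides by metis
qed

text \<open>The statement does not fix the orientation of the single curves; \<open>\<sigma> k = \<plusminus>1\<close> records on which side of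
  \<open>\<gamma> k\<close> the domain lies.\<close>

locale collared_domain =
  fixes \<Omega> :: "complex set" and n :: nat and \<gamma> :: "nat \<Rightarrow> real \<Rightarrow> complex"
    and \<epsilon> C :: real and \<sigma> :: "nat \<Rightarrow> real"
  assumes dom: "smooth_bdry_domain \<Omega> n \<gamma>"
    and eps: "0 < \<epsilon>" and C_pos: "C > 0" and sgn: "\<bar>\<sigma> k\<bar> = 1"
    and tube_inside: "k < n \<Longrightarrow> 0 < e \<Longrightarrow> e \<le> \<epsilon> \<Longrightarrow> tube (\<gamma> k) t (e * \<sigma> k) \<in> \<Omega>"
    and tube_outside: "k < n \<Longrightarrow> 0 < e \<Longrightarrow> e \<le> \<epsilon> \<Longrightarrow> tube (\<gamma> k) t (- (e * \<sigma> k)) \<notin> closure \<Omega>"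
    and tube_kernel: "k < n \<Longrightarrow> l < n \<Longrightarrow> 0 < e \<Longrightarrow> e \<le> \<epsilon> \<Longrightarrow> t \<in> {0..1} \<Longrightarrow> u \<in> {0..1} \<Longrightarrow>
       cmod (1 / (\<gamma> l u - tube (\<gamma> k) t (e * \<sigma> k)) - 1 / (\<gamma> l u - tube (\<gamma> k) t (- (e * \<sigma> k)))) \<le> C * qk e (u - t)"

text \<open>Each open side strip of \<open>\<gamma> k\<close> is connected and misses the frontier,
  so it lies in the domain or off its closure. Between the two strips only the \<open>k\<close>-th
  winding number changes; hence the sum changes, and as it is 1 inside and 0 outside, the strips are
  of different kinds. For the kernel bound, the difference of the two Cauchy kernels has numerator
  at most \<open>2 * e * D\<close> and, on the same curve, a denominator of at least
  \<open>\<kappa>\<^sup>2 * (e\<^sup>2 + x\<^sup>2)\<close>: a Poisson kernel at height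
  \<open>e\<close>.\<close>

lemma domain_collar:
  assumes dom: "smooth_bdry_domain \<Omega> n \<gamma>"
  obtains \<epsilon> C \<sigma> where "collared_domain \<Omega> n \<gamma> \<epsilon> C \<sigma>"
proof -
  have loops: "regular_loop (\<gamma> k)" if "k < n" for k using domain_loops[OF dom that] .
  have \<Omega>: "open \<Omega>" and fr: "frontier \<Omega> = (\<Union>k<n. \<gamma> k ` {0..1})"
    and win1: "\<And>a. a \<in> \<Omega> \<Longrightarrow> (\<Sum>k<n. winding_number (\<gamma> k) a) = 1"
    and win0: "\<And>a. a \<notin> closure \<Omega> \<Longrightarrow> (\<Sum>k<n. winding_number (\<gamma> k) a) = 0"
    using dom unfolding smooth_bdry_domain_def by auto
  obtain \<kappa> \<epsilon> where \<kappa>: "\<kappa> > 0" and \<epsilon>: "\<epsilon> > 0" "\<epsilon> \<le> 1" and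
    low: "\<And>k t u s. k < n \<Longrightarrow> \<bar>u - t\<bar> \<le> 1/2 \<Longrightarrow> \<bar>s\<bar> \<le> \<epsilon> \<Longrightarrow>
       \<kappa> * sqrt ((u - t)\<^sup>2 + s\<^sup>2) \<le> cmod (\<gamma> k u - tube (\<gamma> k) t s)" and
    sep: "\<And>k l t u s. k < n \<Longrightarrow> l < n \<Longrightarrow> k \<noteq> l \<Longrightarrow> \<bar>s\<bar> \<le> \<epsilon> \<Longrightarrow> \<kappa> \<le> cmod (\<gamma> l u - tube (\<gamma> k) t s)"
    using domain_tubes[OF dom] by blast
  have off: "tube (\<gamma> k) t s \<noteq> \<gamma> l u" if "k < n" "l < n" "s \<noteq> 0 \<or> k \<noteq> l" "\<bar>s\<bar> \<le> \<epsilon>" for k l t s u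
  proof (cases "k = l")
    case True
    \<comment> \<open>\<open>low\<close> compares parameters within half a period only; an integer
      shift reduces the general case to it.\<close>
    obtain m where m: "\<bar>(u - t) + of_int m\<bar> \<le> 1/2" using shift_within_half by blast
    then have "\<bar>(u + of_int m) - t\<bar> \<le> 1/2" by (simp add: algebra_simps)
    from low[OF \<open>k < n\<close> this \<open>\<bar>s\<bar> \<le> \<epsilon>\<close>] have
      "\<kappa> * sqrt ((u + of_int m - t)\<^sup>2 + s\<^sup>2) \<le> cmod (\<gamma> l u - tube (\<gamma> k) t s)"
      using periodic_of_int[of "\<gamma> k" u m] loop_periodic[OF loops[OF \<open>k < n\<close>]] True by simp
    moreover have "0 < \<kappa> * sqrt ((u + of_int m - t)\<^sup>2 + s\<^sup>2)"
      using \<kappa> that(3) True by (simp add: add_nonneg_pos)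
    ultimately show ?thesis by auto
  next
    case False
    then show ?thesis using sep[OF that(1,2) False that(4), of u t] \<kappa> by auto
  qed
  define T where "T k I = (\<lambda>(t, s). tube (\<gamma> k) t s) ` (UNIV \<times> I)" for k and I :: "real set"
  have side: "\<exists>s::real. \<bar>s\<bar> = 1 \<and> (\<forall>t e. 0 < e \<longrightarrow> e \<le> \<epsilon> \<longrightarrow>
      tube (\<gamma> k) t (e * s) \<in> \<Omega> \<and> tube (\<gamma> k) t (- (e * s)) \<notin> closure \<Omega>)" if k: "k < n" for k
  proof -
    let ?P = "T k {0<..\<epsilon>}" and ?N = "T k {-\<epsilon>..<0}"
    have conn: "connected (T k I)" if "convex I" for I
      unfolding T_def by (intro connected_tube_image loops k that)
    have dich: "T k I \<subseteq> \<Omega> \<or> T k I \<inter> closure \<Omega> = {}" if "convex I" "0 \<notin> I" "\<And>s. s \<in> I \<Longrightarrow> \<bar>s\<bar> \<le> \<epsilon>" for I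
    proof -
      have "T k I \<inter> frontier \<Omega> = {}"
      proof (rule equals0I)
        fix x assume "x \<in> T k I \<inter> frontier \<Omega>"
        then obtain t s l u where "s \<in> I" "x = tube (\<gamma> k) t s" "l < n" "x = \<gamma> l u"
          unfolding T_def fr by fast
        then show False using off[of k l s t u] k that by metis
      qed
      moreover from this have "T k I \<inter> \<Omega> = {} \<or> T k I - \<Omega> = {}"
        using connected_Int_frontier[OF conn[OF that(1)]] by blast
      ultimately show ?thesis
        using \<Omega> unfolding frontier_def by (auto simp: interior_open)
    qed
    have dP: "?P \<subseteq> \<Omega> \<or> ?P \<inter> closure \<Omega> = {}" and dN: "?N \<subseteq> \<Omega> \<or> ?N \<inter> closure \<Omega> = {}"
      by (rule dich; auto)+
    define p where "p = tube (\<gamma> k) 0 \<epsilon>"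
    define q where "q = tube (\<gamma> k) 0 (-\<epsilon>)"
    have pq: "p \<in> ?P" "q \<in> ?N"
      unfolding p_def q_def T_def using \<epsilon> by auto
    have "winding_number (\<gamma> k) p \<noteq> winding_number (\<gamma> k) q"
      by (rule winding_number_jump[OF loops[OF k] \<epsilon>(1) _ T_def T_def pq]) (use off k in fastforce)
    moreover have "winding_number (\<gamma> l) p = winding_number (\<gamma> l) q" if l: "l < n" "l \<noteq> k" for l
    proof -
      \<comment> \<open>The full strip, including \<open>\<gamma> k\<close> itself, misses
        \<open>\<gamma> l\<close>; so passing from \<open>p\<close> to \<open>q\<close> does not
        change this winding number.\<close>
      have "T k {-\<epsilon>..\<epsilon>} \<inter> path_image (\<gamma> l) = {}"
      proof (rule equals0I)
        fix x assume "x \<in> T k {-\<epsilon>..\<epsilon>} \<inter> path_image (\<gamma> l)"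
        then obtain t s u where "s \<in> {-\<epsilon>..\<epsilon>}" "x = tube (\<gamma> k) t s" "x = \<gamma> l u"
          unfolding T_def path_image_def by fast
        moreover have "\<bar>s\<bar> \<le> \<epsilon>" using \<open>s \<in> _\<close> by (simp add: abs_le_iff)
        ultimately show False using off[of k l s t u] k l by simp
      qed
      from winding_number_constant[OF loop_simple_path(3,2)[OF loops[OF l(1)]] conn[OF convex_real_interval(5)] this]
      obtain v where "\<And>x. x \<in> T k {-\<epsilon>..\<epsilon>} \<Longrightarrow> winding_number (\<gamma> l) x = v"
        unfolding constant_on_def by blast
      moreover have "p \<in> T k {-\<epsilon>..\<epsilon>}" "q \<in> T k {-\<epsilon>..\<epsilon>}"
        unfolding p_def q_def T_def using \<epsilon> by auto
      ultimately show ?thesis by metis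
    qed
    then have "(\<Sum>l\<in>{..<n}-{k}. winding_number (\<gamma> l) p) = (\<Sum>l\<in>{..<n}-{k}. winding_number (\<gamma> l) q)"
      by (intro sum.cong) auto
    ultimately have "(\<Sum>l<n. winding_number (\<gamma> l) p) \<noteq> (\<Sum>l<n. winding_number (\<gamma> l) q)"
      using k by (simp add: sum.remove[of "{..<n}" k])
    then have "(?P \<subseteq> \<Omega> \<and> ?N \<inter> closure \<Omega> = {}) \<or> (?N \<subseteq> \<Omega> \<and> ?P \<inter> closure \<Omega> = {})"
      using dP dN pq win1 win0 by (metis disjoint_iff subsetD)
    then show ?thesis
    proof
      assume *: "?P \<subseteq> \<Omega> \<and> ?N \<inter> closure \<Omega> = {}"
      have "tube (\<gamma> k) t e \<in> ?P \<and> tube (\<gamma> k) t (- e) \<in> ?N" if "0 < e" "e \<le> \<epsilon>" for t e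
        unfolding T_def using that by auto
      with * show ?thesis by (intro exI[of _ 1]) (simp, blast)
    next
      assume *: "?N \<subseteq> \<Omega> \<and> ?P \<inter> closure \<Omega> = {}"
      have "tube (\<gamma> k) t e \<in> ?P \<and> tube (\<gamma> k) t (- e) \<in> ?N" if "0 < e" "e \<le> \<epsilon>" for t e
        unfolding T_def using that by auto
      with * show ?thesis by (intro exI[of _ "-1"]) (simp, blast)
    qed
  qed
  then obtain \<sigma>' :: "nat \<Rightarrow> real" where \<sigma>': "\<And>k. k < n \<Longrightarrow> \<bar>\<sigma>' k\<bar> = 1 \<and> (\<forall>t e. 0 < e \<longrightarrow> e \<le> \<epsilon> \<longrightarrow>
      tube (\<gamma> k) t (e * \<sigma>' k) \<in> \<Omega> \<and> tube (\<gamma> k) t (- (e * \<sigma>' k)) \<notin> closure \<Omega>)"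
    by metis
  \<comment> \<open>Indices from \<open>n\<close> on get the value 1, because the locale asks for
    \<open>\<bar>\<sigma> k\<bar> = 1\<close> without restriction on \<open>k\<close>.\<close>
  define \<sigma> where "\<sigma> k = (if k < n then \<sigma>' k else 1)" for k
  have \<sigma>: "\<bar>\<sigma> k\<bar> = 1" for k using \<sigma>' by (simp add: \<sigma>_def)
  obtain D where D: "D > 0" "\<And>k t. k < n \<Longrightarrow> cmod (vd (\<gamma> k) t) \<le> D"
    using domain_vd_bound[OF dom] by blast
  have pk_nonneg: "0 \<le> pk e x" if "e > 0" for e x using that by (simp add: pk_def)
  show ?thesis
  \<comment> \<open>\<open>2 * D / \<kappa>\<^sup>2\<close> suffices on the same curve; the
    additional factor 2 pays for different curves, where \<open>qk e\<close> is bounded below by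
    \<open>e / 2\<close>.\<close>
  proof (rule that[of \<epsilon> "4 * D / \<kappa>\<^sup>2" \<sigma>], unfold_locales)
    show "smooth_bdry_domain \<Omega> n \<gamma>" by (rule dom)
    show "4 * D / \<kappa>\<^sup>2 > 0" using D \<kappa> by simp
    fix k l t u e
    assume kl: "k < n" "l < n" and e: "0 < e" "e \<le> \<epsilon>" and tu: "t \<in> {0..1::real}" "u \<in> {0..1::real}"
    let ?w = "tube (\<gamma> k) t (e * \<sigma> k)" and ?w' = "tube (\<gamma> k) t (- (e * \<sigma> k))"
    have \<sigma>e: "\<bar>e * \<sigma> k\<bar> \<le> \<epsilon>" "\<bar>- (e * \<sigma> k)\<bar> \<le> \<epsilon>" "(e * \<sigma> k)\<^sup>2 = e\<^sup>2"
      using \<sigma>[of k] e by (auto simp: abs_mult power_mult_distrib simp flip: power2_abs[of "\<sigma> k"])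
    have "e * \<sigma> k \<noteq> 0" using e \<sigma>[of k] by auto
    then have nz: "\<gamma> l u - ?w \<noteq> 0" "\<gamma> l u - ?w' \<noteq> 0"
      using off[of k l "e * \<sigma> k" t u] off[of k l "- (e * \<sigma> k)" t u] kl \<sigma>e by auto
    have "1 / (\<gamma> l u - ?w) - 1 / (\<gamma> l u - ?w') = (?w - ?w') / ((\<gamma> l u - ?w) * (\<gamma> l u - ?w'))"
      using nz by (simp add: field_simps)
    moreover have "cmod (?w - ?w') \<le> 2 * e * D"
    proof -
      have "cmod (?w - ?w') = 2 * (\<bar>e * \<sigma> k\<bar> * cmod (vd (\<gamma> k) t))"
        unfolding tube_def[OF loops[OF kl(1)]] by (simp add: norm_mult abs_mult flip: mult_2)
      also have "\<dots> = 2 * e * cmod (vd (\<gamma> k) t)" using e \<sigma>[of k] by (simp add: abs_mult)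
      also have "\<dots> \<le> 2 * e * D" using e D kl by (intro mult_left_mono) auto
      finally show ?thesis .
    qed
    ultimately have main: "cmod (1 / (\<gamma> l u - ?w) - 1 / (\<gamma> l u - ?w')) \<le>
        2 * e * D / (cmod (\<gamma> l u - ?w) * cmod (\<gamma> l u - ?w'))"
      by (simp add: norm_divide norm_mult divide_right_mono)
    have "2 * e * D / (cmod (\<gamma> l u - ?w) * cmod (\<gamma> l u - ?w')) \<le> 4 * D / \<kappa>\<^sup>2 * qk e (u - t)"
    proof (cases "k = l")
      case True
      \<comment> \<open>Differences of parameters in \<open>{0..1}\<close> lie in
        \<open>{-1..1}\<close>, so one of three shifts gives the nearest representative. These
        shifts are the three terms of \<open>qk\<close>.\<close>
      have "\<exists>m\<in>{-1, 0, 1::int}. \<bar>u + of_int m - t\<bar> \<le> 1/2"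
      proof -
        have "-1 \<le> u - t" "u - t \<le> 1" using tu by auto
        then consider "\<bar>u - t\<bar> \<le> 1/2" | "\<bar>u - 1 - t\<bar> \<le> 1/2" | "\<bar>u + 1 - t\<bar> \<le> 1/2" by linarith
        then show ?thesis by cases auto
      qed
      then obtain m :: int where m: "m \<in> {-1, 0, 1}" "\<bar>u + of_int m - t\<bar> \<le> 1/2" by blast
      let ?x = "u + of_int m - t"
      let ?r = "sqrt (?x\<^sup>2 + e\<^sup>2)"
      have per: "\<gamma> l u = \<gamma> k (u + of_int m)"
        using periodic_of_int[of "\<gamma> k" u m] loop_periodic[OF loops[OF \<open>k < n\<close>]] True by simp
      have "\<kappa> * ?r \<le> cmod (\<gamma> l u - ?w)" "\<kappa> * ?r \<le> cmod (\<gamma> l u - ?w')"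
        using low[OF kl(1) m(2) \<sigma>e(1)] low[OF kl(1) m(2) \<sigma>e(2)] \<sigma>e(3) per by simp_all
      then have "(\<kappa> * ?r) * (\<kappa> * ?r) \<le> cmod (\<gamma> l u - ?w) * cmod (\<gamma> l u - ?w')"
        using \<kappa> by (intro mult_mono) auto
      moreover have "(\<kappa> * ?r) * (\<kappa> * ?r) = \<kappa>\<^sup>2 * (e\<^sup>2 + ?x\<^sup>2)"
      proof -
        have "?r * ?r = e\<^sup>2 + ?x\<^sup>2"
          by (metis add.commute real_sqrt_pow2 power2_eq_square sum_power2_ge_zero)
        then show ?thesis by (metis power2_eq_square power_mult_distrib)
      qed
      moreover have "0 < \<kappa>\<^sup>2 * (e\<^sup>2 + ?x\<^sup>2)" using \<kappa> e by (simp add: add_pos_nonneg)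
      ultimately have "2 * e * D / (cmod (\<gamma> l u - ?w) * cmod (\<gamma> l u - ?w')) \<le> 2 * e * D / (\<kappa>\<^sup>2 * (e\<^sup>2 + ?x\<^sup>2))"
        using e D by (intro divide_left_mono) auto
      also have "\<dots> = 2 * D / \<kappa>\<^sup>2 * pk e ?x" by (simp add: pk_def)
      also have "\<dots> \<le> 4 * D / \<kappa>\<^sup>2 * qk e (u - t)"
      proof (intro mult_mono)
        show "pk e ?x \<le> qk e (u - t)"
          using m(1) pk_nonneg[OF e(1)] unfolding qk_def
          by (auto simp: algebra_simps add_nonneg_nonneg)
      qed (use D \<kappa> pk_nonneg[OF e(1)] in \<open>auto simp: divide_right_mono\<close>)
      finally show ?thesis .
    next
      case False
      \<comment> \<open>Different curves keep a positive distance, so the difference of the kernels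
        is of order \<open>e\<close>. Since \<open>e\<^sup>2 + (u - t)\<^sup>2 \<le> 2\<close>, a
        Poisson kernel absorbs it.\<close>
      have "\<kappa> * \<kappa> \<le> cmod (\<gamma> l u - ?w) * cmod (\<gamma> l u - ?w')"
        using sep[OF kl False \<sigma>e(1)] sep[OF kl False \<sigma>e(2)] \<kappa> by (intro mult_mono) auto
      then have "2 * e * D / (cmod (\<gamma> l u - ?w) * cmod (\<gamma> l u - ?w')) \<le> 2 * e * D / (\<kappa> * \<kappa>)"
        using e D \<kappa> nz by (intro divide_left_mono) auto
      also have "\<dots> = 4 * D / \<kappa>\<^sup>2 * (e / 2)" by (simp add: power2_eq_square)
      also have "\<dots> \<le> 4 * D / \<kappa>\<^sup>2 * qk e (u - t)"
      proof (intro mult_left_mono)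
        have "e\<^sup>2 \<le> 1" using e \<epsilon> by (simp add: power_le_one)
        moreover have "(u - t)\<^sup>2 \<le> 1\<^sup>2" by (rule abs_le_square_iff[THEN iffD1]) (use tu in auto)
        ultimately have "e / 2 \<le> pk e (u - t)"
          unfolding pk_def using e by (intro divide_left_mono) (auto simp: add_pos_nonneg)
        then show "e / 2 \<le> qk e (u - t)"
          using pk_nonneg[OF e(1), of "u - t + 1"] pk_nonneg[OF e(1), of "u - t - 1"]
          unfolding qk_def by linarith
      qed (use D \<kappa> in auto)
      finally show ?thesis .
    qed
    with main show "cmod (1 / (\<gamma> l u - ?w) - 1 / (\<gamma> l u - ?w')) \<le> 4 * D / \<kappa>\<^sup>2 * qk e (u - t)"
      by linarith
  qed (use \<epsilon> \<sigma> \<sigma>' in \<open>auto simp: \<sigma>_def\<close>)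
qed

section \<open>Cauchy's theorem up to the boundary\<close>

text \<open>The curves are strung together into one closed path: each new curve is reached along a
  connecting path \<open>q\<close> and left along its reverse, and the two passages cancel in every
  integral. A single path for all integrands is essential, since its winding numbers are also read
  off as integrals.\<close>

lemma cycle_to_path:
  fixes c :: "nat \<Rightarrow> real \<Rightarrow> complex"
  assumes S: "open S" "connected S" "S \<noteq> {}"
    and c: "\<And>k. k < n \<Longrightarrow> valid_path (c k)" "\<And>k. k < n \<Longrightarrow> pathfinish (c k) = pathstart (c k)"
      "\<And>k. k < n \<Longrightarrow> path_image (c k) \<subseteq> S"
  shows "\<exists>p. valid_path p \<and> pathfinish p = pathstart p \<and> path_image p \<subseteq> S \<and>
    (\<forall>g. g holomorphic_on S \<longrightarrow> (g has_contour_integral (\<Sum>k<n. contour_integral (c k) g)) p)"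
  using c
proof (induction n)
  case 0
  obtain x where "x \<in> S" using S by blast
  define p where "p = linepath x x"
  have "valid_path p" "pathfinish p = pathstart p" "path_image p \<subseteq> S" "(g has_contour_integral 0) p" for g
    unfolding p_def using \<open>x \<in> S\<close>
    by (rule valid_path_linepath has_contour_integral_trivial | simp)+
  then show ?case by (intro exI[of _ p]) simp
next
  case (Suc n)
  have "\<exists>p. valid_path p \<and> pathfinish p = pathstart p \<and> path_image p \<subseteq> S \<and>
    (\<forall>g. g holomorphic_on S \<longrightarrow> (g has_contour_integral (\<Sum>k<n. contour_integral (c k) g)) p)"
    by (rule Suc.IH) (use Suc.prems in auto)
  then obtain p where p: "valid_path p" "pathfinish p = pathstart p" "path_image p \<subseteq> S"
    "\<And>g. g holomorphic_on S \<Longrightarrow> (g has_contour_integral (\<Sum>k<n. contour_integral (c k) g)) p"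
    by blast
  have cn: "valid_path (c n)" "pathfinish (c n) = pathstart (c n)" "path_image (c n) \<subseteq> S"
    using Suc.prems by auto
  have "pathstart p \<in> S" "pathstart (c n) \<in> S"
    using p(3) cn(3) pathstart_in_path_image by blast+
  then obtain q where q: "polynomial_function q" "path_image q \<subseteq> S" "pathstart q = pathstart p"
      "pathfinish q = pathstart (c n)"
    using connected_open_polynomial_connected[OF S(1,2)] by blast
  have vq: "valid_path q" by (rule valid_path_polynomial_function[OF q(1)])
  let ?r = "p +++ (q +++ (c n +++ reversepath q))"
  have "(g has_contour_integral (\<Sum>k<Suc n. contour_integral (c k) g)) ?r" if g: "g holomorphic_on S" for g
  proof -
    have "(g has_contour_integral contour_integral q g) q" "(g has_contour_integral contour_integral (c n) g) (c n)"
      using contour_integrable_holomorphic_simple[OF g S(1)] vq q cn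
      by (auto intro: has_contour_integral_integral)
    then have "(g has_contour_integral ((\<Sum>k<n. contour_integral (c k) g) +
        (contour_integral q g + (contour_integral (c n) g + - contour_integral q g)))) ?r"
      using p vq cn q g
      by (intro has_contour_integral_join has_contour_integral_reversepath) auto
    then show ?thesis by simp
  qed
  moreover have "valid_path ?r" "pathfinish ?r = pathstart ?r" "path_image ?r \<subseteq> S"
    using p q cn vq by (auto simp: path_image_join valid_path_join)
  ultimately show ?case by blast
qed

text \<open>For \<open>w\<close> outside \<open>S\<close> the function \<open>1 / (x - w)\<close> is
  holomorphic on \<open>S\<close>, so the joined path has the same total winding number about
  \<open>w\<close> as the cycle, namely 0; the homology form of Cauchy's theorem applies to
  it.\<close>

lemma Cauchy_theorem_cycle:
  fixes c :: "nat \<Rightarrow> real \<Rightarrow> complex"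
  assumes S: "open S" "connected S" "S \<noteq> {}"
    and c: "\<And>k. k < n \<Longrightarrow> valid_path (c k)" "\<And>k. k < n \<Longrightarrow> pathfinish (c k) = pathstart (c k)"
      "\<And>k. k < n \<Longrightarrow> path_image (c k) \<subseteq> S"
    and zero: "\<And>w. w \<notin> S \<Longrightarrow> (\<Sum>k<n. winding_number (c k) w) = 0"
    and g: "g holomorphic_on S"
  shows "(\<Sum>k<n. contour_integral (c k) g) = 0"
proof -
  have "\<exists>p. valid_path p \<and> pathfinish p = pathstart p \<and> path_image p \<subseteq> S \<and>
      (\<forall>g. g holomorphic_on S \<longrightarrow> (g has_contour_integral (\<Sum>k<n. contour_integral (c k) g)) p)"
    by (rule cycle_to_path) (use S c in auto)
  then obtain p where p: "valid_path p" "pathfinish p = pathstart p" "path_image p \<subseteq> S"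
    "\<And>g. g holomorphic_on S \<Longrightarrow> (g has_contour_integral (\<Sum>k<n. contour_integral (c k) g)) p"
    by blast
  have "winding_number p w = 0" if "w \<notin> S" for w
  proof -
    have "(\<lambda>x. 1 / (x - w)) holomorphic_on S"
      using that by (intro holomorphic_intros) auto
    then have "winding_number p w = 1 / (2 * pi * \<i>) * (\<Sum>k<n. contour_integral (c k) (\<lambda>x. 1 / (x - w)))"
      using p that by (subst winding_number_valid_path) (auto simp: contour_integral_unique)
    also have "\<dots> = (\<Sum>k<n. winding_number (c k) w)"
      unfolding sum_distrib_left
      by (intro sum.cong refl winding_number_valid_path[symmetric]) (use c that in auto)
    finally show ?thesis using zero[OF that] by simp
  qed
  then have "(g has_contour_integral 0) p"
    using Cauchy_theorem_global[OF S(1) g p(1,2,3)] by blast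
  with p(4)[OF g] show ?thesis by (rule has_contour_integral_unique)
qed

lemma integral_tendsto_param:
  fixes F :: "real \<Rightarrow> real \<Rightarrow> complex"
  assumes "\<epsilon> > 0" "continuous_on ({0..\<epsilon>} \<times> {0..1}) (\<lambda>(e, t). F e t)"
  shows "((\<lambda>e. integral {0..1} (F e)) \<longlongrightarrow> integral {0..1} (F 0)) (at_right 0)"
proof -
  have "continuous_on {0..\<epsilon>} (\<lambda>e. integral (cbox 0 1) (F e))"
    by (rule integral_continuous_on_param) (use assms(2) in \<open>simp add: box_real\<close>)
  then have "((\<lambda>e. integral {0..1} (F e)) \<longlongrightarrow> integral {0..1} (F 0)) (at 0 within {0..\<epsilon>})"
    using assms(1) by (auto simp: continuous_on_def)
  moreover have "at 0 within {0..\<epsilon>} = at_right 0"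
    by (rule at_within_Icc_at_right) fact
  ultimately show ?thesis by simp
qed

section \<open>Shifted curves, Cauchy's theorem and Cauchy's formula\<close>

context collared_domain
begin

lemma loops: "k < n \<Longrightarrow> regular_loop (\<gamma> k)"
  using domain_loops[OF dom] .

lemma open_\<Omega>: "open \<Omega>" and connected_\<Omega>: "connected \<Omega>" and nonempty_\<Omega>: "\<Omega> \<noteq> {}"
  and frontier_\<Omega>: "frontier \<Omega> = (\<Union>k<n. \<gamma> k ` {0..1})"
  and winding_in: "w \<in> \<Omega> \<Longrightarrow> (\<Sum>k<n. winding_number (\<gamma> k) w) = 1"
  and winding_out: "w \<notin> closure \<Omega> \<Longrightarrow> (\<Sum>k<n. winding_number (\<gamma> k) w) = 0"
  using dom unfolding smooth_bdry_domain_def by auto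

text \<open>The sign \<open>\<sigma> k\<close> lets \<open>e > 0\<close> point into the domain
  whatever the orientation of \<open>\<gamma> k\<close>; \<open>sh k (- e) t\<close> is the mirror
  point outside.\<close>

definition sh :: "nat \<Rightarrow> real \<Rightarrow> real \<Rightarrow> complex" where
  "sh k e t = \<gamma> k t + complex_of_real (e * \<sigma> k) * (\<i> * vd (\<gamma> k) t)"

definition dsh :: "nat \<Rightarrow> real \<Rightarrow> real \<Rightarrow> complex" where
  "dsh k e t = vd (\<gamma> k) t + complex_of_real (e * \<sigma> k) * (\<i> * vd (vd (\<gamma> k)) t)"

lemma sh_0 [simp]: "sh k 0 t = \<gamma> k t" "dsh k 0 t = vd (\<gamma> k) t"
  by (simp_all add: sh_def dsh_def)

lemma sh_tube: "k < n \<Longrightarrow> sh k e t = tube (\<gamma> k) t (e * \<sigma> k)"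
  by (simp add: sh_def tube_def[OF loops])

lemma sh_in: "k < n \<Longrightarrow> 0 < e \<Longrightarrow> e \<le> \<epsilon> \<Longrightarrow> sh k e t \<in> \<Omega>"
  by (simp add: sh_tube tube_inside)

lemma sh_out: "k < n \<Longrightarrow> 0 < e \<Longrightarrow> e \<le> \<epsilon> \<Longrightarrow> sh k (-e) t \<notin> closure \<Omega>"
  using tube_outside[of k e t] by (simp add: sh_tube)

lemma bdry_in_frontier: "k < n \<Longrightarrow> \<gamma> k t \<in> frontier \<Omega>"
  using frontier_\<Omega> periodic_range[of "\<gamma> k"] loop_periodic[OF loops, of k] by blast

lemma bdry_notin: "k < n \<Longrightarrow> \<gamma> k t \<notin> \<Omega>"
  using bdry_in_frontier[of k t] open_\<Omega> by (auto simp: frontier_def interior_open)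

lemma sh_closure: "k < n \<Longrightarrow> 0 \<le> e \<Longrightarrow> e \<le> \<epsilon> \<Longrightarrow> sh k e t \<in> closure \<Omega>"
  using sh_in[of k e t] bdry_in_frontier[of k t] closure_subset
  by (cases "e = 0") (auto simp: frontier_def)

lemma sh_cont [continuous_intros]:
  assumes "k < n" "continuous_on A f" "continuous_on A g"
  shows "continuous_on A (\<lambda>x. sh k (f x) (g x))" "continuous_on A (\<lambda>x. dsh k (f x) (g x))"
  unfolding sh_def dsh_def using assms
  by (auto intro!: continuous_intros continuous_on_compose2[OF loop_cont(1)[OF loops, of k UNIV]]
      continuous_on_compose2[OF loop_cont(2)[OF loops, of k UNIV]]
      continuous_on_compose2[OF loop_cont(3)[OF loops, of k UNIV]])

lemma sh_deriv:
  assumes "k < n"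
  shows "(sh k e has_vector_derivative dsh k e t) (at t)"
proof -
  have "((\<lambda>t. \<gamma> k t + complex_of_real (e * \<sigma> k) * (\<i> * vd (\<gamma> k) t)) has_vector_derivative
    vd (\<gamma> k) t + complex_of_real (e * \<sigma> k) * (\<i> * vd (vd (\<gamma> k)) t)) (at t)"
    by (intro has_vector_derivative_add has_vector_derivative_mult_right loop_deriv loop_deriv2 loops assms)
  then show ?thesis by (simp add: sh_def[abs_def] dsh_def)
qed

lemma sh_path:
  assumes "k < n"
  shows "valid_path (sh k e)" "pathfinish (sh k e) = pathstart (sh k e)" "path (sh k e)"
    "contour_integral (sh k e) g = integral {0..1} (\<lambda>t. g (sh k e t) * dsh k e t)"
proof -
  have "sh k e C1_differentiable_on {0..1}"
    unfolding C1_differentiable_on_def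
    by (intro exI[of _ "dsh k e"] conjI ballI sh_deriv assms sh_cont continuous_intros)
  then show "valid_path (sh k e)"
    by (simp add: valid_path_def C1_differentiable_imp_piecewise)
  then show "path (sh k e)" by (rule valid_path_imp_path)
  show "pathfinish (sh k e) = pathstart (sh k e)"
    using loop_periodic[OF loops[OF assms], of 0] loop_vd_periodic[OF loops[OF assms], of 0]
    by (simp add: pathfinish_def pathstart_def sh_def)
  show "contour_integral (sh k e) g = integral {0..1} (\<lambda>t. g (sh k e t) * dsh k e t)"
    by (simp add: contour_integral_integral vector_derivative_at[OF sh_deriv[OF assms]])
qed

lemma sh_0_eq: "sh k 0 = \<gamma> k" by (simp add: fun_eq_iff)

text \<open>For \<open>w\<close> off the closure, pushing the curves inwards along the normals is a
  homotopy that avoids \<open>w\<close>. A frontier point is a limit of outer points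
  \<open>sh l (- s) t\<close>, and near it the winding numbers of the curves inside the domain are
  constant.\<close>

lemma sh_winding:
  assumes e: "0 < e" "e \<le> \<epsilon>" and w: "w \<notin> \<Omega>"
  shows "(\<Sum>k<n. winding_number (sh k e) w) = 0"
proof -
  have out: "(\<Sum>k<n. winding_number (sh k e) p) = 0" if p: "p \<notin> closure \<Omega>" for p
  proof -
    have "winding_number (sh k e) p = winding_number (\<gamma> k) p" if k: "k < n" for k
    proof (rule winding_number_homotopic_loops, rule homotopic_loops_linear)
      show "path (sh k e)" "path (\<gamma> k)" "pathfinish (sh k e) = pathstart (sh k e)" "pathfinish (\<gamma> k) = pathstart (\<gamma> k)"
        using sh_path[OF k, of e] sh_path[OF k, of 0] by (simp_all add: sh_0_eq)
      fix t x
      show "closed_segment (sh k e t) (\<gamma> k t) \<subseteq> - {p}"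
      proof
        fix y assume "y \<in> closed_segment (sh k e t) (\<gamma> k t)"
        then obtain u where u: "0 \<le> u" "u \<le> 1" "y = (1 - u) *\<^sub>R sh k e t + u *\<^sub>R \<gamma> k t"
          by (auto simp: in_segment)
        \<comment> \<open>A point of the connecting segment is itself a shifted point with a smaller
          shift, hence in the closure.\<close>
        then have "y = sh k ((1 - u) * e) t"
          by (simp add: sh_def scaleR_conv_of_real algebra_simps)
        moreover have "0 \<le> (1 - u) * e" using u e by simp
        moreover have "(1 - u) * e \<le> 1 * e" using u e by (intro mult_right_mono) auto
        then have "(1 - u) * e \<le> \<epsilon>" by (rule order_trans) (use e in simp)
        ultimately have "y \<in> closure \<Omega>" using sh_closure[OF k] by simp
        with p show "y \<in> - {p}" by auto
      qed
    qed
    then show ?thesis using winding_out[OF p] by simp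
  qed
  show ?thesis
  proof (cases "w \<in> closure \<Omega>")
    case True
    then have "w \<in> frontier \<Omega>" using w open_\<Omega> by (simp add: frontier_def interior_open)
    then obtain l t where l: "l < n" "w = \<gamma> l t" using frontier_\<Omega> by auto
    define K where "K = (\<Union>k<n. path_image (sh k e))"
    have "compact K" unfolding K_def by (intro compact_UN compact_path_image sh_path) auto
    moreover have "K \<subseteq> \<Omega>" unfolding K_def path_image_def using sh_in e by auto
    ultimately have "open (- K)" "w \<in> - K"
      using w by (auto simp: compact_imp_closed open_Compl)
    then obtain r where r: "r > 0" "ball w r \<inter> K = {}"
      by (metis open_contains_ball disjoint_eq_subset_Compl)
    have "((\<lambda>s. sh l (- s) t) \<longlongrightarrow> sh l (- 0) t) (at_right 0)"
      unfolding sh_def by (intro tendsto_intros)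
    then have "\<forall>\<^sub>F s in at_right 0. dist (sh l (- s) t) w < r"
      using r(1) l by (auto dest: tendstoD)
    moreover have "\<forall>\<^sub>F s in at_right 0. 0 < s \<and> s \<le> \<epsilon>"
      unfolding eventually_at_right_field using eps by (auto intro!: exI[of _ \<epsilon>])
    ultimately have "\<forall>\<^sub>F s in at_right 0. dist (sh l (- s) t) w < r \<and> 0 < s \<and> s \<le> \<epsilon>"
      by eventually_elim auto
    then obtain s where s: "dist (sh l (- s) t) w < r" "0 < s" "s \<le> \<epsilon>"
      using eventually_happens[of _ "at_right (0::real)"] by (metis (lifting) trivial_limit_at_right_real)
    let ?p = "sh l (- s) t"
    have "winding_number (sh k e) w = winding_number (sh k e) ?p" if k: "k < n" for k
    proof -
      have "ball w r \<inter> path_image (sh k e) = {}" using r k unfolding K_def by blast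
      from winding_number_constant[OF sh_path(3)[OF k] sh_path(2)[OF k] convex_connected[OF convex_ball] this]
      obtain v where "\<And>x. x \<in> ball w r \<Longrightarrow> winding_number (sh k e) x = v"
        unfolding constant_on_def by blast
      moreover have "w \<in> ball w r" "?p \<in> ball w r" using r s by (auto simp: dist_commute)
      ultimately show ?thesis by metis
    qed
    then have "(\<Sum>k<n. winding_number (sh k e) w) = (\<Sum>k<n. winding_number (sh k e) ?p)" by simp
    also have "\<dots> = 0" using out sh_out[OF l(1) s(2,3)] by blast
    finally show ?thesis .
  qed (rule out)
qed

lemma Cauchy_shifted:
  assumes "0 < e" "e \<le> \<epsilon>" "g holomorphic_on \<Omega>"
  shows "(\<Sum>k<n. integral {0..1} (\<lambda>t. g (sh k e t) * dsh k e t)) = 0"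
proof -
  have "(\<Sum>k<n. contour_integral (sh k e) g) = 0"
    by (rule Cauchy_theorem_cycle[OF open_\<Omega> connected_\<Omega> nonempty_\<Omega> _ _ _ _ assms(3)])
       (use sh_path sh_in sh_winding assms in \<open>auto simp: path_image_def\<close>)
  then show ?thesis by (simp add: sh_path)
qed

lemma eventually_shift: "\<forall>\<^sub>F e in at_right 0. 0 < e \<and> e \<le> \<epsilon>"
  unfolding eventually_at_right_field using eps by (auto intro!: exI[of _ \<epsilon>])

lemma shifted_integral_tendsto:
  assumes "continuous_on (closure \<Omega>) g"
  shows "((\<lambda>e. \<Sum>k<n. integral {0..1} (\<lambda>t. g (sh k e t) * dsh k e t)) \<longlongrightarrow>
    (\<Sum>k<n. integral {0..1} (\<lambda>t. g (\<gamma> k t) * vd (\<gamma> k) t))) (at_right 0)"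
proof (rule tendsto_sum)
  fix k assume "k \<in> {..<n}"
  then have k: "k < n" by simp
  have "continuous_on ({0..\<epsilon>} \<times> {0..1}) (\<lambda>(e, t). g (sh k e t) * dsh k e t)"
    unfolding case_prod_unfold
    by (intro continuous_intros continuous_on_compose2[OF assms] k) (auto intro!: sh_closure k)
  from integral_tendsto_param[OF eps this]
  show "((\<lambda>e. integral {0..1} (\<lambda>t. g (sh k e t) * dsh k e t)) \<longlongrightarrow>
    integral {0..1} (\<lambda>t. g (\<gamma> k t) * vd (\<gamma> k) t)) (at_right 0)" by simp
qed

lemma Cauchy_boundary:
  assumes "g holomorphic_on \<Omega>" "continuous_on (closure \<Omega>) g"
  shows "(\<Sum>k<n. integral {0..1} (\<lambda>t. g (\<gamma> k t) * vd (\<gamma> k) t)) = 0"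
proof (rule tendsto_unique[OF _ shifted_integral_tendsto[OF assms(2)]])
  show "((\<lambda>e. \<Sum>k<n. integral {0..1} (\<lambda>t. g (sh k e t) * dsh k e t)) \<longlongrightarrow> 0) (at_right 0)"
    by (rule tendsto_eventually)
       (use eventually_shift in eventually_elim, auto intro!: Cauchy_shifted assms)
qed simp

lemma cext_eq:
  "cext n \<gamma> h w = (\<Sum>k<n. integral {0..1} (\<lambda>t. h (\<gamma> k t) * vd (\<gamma> k) t / (\<gamma> k t - w))) / (2 * pi * \<i>)"
proof -
  have "integral {0..1} (\<lambda>t. h (\<gamma> k t) * utan (\<gamma> k) t / (\<gamma> k t - w) * complex_of_real (cmod (vd (\<gamma> k) t)))
    = integral {0..1} (\<lambda>t. h (\<gamma> k t) * vd (\<gamma> k) t / (\<gamma> k t - w))" if "k < n" for k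
    using loop_vd_nz[OF loops[OF that]] by (intro integral_cong) (simp add: utan_def)
  then show ?thesis by (simp add: cext_def bint_def)
qed

lemma winding_integral:
  assumes "w \<in> \<Omega>"
  shows "(\<Sum>k<n. integral {0..1} (\<lambda>t. vd (\<gamma> k) t / (\<gamma> k t - w))) = 2 * pi * \<i>"
proof -
  have "winding_number (\<gamma> k) w = integral {0..1} (\<lambda>t. vd (\<gamma> k) t / (\<gamma> k t - w)) / (2 * pi * \<i>)" if k: "k < n" for k
  proof -
    have "w \<notin> path_image (\<gamma> k)" using bdry_notin[OF k] assms by (auto simp: path_image_def)
    then show ?thesis
      using winding_number_valid_path[of "\<gamma> k" w] sh_path(1)[OF k, of 0]
        sh_path(4)[OF k, of 0 "\<lambda>x. 1 / (x - w)"] by (simp add: sh_0_eq)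
  qed
  then have "1 = (\<Sum>k<n. integral {0..1} (\<lambda>t. vd (\<gamma> k) t / (\<gamma> k t - w)) / (2 * pi * \<i>))"
    using winding_in[OF assms] by simp
  then show ?thesis by (simp add: field_simps flip: sum_divide_distrib)
qed

text \<open>Difference quotient with its removable singularity filled in. It yields Cauchy's formula
  from Cauchy's theorem, and later cancels the poles of the Garabedian kernels.\<close>

definition dq :: "(complex \<Rightarrow> complex) \<Rightarrow> complex \<Rightarrow> complex \<Rightarrow> complex" where
  "dq g w x = (if x = w then deriv g w else (g x - g w) / (x - w))"

lemma dq_holomorphic: "g holomorphic_on \<Omega> \<Longrightarrow> dq g w holomorphic_on \<Omega>"
  unfolding dq_def[abs_def]
proof (cases "w \<in> \<Omega>")
  case False
  assume "g holomorphic_on \<Omega>"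
  then have "(\<lambda>x. (g x - g w) / (x - w)) holomorphic_on \<Omega>"
    using False by (intro holomorphic_intros) auto
  then show "(\<lambda>x. if x = w then deriv g w else (g x - g w) / (x - w)) holomorphic_on \<Omega>"
    by (rule holomorphic_transform) (use False in auto)
qed (use open_\<Omega> pole_lemma_open in blast)

lemma dq_continuous:
  assumes "g holomorphic_on \<Omega>" "continuous_on (closure \<Omega>) g" "w \<in> \<Omega>"
  shows "continuous_on (closure \<Omega>) (dq g w)"
proof -
  have eq: "closure \<Omega> = \<Omega> \<union> (closure \<Omega> - {w})" using assms(3) closure_subset by blast
  have "continuous_on (closure \<Omega> - {w}) (\<lambda>x. (g x - g w) / (x - w))"
    by (intro continuous_intros continuous_on_subset[OF assms(2)]) auto
  then have 1: "continuous_on (closure \<Omega> - {w}) (dq g w)"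
    by (rule continuous_on_eq) (auto simp: dq_def)
  have 2: "continuous_on \<Omega> (dq g w)"
    by (rule holomorphic_on_imp_continuous_on[OF dq_holomorphic[OF assms(1)]])
  show ?thesis
    by (subst eq, rule continuous_on_Un_local_open[OF _ _ 2 1])
       (use open_\<Omega> closure_subset eq in \<open>auto simp: openin_open intro: exI[of _ \<Omega>] exI[of _ "-{w}"]\<close>)
qed

text \<open>Cauchy's theorem for \<open>dq g w\<close>; the term with \<open>g w\<close> contributes
  the total winding number 1.\<close>

lemma Cauchy_formula_boundary:
  assumes "g holomorphic_on \<Omega>" "continuous_on (closure \<Omega>) g" "w \<in> \<Omega>"
  shows "cext n \<gamma> g w = g w"
proof -
  have nw: "\<gamma> k t - w \<noteq> 0" if "k < n" for k t using bdry_notin[OF that] assms(3) by force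
  have gb: "continuous_on A (\<lambda>t. g (\<gamma> k t))" if "k < n" for k A
    using bdry_in_frontier[OF that]
    by (intro continuous_on_compose2[OF assms(2)] loop_cont loops that) (auto simp: frontier_def)
  have "0 = (\<Sum>k<n. integral {0..1} (\<lambda>t. dq g w (\<gamma> k t) * vd (\<gamma> k) t))"
    by (rule Cauchy_boundary[symmetric]) (intro dq_holomorphic dq_continuous assms)+
  also have "\<dots> = (\<Sum>k<n. integral {0..1} (\<lambda>t. g (\<gamma> k t) * vd (\<gamma> k) t / (\<gamma> k t - w)) -
      g w * integral {0..1} (\<lambda>t. vd (\<gamma> k) t / (\<gamma> k t - w)))"
  proof (rule sum.cong[OF refl])
    fix k assume "k \<in> {..<n}"
    then have k: "k < n" by simp
    have "integral {0..1} (\<lambda>t. dq g w (\<gamma> k t) * vd (\<gamma> k) t) =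
      integral {0..1} (\<lambda>t. g (\<gamma> k t) * vd (\<gamma> k) t / (\<gamma> k t - w) - g w * (vd (\<gamma> k) t / (\<gamma> k t - w)))"
      using nw[OF k] by (intro integral_cong) (auto simp: dq_def diff_divide_distrib algebra_simps)
    also have "\<dots> = integral {0..1} (\<lambda>t. g (\<gamma> k t) * vd (\<gamma> k) t / (\<gamma> k t - w)) -
        integral {0..1} (\<lambda>t. g w * (vd (\<gamma> k) t / (\<gamma> k t - w)))"
      by (intro Henstock_Kurzweil_Integration.integral_diff integrable_continuous_interval continuous_intros
          loop_cont loops k gb) (use nw[OF k] in auto)
    finally show "integral {0..1} (\<lambda>t. dq g w (\<gamma> k t) * vd (\<gamma> k) t) =
       integral {0..1} (\<lambda>t. g (\<gamma> k t) * vd (\<gamma> k) t / (\<gamma> k t - w)) -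
      g w * integral {0..1} (\<lambda>t. vd (\<gamma> k) t / (\<gamma> k t - w))"
      by (simp only: Henstock_Kurzweil_Integration.integral_mult_right)
  qed
  also have "\<dots> = (\<Sum>k<n. integral {0..1} (\<lambda>t. g (\<gamma> k t) * vd (\<gamma> k) t / (\<gamma> k t - w))) - g w * (2 * pi * \<i>)"
    by (simp add: sum_subtractf winding_integral[OF assms(3)] flip: sum_distrib_left)
  finally show ?thesis by (simp add: cext_eq)
qed

lemma cext_outside:
  assumes "g holomorphic_on \<Omega>" "continuous_on (closure \<Omega>) g" "w \<notin> closure \<Omega>"
  shows "cext n \<gamma> g w = 0"
proof -
  have "w \<notin> \<Omega>" using assms(3) closure_subset by blast
  have "(\<Sum>k<n. integral {0..1} (\<lambda>t. (\<lambda>x. g x / (x - w)) (\<gamma> k t) * vd (\<gamma> k) t)) = 0"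
    by (rule Cauchy_boundary) (use assms \<open>w \<notin> \<Omega>\<close> in \<open>auto intro!: holomorphic_intros continuous_intros\<close>)
  then show ?thesis by (simp add: cext_eq)
qed

end

section \<open>Boundary values of Hardy space functions\<close>

text \<open>\<open>pk e\<close> is \<open>pi\<close> times the Poisson kernel of the half plane at
  height \<open>e\<close>, the derivative of an arctangent; its mass is thus bounded independently
  of \<open>e\<close>.\<close>

lemma pk_has_integral:
  assumes "e > 0"
  shows "((\<lambda>u. pk e (u + c)) has_integral (arctan ((1 + c) / e) - arctan (c / e))) {0..1}"
proof -
  have "((\<lambda>u. arctan ((u + c) / e)) has_vector_derivative pk e (u + c)) (at u within {0..1})" for u
  proof -
    have "((\<lambda>u. arctan ((u + c) / e)) has_real_derivative inverse (1 + ((u + c) / e)\<^sup>2) * (1 / e)) (at u within {0..1})"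
      using assms by (auto intro!: derivative_eq_intros)
    moreover have "inverse (1 + ((u + c) / e)\<^sup>2) * (1 / e) = pk e (u + c)"
      using assms unfolding pk_def by (simp add: power_divide divide_simps add_nonneg_eq_0_iff power2_eq_square)
    ultimately show ?thesis by (simp add: has_real_derivative_iff_has_vector_derivative)
  qed
  from fundamental_theorem_of_calculus[OF _ this] show ?thesis by simp
qed

lemma qk_cont:
  assumes "e > 0" "continuous_on A f"
  shows "continuous_on A (\<lambda>x. qk e (f x))"
  unfolding qk_def pk_def using assms
  by (intro continuous_intros) (auto simp: add_pos_nonneg intro!: less_imp_neq[symmetric])

lemma qk_nonneg: "e > 0 \<Longrightarrow> qk e x \<ge> 0"
  by (simp add: qk_def pk_def)

lemma qk_minus: "qk e (- x) = qk e x"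
proof -
  have "pk e (- x) = pk e x" "pk e (- x + 1) = pk e (x - 1)" "pk e (- x - 1) = pk e (x + 1)"
    unfolding pk_def by (simp_all add: power2_eq_square algebra_simps)
  then show ?thesis by (simp add: qk_def)
qed

text \<open>Each of the three terms has mass at most \<open>pi\<close>. Both orders of the variables
  are needed: one for the mean-square estimate at a fixed point, the other after exchanging
  integrals.\<close>

lemma qk_integral_le:
  assumes "e > 0"
  shows "integral {0..1} (\<lambda>u. qk e (u - t)) \<le> 3 * pi" "integral {0..1} (\<lambda>u. qk e (t - u)) \<le> 3 * pi"
proof -
  have le: "arctan a - arctan b \<le> pi" for a b
    using arctan_bounded[of a] arctan_bounded[of b] by linarith
  have "((\<lambda>u. pk e (u + (- t)) + pk e (u + (1 - t)) + pk e (u + (- 1 - t))) has_integral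
     (arctan ((1 + (- t)) / e) - arctan ((- t) / e)) + (arctan ((1 + (1 - t)) / e) - arctan ((1 - t) / e))
     + (arctan ((1 + (- 1 - t)) / e) - arctan ((- 1 - t) / e))) {0..1}"
    by (intro has_integral_add pk_has_integral assms)
  moreover have "(\<lambda>u. pk e (u + (- t)) + pk e (u + (1 - t)) + pk e (u + (- 1 - t))) = (\<lambda>u. qk e (u - t))"
    by (auto simp: qk_def algebra_simps)
  ultimately have "integral {0..1} (\<lambda>u. qk e (u - t)) =
     (arctan ((1 + (- t)) / e) - arctan ((- t) / e)) + (arctan ((1 + (1 - t)) / e) - arctan ((1 - t) / e))
     + (arctan ((1 + (- 1 - t)) / e) - arctan ((- 1 - t) / e))" by (simp add: integral_unique)
  then show 1: "integral {0..1} (\<lambda>u. qk e (u - t)) \<le> 3 * pi"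
    using le[of "(1 + (- t)) / e" "(- t) / e"] le[of "(1 + (1 - t)) / e" "(1 - t) / e"]
      le[of "(1 + (- 1 - t)) / e" "(- 1 - t) / e"] by linarith
  have "qk e (t - u) = qk e (u - t)" for u using qk_minus[of e "u - t"] by simp
  with 1 show "integral {0..1} (\<lambda>u. qk e (t - u)) \<le> 3 * pi" by simp
qed

text \<open>Cauchy-Schwarz for the measure with density \<open>q\<close>, obtained by expanding the
  nonnegative integral of \<open>(A * x u - ?m)\<^sup>2 * q u\<close>; \<open>A\<close> need only
  bound the mass.\<close>

lemma weighted_mean_square:
  fixes x q :: "real \<Rightarrow> real"
  assumes c: "continuous_on {0..1} x" "continuous_on {0..1} q" and q: "\<And>u. u \<in> {0..1} \<Longrightarrow> q u \<ge> 0"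
    and A: "A > 0" "integral {0..1} q \<le> A"
  shows "(integral {0..1} (\<lambda>u. x u * q u))\<^sup>2 \<le> A * integral {0..1} (\<lambda>u. (x u)\<^sup>2 * q u)"
proof -
  let ?m = "integral {0..1} (\<lambda>u. x u * q u)" and ?s = "integral {0..1} (\<lambda>u. (x u)\<^sup>2 * q u)"
    and ?Q = "integral {0..1} q"
  have i: "q integrable_on {0..1}" "(\<lambda>u. x u * q u) integrable_on {0..1}" "(\<lambda>u. (x u)\<^sup>2 * q u) integrable_on {0..1}"
    by (intro integrable_continuous_interval continuous_intros c)+
  have "0 \<le> integral {0..1} (\<lambda>u. (A * x u - ?m)\<^sup>2 * q u)"
    by (intro integral_nonneg integrable_continuous_interval continuous_intros c) (use q in auto)
  also have "(\<lambda>u. (A * x u - ?m)\<^sup>2 * q u) = (\<lambda>u. A\<^sup>2 * ((x u)\<^sup>2 * q u) - 2 * A * ?m * (x u * q u) + ?m\<^sup>2 * q u)"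
    by (auto simp: power2_eq_square algebra_simps)
  also have "integral {0..1} \<dots> = A\<^sup>2 * ?s - 2 * A * ?m * ?m + ?m\<^sup>2 * ?Q"
    by (rule integral_unique)
       (intro has_integral_add has_integral_diff has_integral_mult_right integrable_integral i)
  also have "\<dots> \<le> A\<^sup>2 * ?s - 2 * A * ?m * ?m + ?m\<^sup>2 * A"
    using A by (intro add_left_mono mult_left_mono) auto
  also have "\<dots> = A * (A * ?s - ?m\<^sup>2)" by (simp add: power2_eq_square algebra_simps)
  finally show ?thesis using A by (simp add: zero_le_mult_iff)
qed

lemma integral_swap_01:
  fixes F :: "real \<Rightarrow> real \<Rightarrow> real"
  assumes "continuous_on ({0..1} \<times> {0..1}) (\<lambda>(x, y). F x y)"
  shows "integral {0..1} (\<lambda>x. integral {0..1} (F x)) = integral {0..1} (\<lambda>y. integral {0..1} (\<lambda>x. F x y))"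
proof -
  have "cbox (0::real, 0::real) (1, 1) = {0..1} \<times> {0..1}"
    by (metis box_real(2) cbox_Pair_eq)
  then show ?thesis
    using integral_swap_continuous[of 0 0 1 1 F] assms by simp
qed

section \<open>Lebesgue and gauge integrals on the unit interval\<close>

abbreviation "I01 \<equiv> lebesgue_on {0..1::real}"

lemma continuous_square_integrable:
  assumes "continuous_on {0..1} f"
  shows "square_integrable I01 f"
proof -
  have "f \<in> borel_measurable I01"
    by (rule continuous_imp_measurable_on_sets_lebesgue[OF assms]) simp
  moreover have "integrable I01 (\<lambda>x. (cmod (f x))\<^sup>2)"
    by (rule absolutely_integrable_imp_integrable[OF absolutely_integrable_continuous_real])
       (use assms in \<open>auto intro!: continuous_intros\<close>)
  ultimately show ?thesis by (simp add: square_integrable_def)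
qed

lemma continuous_measurable_I01:
  "continuous_on {0..1} f \<Longrightarrow> f \<in> borel_measurable I01"
  by (rule continuous_imp_measurable_on_sets_lebesgue) simp_all

lemma I01_integral:
  fixes f :: "real \<Rightarrow> 'b::euclidean_space"
  assumes "integrable I01 f"
  shows "integral\<^sup>L I01 f = integral {0..1} f" "f integrable_on {0..1}"
  using assms by (simp_all add: lebesgue_integral_eq_integral integrable_on_lebesgue_on)

lemma L2b_square_integrable:
  assumes "L2b n \<gamma> h" "k < n"
  shows "square_integrable I01 (\<lambda>t. h (\<gamma> k t))"
proof -
  have "(\<lambda>t. h (\<gamma> k t)) measurable_on {0..1}" "(\<lambda>t. (cmod (h (\<gamma> k t)))\<^sup>2) integrable_on {0..1}"
    using assms by (auto simp: L2b_def)
  then show ?thesis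
    by (auto simp: square_integrable_def measurable_on_iff_borel_measurable
        intro!: absolutely_integrable_imp_integrable nonnegative_absolutely_integrable_1)
qed

lemma square_integrable_I01_norm:
  assumes "square_integrable I01 f"
  shows "integrable I01 f" "(\<integral>t. cmod (f t) \<partial>I01) \<le> sqrt (sqnorm I01 f)"
proof -
  have one: "square_integrable I01 (\<lambda>t. 1)" by (intro continuous_square_integrable continuous_intros)
  show "integrable I01 f"
    using square_integrable_mult_integrable[OF assms one] by simp
  have "(\<integral>t. (cmod 1)\<^sup>2 \<partial>I01) = 1" by (simp add: measure_restrict_space)
  then have "(\<integral>t. cmod (f t) \<partial>I01)\<^sup>2 \<le> (sqnorm I01 f)"
    using Cauchy_Schwarz_L2[OF assms one] by simp
  then show "(\<integral>t. cmod (f t) \<partial>I01) \<le> sqrt (sqnorm I01 f)"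
    by (rule real_le_rsqrt)
qed

section \<open>Uniform mean-square bounds along the shifted curves\<close>

context collared_domain
begin

lemmas vd_bound = domain_vd_bound[OF dom]

lemma bdry_cont:
  assumes "continuous_on (closure \<Omega>) g" "k < n"
  shows "continuous_on A (\<lambda>t. g (\<gamma> k t))"
  using bdry_in_frontier[OF assms(2)]
  by (intro continuous_on_compose2[OF assms(1)] loop_cont loops assms(2)) (auto simp: frontier_def)

text \<open>A Schur test. \<open>g\<close> at an inner point is an integral of its boundary values
  against a kernel dominated by \<open>C * qk e (u - t)\<close>. The mass in \<open>u\<close> bounds
  the square pointwise by a weighted mean of squares, and the mass in \<open>t\<close> bounds the
  integral of that mean, uniformly in \<open>e\<close>.\<close>

lemma Hardy_bound:
  obtains B where "B > 0" "\<And>g e. g holomorphic_on \<Omega> \<Longrightarrow> continuous_on (closure \<Omega>) g \<Longrightarrow> 0 < e \<Longrightarrow> e \<le> \<epsilon> \<Longrightarrow>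
    (\<Sum>k<n. integral {0..1} (\<lambda>t. (cmod (g (sh k e t)))\<^sup>2)) \<le> B * (\<Sum>k<n. integral {0..1} (\<lambda>t. (cmod (g (\<gamma> k t)))\<^sup>2))"
proof -
  obtain D where D: "D > 0" "\<And>k t. k < n \<Longrightarrow> cmod (vd (\<gamma> k) t) \<le> D" using vd_bound by blast
  \<comment> \<open>\<open>(D * C)\<^sup>2\<close> comes from tangent and kernel,
    \<open>real n\<close> from squaring a sum over the curves, \<open>3 * pi\<close> from the mass
    of \<open>qk\<close>.\<close>
  define B0 where "B0 = (D * C)\<^sup>2 * real n * (3 * pi)"
  have B0: "B0 \<ge> 0" by (simp add: B0_def)
  show ?thesis
  \<comment> \<open>The outer \<open>real n\<close> comes from summing over \<open>k\<close>; the
    \<open>+ 1\<close> makes the constant positive even for \<open>n = 0\<close>.\<close>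
  proof (rule that[of "real n * (B0 * (3 * pi)) + 1"])
    show "real n * (B0 * (3 * pi)) + 1 > 0"
      using B0 by (simp add: add_nonneg_pos)
    fix g and e :: real
    assume g: "g holomorphic_on \<Omega>" "continuous_on (closure \<Omega>) g" and e: "0 < e" "e \<le> \<epsilon>"
    let ?q = "\<lambda>l t. integral {0..1} (\<lambda>u. (cmod (g (\<gamma> l u)))\<^sup>2 * qk e (u - t))"
    let ?N = "\<Sum>l<n. integral {0..1} (\<lambda>u. (cmod (g (\<gamma> l u)))\<^sup>2)"
    have gc: "continuous_on A (\<lambda>t. g (\<gamma> k t))" if "k < n" for k A by (rule bdry_cont[OF g(2) that])
    have qc: "continuous_on A (\<lambda>u. qk e (u - t))" "continuous_on A (\<lambda>u. qk e (t - u))" for t A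
      by (intro qk_cont e continuous_intros)+
    have ptw: "(cmod (g (sh k e t)))\<^sup>2 \<le> B0 * (\<Sum>l<n. ?q l t)"
      if k: "k < n" and t: "t \<in> {0..1}" for k t
    proof -
      let ?w = "sh k e t" and ?w' = "sh k (- e) t"
      let ?c = "\<lambda>l w. integral {0..1} (\<lambda>u. g (\<gamma> l u) * vd (\<gamma> l) u / (\<gamma> l u - w))"
        and ?d = "\<lambda>l u. g (\<gamma> l u) * vd (\<gamma> l) u * (1 / (\<gamma> l u - ?w) - 1 / (\<gamma> l u - ?w'))"
      have w: "?w \<in> \<Omega>" "?w' \<notin> closure \<Omega>" using sh_in sh_out k e by auto
      have nz: "\<gamma> l u - ?w \<noteq> 0" "\<gamma> l u - ?w' \<noteq> 0" if "l < n" for l u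
        using bdry_in_frontier[OF that, of u] bdry_notin[OF that, of u] w by (auto simp: frontier_def)
      have "g ?w = cext n \<gamma> g ?w - cext n \<gamma> g ?w'"
        using Cauchy_formula_boundary[OF g w(1)] cext_outside[OF g w(2)] by simp
      also have "\<dots> = (\<Sum>l<n. ?c l ?w -
           ?c l ?w') / (2 * pi * \<i>)"
        by (simp add: cext_eq sum_subtractf diff_divide_distrib)
      finally have "cmod (g ?w) = cmod (\<Sum>l<n. ?c l ?w -
           ?c l ?w') / (2 * pi)" (is "_ = cmod ?S / _")
        by (simp add: norm_divide norm_mult)
      also have "\<dots> \<le> cmod ?S / 1" using pi_gt3 by (intro divide_left_mono) auto
      also have "\<dots> \<le> (\<Sum>l<n. D * C * integral {0..1} (\<lambda>u. cmod (g (\<gamma> l u)) * qk e (u - t)))"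
        unfolding div_by_1
      proof (rule sum_norm_le)
        fix l assume "l \<in> {..<n}"
        then have l: "l < n" by simp
        have "?c l ?w -
           ?c l ?w' =
           integral {0..1} (\<lambda>u. g (\<gamma> l u) * vd (\<gamma> l) u / (\<gamma> l u - ?w) - g (\<gamma> l u) * vd (\<gamma> l) u / (\<gamma> l u - ?w'))"
          by (intro Henstock_Kurzweil_Integration.integral_diff[symmetric] integrable_continuous_interval
              continuous_intros gc loop_cont loops l) (use nz[OF l] in auto)
        also have "\<dots> = integral {0..1} (?d l)"
          by (simp add: right_diff_distrib)
        finally have eq: "?c l ?w -
           ?c l ?w' =
           integral {0..1} (?d l)" .
        have "cmod (integral {0..1} (?d l))
          \<le> integral {0..1} (\<lambda>u. D * C * (cmod (g (\<gamma> l u)) * qk e (u - t)))"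
        proof (rule integral_norm_bound_integral)
          show "?d l integrable_on {0..1}"
            by (intro integrable_continuous_interval continuous_intros gc loop_cont loops l) (use nz[OF l] in auto)
          show "(\<lambda>u. D * C * (cmod (g (\<gamma> l u)) * qk e (u - t))) integrable_on {0..1}"
            by (intro integrable_continuous_interval continuous_intros gc qc l)
          fix u :: real assume u: "u \<in> {0..1}"
          have "cmod (1 / (\<gamma> l u - ?w) - 1 / (\<gamma> l u - ?w')) \<le> C * qk e (u - t)"
            using tube_kernel[OF k l e t u] k by (simp add: sh_tube)
          then have "cmod (g (\<gamma> l u)) * cmod (vd (\<gamma> l) u) * cmod (1 / (\<gamma> l u - ?w) - 1 / (\<gamma> l u - ?w'))
            \<le> cmod (g (\<gamma> l u)) * D * (C * qk e (u - t))"
            using D l by (intro mult_mono) auto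
          then show "cmod (g (\<gamma> l u) * vd (\<gamma> l) u * (1 / (\<gamma> l u - ?w) - 1 / (\<gamma> l u - ?w')))
            \<le> D * C * (cmod (g (\<gamma> l u)) * qk e (u - t))"
            by (simp only: norm_mult mult_ac)
        qed
        then show "cmod (?c l ?w -
           ?c l ?w')
           \<le> D * C * integral {0..1} (\<lambda>u. cmod (g (\<gamma> l u)) * qk e (u - t))"
          by (simp only: eq Henstock_Kurzweil_Integration.integral_mult_right)
      qed
      finally have "cmod (g ?w) \<le> (\<Sum>l<n. D * C * integral {0..1} (\<lambda>u. cmod (g (\<gamma> l u)) * qk e (u - t)))" .
      then have "(cmod (g ?w))\<^sup>2 \<le> (\<Sum>l<n. D * C * integral {0..1} (\<lambda>u. cmod (g (\<gamma> l u)) * qk e (u - t)))\<^sup>2"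
        by (intro power_mono) auto
      also have "\<dots> = (D * C)\<^sup>2 * (\<Sum>l<n. integral {0..1} (\<lambda>u. cmod (g (\<gamma> l u)) * qk e (u - t)))\<^sup>2"
        by (simp add: power_mult_distrib flip: sum_distrib_left)
      also have "\<dots> \<le> (D * C)\<^sup>2 * ((\<Sum>l<n. (integral {0..1} (\<lambda>u. cmod (g (\<gamma> l u)) * qk e (u - t)))\<^sup>2) * real n)"
        using sum_squared_le_sum_of_squares[of "\<lambda>l. integral {0..1} (\<lambda>u. cmod (g (\<gamma> l u)) * qk e (u - t))" "{..<n}"]
        by (intro mult_left_mono) auto
      also have "\<dots> \<le> (D * C)\<^sup>2 * ((\<Sum>l<n. 3 * pi * ?q l t) * real n)"
        by (intro mult_left_mono mult_right_mono sum_mono weighted_mean_square qk_integral_le e qk_nonneg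
            continuous_intros gc qc) auto
      also have "\<dots> = B0 * (\<Sum>l<n. ?q l t)"
        by (simp add: B0_def mult_ac flip: sum_distrib_left)
      finally show ?thesis .
    qed
    have jc: "continuous_on ({0..1} \<times> {0..1}) (\<lambda>(t, u). (cmod (g (\<gamma> l u)))\<^sup>2 * qk e (u - t))" if l: "l < n" for l
      unfolding case_prod_unfold
      by (intro continuous_intros qk_cont e continuous_on_compose2[OF gc[OF l, of UNIV]]) auto
    have ic: "(\<lambda>t. ?q l t) integrable_on {0..1}" if l: "l < n" for l
    proof -
      have "continuous_on {0..1} (\<lambda>t. integral (cbox 0 1) (\<lambda>u. (cmod (g (\<gamma> l u)))\<^sup>2 * qk e (u - t)))"
        by (rule integral_continuous_on_param) (use jc[OF l] in simp)
      then show ?thesis by (auto intro: integrable_continuous_interval)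
    qed
    have "integral {0..1} (\<lambda>t. (cmod (g (sh k e t)))\<^sup>2) \<le> B0 * (3 * pi) * ?N" if k: "k < n" for k
    proof -
      have "continuous_on {0..1} (\<lambda>t. g (sh k e t))"
        by (rule continuous_on_compose2[OF g(2)]) (use sh_closure k e in \<open>auto intro!: continuous_intros\<close>)
      then have "integral {0..1} (\<lambda>t. (cmod (g (sh k e t)))\<^sup>2) \<le>
          integral {0..1} (\<lambda>t. B0 * (\<Sum>l<n. ?q l t))"
        by (intro integral_le integrable_continuous_interval[where f = "\<lambda>t. (cmod (g (sh k e t)))\<^sup>2"] continuous_intros
            integrable_on_mult_right integrable_sum ic ptw k) auto
      also have "\<dots> = B0 * (\<Sum>l<n. integral {0..1} (\<lambda>t. ?q l t))"
        unfolding Henstock_Kurzweil_Integration.integral_mult_right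
        by (subst Henstock_Kurzweil_Integration.integral_sum) (use ic in auto)
      also have "\<dots> \<le> B0 * (\<Sum>l<n. 3 * pi * integral {0..1} (\<lambda>u. (cmod (g (\<gamma> l u)))\<^sup>2))"
      proof (intro mult_left_mono sum_mono B0)
        fix l assume "l \<in> {..<n}"
        then have l: "l < n" by simp
        \<comment> \<open>Exchanging the integrals leaves an inner integral of \<open>qk\<close>
          over \<open>t\<close>, again at most \<open>3 * pi\<close>.\<close>
        have "integral {0..1} (\<lambda>t. ?q l t) =
          integral {0..1} (\<lambda>u. integral {0..1} (\<lambda>t. (cmod (g (\<gamma> l u)))\<^sup>2 * qk e (u - t)))"
          by (rule integral_swap_01[OF jc[OF l]])
        also have "\<dots> = integral {0..1} (\<lambda>u. (cmod (g (\<gamma> l u)))\<^sup>2 * integral {0..1} (\<lambda>t. qk e (u - t)))"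
          by simp
        also have "\<dots> \<le> integral {0..1} (\<lambda>u. (cmod (g (\<gamma> l u)))\<^sup>2 * (3 * pi))"
        proof (rule integral_le)
          have "continuous_on {0..1} (\<lambda>u. integral (cbox 0 1) (\<lambda>t. qk e (u - t)))"
            by (rule integral_continuous_on_param)
               (auto simp: case_prod_unfold intro!: qk_cont e continuous_intros)
          then show "(\<lambda>u. (cmod (g (\<gamma> l u)))\<^sup>2 * integral {0..1} (\<lambda>t. qk e (u - t))) integrable_on {0..1}"
            by (auto intro!: integrable_continuous_interval continuous_intros gc l)
          show "(\<lambda>u. (cmod (g (\<gamma> l u)))\<^sup>2 * (3 * pi)) integrable_on {0..1}"
            by (intro integrable_continuous_interval continuous_intros gc l)
        qed (use qk_integral_le[OF e(1)] in \<open>auto intro!: mult_left_mono\<close>)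
        finally show "integral {0..1} (\<lambda>t. ?q l t)
          \<le> 3 * pi * integral {0..1} (\<lambda>u. (cmod (g (\<gamma> l u)))\<^sup>2)" by (simp add: mult.commute)
      qed
      also have "\<dots> = B0 * (3 * pi) * ?N" by (simp add: mult.assoc flip: sum_distrib_left)
      finally show ?thesis .
    qed
    then have "(\<Sum>k<n. integral {0..1} (\<lambda>t. (cmod (g (sh k e t)))\<^sup>2)) \<le> (\<Sum>k<n. B0 * (3 * pi) * ?N)"
      by (intro sum_mono) auto
    also have "\<dots> = real n * (B0 * (3 * pi)) * ?N" by simp
    also have "\<dots> \<le> (real n * (B0 * (3 * pi)) + 1) * ?N"
      by (intro mult_right_mono sum_nonneg Henstock_Kurzweil_Integration.integral_nonneg
            integrable_continuous_interval continuous_intros gc) auto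
    finally show "(\<Sum>k<n. integral {0..1} (\<lambda>t. (cmod (g (sh k e t)))\<^sup>2)) \<le> (real n * (B0 * (3 * pi)) + 1) * ?N" .
  qed
qed

end

section \<open>Convergence of Hardy space functions to their boundary values\<close>

lemma null_multiplier_imp_L2_null:
  assumes "null_multiplier I01 F b"
  shows "L2_null I01 F b"
  using L2_null_mult_bounded[OF assms L2_bounded_const[of I01 "\<lambda>_. 1"]]
  by (simp add: continuous_square_integrable)

text \<open>Joint continuity on a compact rectangle that includes \<open>e = 0\<close> is uniform
  continuity, so the convergence is uniform in \<open>t\<close>.\<close>

lemma uniform_tendsto_param:
  fixes F :: "real \<Rightarrow> real \<Rightarrow> complex"
  assumes "\<epsilon> > 0" "continuous_on ({0..\<epsilon>} \<times> {0..1}) (\<lambda>(e, t). F e t)"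
  shows "null_multiplier I01 (at_right 0) (\<lambda>e t. F e t - F 0 t)"
  unfolding null_multiplier_def
proof (intro allI impI)
  fix \<eta> :: real assume \<eta>: "\<eta> > 0"
  have "uniformly_continuous_on ({0..\<epsilon>} \<times> {0..1}) (\<lambda>(e, t). F e t)"
    by (rule compact_uniformly_continuous[OF assms(2)]) (intro compact_Times compact_Icc)
  then obtain d where d: "d > 0" "\<And>x y. x \<in> {0..\<epsilon>} \<times> {0..1} \<Longrightarrow> y \<in> {0..\<epsilon>} \<times> {0..1} \<Longrightarrow> dist y x < d \<Longrightarrow>
      dist ((\<lambda>(e, t). F e t) y) ((\<lambda>(e, t). F e t) x) < \<eta>"
    using \<eta> unfolding uniformly_continuous_on_def by metis
  have "F e \<in> borel_measurable I01" if "e \<in> {0..\<epsilon>}" for e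
  proof (rule continuous_measurable_I01)
    have "continuous_on {0..1} (\<lambda>t. (\<lambda>(e, t). F e t) (e, t))"
      by (rule continuous_on_compose2[OF assms(2)]) (use that in \<open>auto intro!: continuous_intros\<close>)
    then show "continuous_on {0..1} (F e)" by simp
  qed
  moreover have "cmod (F e t - F 0 t) \<le> \<eta>" if "0 < e" "e < min d \<epsilon>" "t \<in> {0..1}" for e t
    using d(2)[of "(0, t)" "(e, t)"] that assms(1) by (simp add: dist_Pair_Pair dist_norm)
  ultimately show "\<forall>\<^sub>F e in at_right 0. (\<lambda>t. F e t - F 0 t) \<in> borel_measurable I01 \<and>
      (\<forall>t\<in>space I01. cmod (F e t - F 0 t) \<le> \<eta>)"
    unfolding eventually_at_right_field using d(1) assms(1)
    by (intro exI[of _ "min d \<epsilon>"]) (auto intro!: borel_measurable_diff)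
qed

lemma AinfD:
  assumes "g \<in> Ainf \<Omega>"
  shows "g holomorphic_on \<Omega>" "continuous_on (closure \<Omega>) g"
  using assms by (auto simp: Ainf_def)

context collared_domain
begin

lemma away_from_boundary:
  assumes "compact K" "K \<subseteq> \<Omega>"
  obtains d where "d > 0" "\<And>k t w. k < n \<Longrightarrow> w \<in> K \<Longrightarrow> d \<le> cmod (\<gamma> k t - w)"
proof -
  have "K \<inter> frontier \<Omega> = {}" using assms open_\<Omega> by (auto simp: frontier_def interior_open)
  then obtain d where "d > 0" "\<forall>x\<in>K. \<forall>y\<in>frontier \<Omega>. d \<le> dist x y"
    using separate_compact_closed[OF assms(1), of "frontier \<Omega>"] by auto
  with that[of d] show ?thesis
    using bdry_in_frontier by (metis dist_norm norm_minus_commute)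
qed

lemma Cauchy_kernel_square_integrable:
  assumes "square_integrable I01 (\<lambda>t. u (\<gamma> k t))" "k < n"
    and d: "d > 0" "\<And>t. d \<le> cmod (\<gamma> k t - w)"
    and D: "\<And>t. cmod (vd (\<gamma> k) t) \<le> D"
  shows "square_integrable I01 (\<lambda>t. u (\<gamma> k t) * vd (\<gamma> k) t / (\<gamma> k t - w))"
    and "cmod (integral {0..1} (\<lambda>t. u (\<gamma> k t) * vd (\<gamma> k) t / (\<gamma> k t - w))) \<le>
       D / d * sqrt (sqnorm I01 (\<lambda>t. u (\<gamma> k t)))"
proof -
  have nz: "\<gamma> k t - w \<noteq> 0" for t using d(2)[of t] d(1) by auto
  have D0: "0 \<le> D" using D[of 0] norm_ge_zero order_trans by blast
  have b: "cmod (vd (\<gamma> k) t / (\<gamma> k t - w)) \<le> D / d" for t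
    unfolding norm_divide using d D D0 by (intro frac_le) auto
  have bm: "(\<lambda>t. vd (\<gamma> k) t / (\<gamma> k t - w)) \<in> borel_measurable I01"
    by (intro continuous_measurable_I01 continuous_intros loop_cont loops assms) (use nz in auto)
  have "square_integrable I01 (\<lambda>t. vd (\<gamma> k) t / (\<gamma> k t - w) * u (\<gamma> k t))"
    by (rule square_integrable_bounded_mult(1)[OF assms(1) bm b])
  then show sq: "square_integrable I01 (\<lambda>t. u (\<gamma> k t) * vd (\<gamma> k) t / (\<gamma> k t - w))"
    by (simp add: mult.commute)
  have "integral {0..1} (\<lambda>t. u (\<gamma> k t) * vd (\<gamma> k) t / (\<gamma> k t - w)) =
    (\<integral>t. u (\<gamma> k t) * vd (\<gamma> k) t / (\<gamma> k t - w) \<partial>I01)"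
    using I01_integral[OF square_integrable_I01_norm(1)[OF sq]] by simp
  also have "cmod (\<integral>t. u (\<gamma> k t) * vd (\<gamma> k) t / (\<gamma> k t - w) \<partial>I01) \<le>
      (\<integral>t. D / d * cmod (u (\<gamma> k t)) \<partial>I01)"
  proof (rule Bochner_Integration.integral_norm_bound_integral)
    show "cmod (u (\<gamma> k t) * vd (\<gamma> k) t / (\<gamma> k t - w)) \<le> D / d * cmod (u (\<gamma> k t))" for t
      using mult_left_mono[OF b[of t], of "cmod (u (\<gamma> k t))"] by (simp add: norm_mult norm_divide mult.commute)
  qed (use square_integrable_I01_norm(1)[OF sq] square_integrable_I01_norm(1)[OF assms(1)] in auto)
  also have "\<dots> = D / d * (\<integral>t. cmod (u (\<gamma> k t)) \<partial>I01)"
    by (rule Bochner_Integration.integral_mult_right_zero)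
  also have "\<dots> \<le> D / d * sqrt (sqnorm I01 (\<lambda>t. u (\<gamma> k t)))"
    by (intro mult_left_mono square_integrable_I01_norm(2) assms(1)) (use d D0 in auto)
  finally show "cmod (integral {0..1} (\<lambda>t. u (\<gamma> k t) * vd (\<gamma> k) t / (\<gamma> k t - w))) \<le>
       D / d * sqrt (sqnorm I01 (\<lambda>t. u (\<gamma> k t)))" .
qed

text \<open>Evaluation of the Cauchy integral at \<open>w\<close> is continuous in the boundary
  \<open>L^2\<close> norm, with a constant depending on \<open>w\<close> only through its distance
  to the curves.\<close>

lemma cext_diff_bound:
  assumes u: "\<And>k. k < n \<Longrightarrow> square_integrable I01 (\<lambda>t. u (\<gamma> k t))"
    and v: "\<And>k. k < n \<Longrightarrow> square_integrable I01 (\<lambda>t. v (\<gamma> k t))"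
    and d: "d > 0" "\<And>k t. k < n \<Longrightarrow> d \<le> cmod (\<gamma> k t - w)"
    and D: "\<And>k t. k < n \<Longrightarrow> cmod (vd (\<gamma> k) t) \<le> D"
  shows "cmod (cext n \<gamma> u w - cext n \<gamma> v w) \<le> D / d * (\<Sum>k<n. sqrt (sqnorm I01 (\<lambda>t. u (\<gamma> k t) - v (\<gamma> k t))))"
proof -
  let ?f = "\<lambda>k u. integral {0..1} (\<lambda>t. u (\<gamma> k t) * vd (\<gamma> k) t / (\<gamma> k t - w))"
  have eq: "?f k u - ?f k v = ?f k (\<lambda>x. u x - v x)" if k: "k < n" for k
  proof -
    have i: "(\<lambda>t. u (\<gamma> k t) * vd (\<gamma> k) t / (\<gamma> k t - w)) integrable_on {0..1}"
      "(\<lambda>t. v (\<gamma> k t) * vd (\<gamma> k) t / (\<gamma> k t - w)) integrable_on {0..1}"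
      by (rule I01_integral(2)[OF square_integrable_I01_norm(1)[OF Cauchy_kernel_square_integrable(1)[OF _ k d(1) d(2)[OF k] D[OF k]]]];
          use u v k in simp)+
    show ?thesis
      by (simp add: Henstock_Kurzweil_Integration.integral_diff[OF i, symmetric] diff_divide_distrib left_diff_distrib)
  qed
  have "cext n \<gamma> u w - cext n \<gamma> v w = (\<Sum>k<n. ?f k u - ?f k v) / (2 * pi * \<i>)"
    by (simp add: cext_eq sum_subtractf diff_divide_distrib)
  then have "cmod (cext n \<gamma> u w - cext n \<gamma> v w) = cmod (\<Sum>k<n. ?f k u - ?f k v) / (2 * pi)"
    by (simp add: norm_divide norm_mult)
  also have "\<dots> \<le> cmod (\<Sum>k<n. ?f k u - ?f k v) / 1"
    using pi_gt3 by (intro divide_left_mono) auto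
  also have "\<dots> \<le> (\<Sum>k<n. D / d * sqrt (sqnorm I01 (\<lambda>t. u (\<gamma> k t) - v (\<gamma> k t))))"
    unfolding div_by_1
  proof (rule sum_norm_le)
    fix k assume "k \<in> {..<n}"
    then have k: "k < n" by simp
    show "cmod (?f k u - ?f k v) \<le> D / d * sqrt (sqnorm I01 (\<lambda>t. u (\<gamma> k t) - v (\<gamma> k t)))"
      unfolding eq[OF k]
      by (rule Cauchy_kernel_square_integrable(2)[where u = "\<lambda>x. u x - v x", OF _ k d(1) d(2)[OF k] D[OF k]])
         (rule square_integrable_diff[OF u[OF k] v[OF k]])
  qed
  finally show ?thesis by (simp add: sum_distrib_left)
qed

lemma bdry_square_integrable:
  "continuous_on (closure \<Omega>) g \<Longrightarrow> k < n \<Longrightarrow> square_integrable I01 (\<lambda>t. g (\<gamma> k t))"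
  by (intro continuous_square_integrable bdry_cont)

lemma H2_square_integrable:
  "h \<in> H2 \<Omega> n \<gamma> \<Longrightarrow> k < n \<Longrightarrow> square_integrable I01 (\<lambda>t. h (\<gamma> k t))"
  by (rule L2b_square_integrable) (auto simp: H2_def)

text \<open>\<open>H2\<close> measures approximation by arc length over all curves at once. The
  summands are nonnegative and the speed is bounded below on each curve, so the approximation also
  holds in the parameter, curve by curve.\<close>

lemma H2_approx:
  assumes "h \<in> H2 \<Omega> n \<gamma>"
  obtains G where "\<And>j. G j \<in> Ainf \<Omega>" "\<And>k. k < n \<Longrightarrow> L2_null I01 sequentially (\<lambda>j t. G j (\<gamma> k t) - h (\<gamma> k t))"
proof -
  obtain G where G: "\<And>j. G j \<in> Ainf \<Omega>"
    "(\<lambda>j. bint n \<gamma> (\<lambda>z T. complex_of_real ((cmod (G j z - h z))\<^sup>2))) \<longlonglongrightarrow> 0"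
    using assms unfolding H2_def by blast
  let ?I = "\<lambda>k j. \<integral>t. (cmod (G j (\<gamma> k t) - h (\<gamma> k t)))\<^sup>2 * cmod (vd (\<gamma> k) t) \<partial>I01"
  have sq: "square_integrable I01 (\<lambda>t. G j (\<gamma> k t) - h (\<gamma> k t))" if "k < n" for k j
    by (intro square_integrable_diff H2_square_integrable assms that bdry_square_integrable AinfD G)
  have int: "integrable I01 (\<lambda>t. (cmod (G j (\<gamma> k t) - h (\<gamma> k t)))\<^sup>2 * cmod (vd (\<gamma> k) t))" if k: "k < n" for k j
  proof -
    obtain D where D: "D > 0" "\<And>k t. k < n \<Longrightarrow> cmod (vd (\<gamma> k) t) \<le> D" using vd_bound by blast
    have [measurable]: "(\<lambda>t. G j (\<gamma> k t) - h (\<gamma> k t)) \<in> borel_measurable I01" "vd (\<gamma> k) \<in> borel_measurable I01"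
      using sq[OF k] continuous_measurable_I01[OF loop_cont(2)[OF loops[OF k]]] by (auto simp: square_integrable_def)
    show ?thesis
      by (rule Bochner_Integration.integrable_bound[where f = "\<lambda>t. D * (cmod (G j (\<gamma> k t) - h (\<gamma> k t)))\<^sup>2"])
         (use sq[OF k] D k in \<open>auto simp: square_integrable_def norm_mult mult.commute[of D] intro!: mult_left_mono\<close>)
  qed
  have "bint n \<gamma> (\<lambda>z T. complex_of_real ((cmod (G j z - h z))\<^sup>2)) = complex_of_real (\<Sum>k<n. ?I k j)" for j
  proof -
    have "integral {0..1} (\<lambda>t. complex_of_real ((cmod (G j (\<gamma> k t) - h (\<gamma> k t)))\<^sup>2) * complex_of_real (cmod (vd (\<gamma> k) t)))
      = complex_of_real (?I k j)" if k: "k < n" for k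
    proof -
      have "((\<lambda>t. complex_of_real ((cmod (G j (\<gamma> k t) - h (\<gamma> k t)))\<^sup>2 * cmod (vd (\<gamma> k) t))) has_integral complex_of_real (?I k j)) {0..1}"
        using I01_integral[OF int[OF k]] by (intro has_integral_of_real) (auto simp: has_integral_iff)
      then show ?thesis by (simp add: integral_unique)
    qed
    then show ?thesis unfolding bint_def by simp
  qed
  then have "(\<lambda>j. complex_of_real (\<Sum>k<n. ?I k j)) \<longlonglongrightarrow> complex_of_real 0" using G(2) by simp
  then have lim: "(\<lambda>j. \<Sum>k<n. ?I k j) \<longlonglongrightarrow> 0" by (simp only: tendsto_of_real_iff)
  show ?thesis
  proof (rule that[OF G(1)])
    fix k assume k: "k < n"
    obtain m where m: "m > 0" "\<And>t. m \<le> cmod (vd (\<gamma> k) t)"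
      using periodic_lower_bound[of "vd (\<gamma> k)"] loop_vd_periodic loop_cont loop_vd_nz loops[OF k] by metis
    have "(sqnorm I01 (\<lambda>t. G j (\<gamma> k t) - h (\<gamma> k t))) \<le> 1 / m * (\<Sum>k<n. ?I k j)" for j
    proof -
      have "m * (sqnorm I01 (\<lambda>t. G j (\<gamma> k t) - h (\<gamma> k t))) = (\<integral>t. m * (cmod (G j (\<gamma> k t) - h (\<gamma> k t)))\<^sup>2 \<partial>I01)"
        by simp
      also have "\<dots> \<le> ?I k j"
        using sq[OF k] int[OF k] m
        by (intro integral_mono) (auto simp: square_integrable_def mult.commute[of m] intro!: mult_left_mono)
      also have "\<dots> \<le> (\<Sum>k<n. ?I k j)" using k by (intro member_le_sum) auto
      finally show ?thesis using m by (simp add: field_simps)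
    qed
    moreover have lim2: "(\<lambda>j. 1 / m * (\<Sum>k<n. ?I k j)) \<longlonglongrightarrow> 0"
      by (rule tendsto_mult_right_zero[OF lim])
    ultimately have "(\<lambda>j. sqnorm I01 (\<lambda>t. G j (\<gamma> k t) - h (\<gamma> k t))) \<longlonglongrightarrow> 0"
      by (intro Lim_null_comparison[OF always_eventually lim2]) simp
    then show "L2_null I01 sequentially (\<lambda>j t. G j (\<gamma> k t) - h (\<gamma> k t))"
      using sq[OF k] by (simp add: L2_null_def)
  qed
qed

text \<open>The approximants equal their own Cauchy integrals, so the \<open>L^2\<close> error on
  the boundary controls the sup error on any compact set inside.\<close>

lemma H2_approx_uniform:
  assumes h: "h \<in> H2 \<Omega> n \<gamma>" and G: "\<And>j. G j \<in> Ainf \<Omega>"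
    "\<And>k. k < n \<Longrightarrow> L2_null I01 sequentially (\<lambda>j t. G j (\<gamma> k t) - h (\<gamma> k t))"
    and K: "compact K" "K \<subseteq> \<Omega>"
  shows "uniform_limit K G (cext n \<gamma> h) sequentially"
proof -
  obtain D where D: "D > 0" "\<And>k t. k < n \<Longrightarrow> cmod (vd (\<gamma> k) t) \<le> D" using vd_bound by blast
  obtain d where d: "d > 0" "\<And>k t w. k < n \<Longrightarrow> w \<in> K \<Longrightarrow> d \<le> cmod (\<gamma> k t - w)"
    using away_from_boundary[OF K] by blast
  let ?E = "\<lambda>j. D / d * (\<Sum>k<n. sqrt (sqnorm I01 (\<lambda>t. G j (\<gamma> k t) - h (\<gamma> k t))))"
  have "?E \<longlonglongrightarrow> D / d * (\<Sum>k<n. sqrt 0)"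
    using G(2) unfolding L2_null_def by (intro tendsto_intros) auto
  then have E: "?E \<longlonglongrightarrow> 0" by simp
  have le: "dist (G j w) (cext n \<gamma> h w) \<le> ?E j" if "w \<in> K" for j w
  proof -
    have "w \<in> \<Omega>" using that K by blast
    then have "G j w = cext n \<gamma> (G j) w"
      by (intro Cauchy_formula_boundary[symmetric] AinfD G)
    then show ?thesis unfolding dist_norm
      using cext_diff_bound[of "G j" h d w D] bdry_square_integrable AinfD(2)[OF G(1)] H2_square_integrable[OF h] d that D
      by simp
  qed
  show ?thesis
  proof (rule uniform_limitI)
    fix r :: real assume "r > 0"
    then have "\<forall>\<^sub>F j in sequentially. ?E j < r" by (intro order_tendstoD(2)[OF E])
    then show "\<forall>\<^sub>F j in sequentially. \<forall>w\<in>K. dist (G j w) (cext n \<gamma> h w) < r"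
    proof eventually_elim
      case (elim j)
      then show ?case using le by (meson le_less_trans)
    qed
  qed
qed

lemma cext_holomorphic:
  assumes "h \<in> H2 \<Omega> n \<gamma>"
  shows "cext n \<gamma> h holomorphic_on \<Omega>"
proof -
  obtain G where G: "\<And>j. G j \<in> Ainf \<Omega>"
    "\<And>k. k < n \<Longrightarrow> L2_null I01 sequentially (\<lambda>j t. G j (\<gamma> k t) - h (\<gamma> k t))"
    using H2_approx[OF assms] by blast
  show ?thesis
  proof (rule holomorphic_uniform_sequence[OF open_\<Omega> AinfD(1)[OF G(1)]])
    fix x assume "x \<in> \<Omega>"
    then obtain d where "d > 0" "cball x d \<subseteq> \<Omega>" using open_\<Omega> open_contains_cball by blast
    then show "\<exists>d>0. cball x d \<subseteq> \<Omega> \<and> uniform_limit (cball x d) G (cext n \<gamma> h) sequentially"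
      using H2_approx_uniform[OF assms, of G "cball x d"] G by auto
  qed
qed

lemma sh_comp_cont:
  assumes "g holomorphic_on \<Omega>" "k < n" "0 < e" "e \<le> \<epsilon>"
  shows "continuous_on A (\<lambda>t. g (sh k e t))"
  by (rule continuous_on_compose2[OF holomorphic_on_imp_continuous_on[OF assms(1)]])
     (use sh_in assms in \<open>auto intro!: sh_cont continuous_intros\<close>)

text \<open>Three errors: from \<open>cext n \<gamma> h\<close> to an approximant on the shifted
  curve, from there to its boundary values, and from these to \<open>h\<close>. The outer two are
  small uniformly in \<open>e\<close>, by \<open>Hardy_bound\<close> and by the choice of
  \<open>j\<close>; the middle one tends to 0 for fixed \<open>j\<close> by uniform
  continuity.\<close>

lemma H2_boundary_values:
  assumes h: "h \<in> H2 \<Omega> n \<gamma>" and k: "k < n"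
  shows "L2_null I01 (at_right 0) (\<lambda>e t. cext n \<gamma> h (sh k e t) - h (\<gamma> k t))"
proof -
  obtain G where G: "\<And>j. G j \<in> Ainf \<Omega>"
    "\<And>k. k < n \<Longrightarrow> L2_null I01 sequentially (\<lambda>j t. G j (\<gamma> k t) - h (\<gamma> k t))"
    using H2_approx[OF h] by blast
  obtain B where B: "B > 0" "\<And>g e. g holomorphic_on \<Omega> \<Longrightarrow> continuous_on (closure \<Omega>) g \<Longrightarrow> 0 < e \<Longrightarrow> e \<le> \<epsilon> \<Longrightarrow>
    (\<Sum>k<n. integral {0..1} (\<lambda>t. (cmod (g (sh k e t)))\<^sup>2)) \<le> B * (\<Sum>k<n. integral {0..1} (\<lambda>t. (cmod (g (\<gamma> k t)))\<^sup>2))"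
    using Hardy_bound by blast
  let ?F = "cext n \<gamma> h"
  note hol = AinfD(1)[OF G(1)] and cont = AinfD(2)[OF G(1)] and Fhol = cext_holomorphic[OF h]
  note hsq = H2_square_integrable[OF h]
  have shsq: "square_integrable I01 (\<lambda>t. g (sh l e t))" if "g holomorphic_on \<Omega>" "l < n" "0 < e" "e \<le> \<epsilon>" for g l e
    by (intro continuous_square_integrable sh_comp_cont that)
  define N where "N j = (\<Sum>l<n. sqnorm I01 (\<lambda>t. G j (\<gamma> l t) - h (\<gamma> l t)))" for j
  have "N \<longlonglongrightarrow> (\<Sum>l<n. 0)"
    unfolding N_def using G(2) by (intro tendsto_sum) (auto simp: L2_null_def)
  then have N: "N \<longlonglongrightarrow> 0" by simp
  have I: "integral {0..1} (\<lambda>t. (cmod (f t))\<^sup>2) = (sqnorm I01 f)" if "square_integrable I01 f" for f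
    using that I01_integral(1)[of "\<lambda>t. (cmod (f t))\<^sup>2"] by (simp add: square_integrable_def)
  have GG: "(sqnorm I01 (\<lambda>t. G m (sh k e t) - G j (sh k e t))) \<le> B * (2 * N m + 2 * N j)"
    if e: "0 < e" "e \<le> \<epsilon>" for e m j
  proof -
    let ?g = "\<lambda>x. G m x - G j x"
    have gh: "?g holomorphic_on \<Omega>" "continuous_on (closure \<Omega>) ?g"
      by (intro holomorphic_intros continuous_intros hol cont)+
    have "(sqnorm I01 (\<lambda>t. ?g (sh k e t))) = integral {0..1} (\<lambda>t. (cmod (?g (sh k e t)))\<^sup>2)"
      by (rule I[OF shsq[OF gh(1) k e], symmetric])
    also have "\<dots> \<le> (\<Sum>k<n. integral {0..1} (\<lambda>t. (cmod (?g (sh k e t)))\<^sup>2))"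
      using k by (intro member_le_sum[where f = "\<lambda>k. integral {0..1} (\<lambda>t. (cmod (?g (sh k e t)))\<^sup>2)"]
          Henstock_Kurzweil_Integration.integral_nonneg integrable_continuous_interval continuous_intros
          sh_comp_cont hol e) auto
    also have "\<dots> \<le> B * (\<Sum>k<n. integral {0..1} (\<lambda>t. (cmod (?g (\<gamma> k t)))\<^sup>2))"
      by (rule B(2)[OF gh e])
    also have "\<dots> \<le> B * (2 * N m + 2 * N j)"
    proof (intro mult_left_mono)
      have "integral {0..1} (\<lambda>t. (cmod (?g (\<gamma> l t)))\<^sup>2) \<le> 2 * (sqnorm I01 (\<lambda>t. G m (\<gamma> l t) - h (\<gamma> l t)))
         + 2 * (sqnorm I01 (\<lambda>t. G j (\<gamma> l t) - h (\<gamma> l t)))" if l: "l < n" for l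
      proof -
        have s: "square_integrable I01 (\<lambda>t. G m (\<gamma> l t) - h (\<gamma> l t))" "square_integrable I01 (\<lambda>t. h (\<gamma> l t) - G j (\<gamma> l t))"
          by (intro square_integrable_diff hsq l bdry_square_integrable cont)+
        show ?thesis
          using square_integrable_add(2)[OF s] I[OF bdry_square_integrable[OF gh(2) l]]
          by (simp add: norm_minus_commute[of "h _"])
      qed
      then have "(\<Sum>k<n. integral {0..1} (\<lambda>t. (cmod (?g (\<gamma> k t)))\<^sup>2)) \<le>
        (\<Sum>l<n. 2 * (sqnorm I01 (\<lambda>t. G m (\<gamma> l t) - h (\<gamma> l t)))
         + 2 * (sqnorm I01 (\<lambda>t. G j (\<gamma> l t) - h (\<gamma> l t))))" by (intro sum_mono) simp
      then show "(\<Sum>k<n. integral {0..1} (\<lambda>t. (cmod (?g (\<gamma> k t)))\<^sup>2)) \<le> 2 * N m + 2 * N j"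
        by (simp add: N_def sum.distrib sum_distrib_left)
    qed (use B in auto)
    finally show ?thesis .
  qed
  have FG: "(sqnorm I01 (\<lambda>t. ?F (sh k e t) - G j (sh k e t))) \<le> 4 * B * N j"
    if e: "0 < e" "e \<le> \<epsilon>" for e j
  proof -
    have "compact (sh k e ` {0..1})"
      by (intro compact_continuous_image sh_cont continuous_intros k) auto
    moreover have "sh k e ` {0..1} \<subseteq> \<Omega>" using sh_in k e by auto
    ultimately have ul: "uniform_limit (sh k e ` {0..1}) G ?F sequentially"
      by (intro H2_approx_uniform[OF h] G)
    \<comment> \<open>For fixed \<open>e\<close> the shifted curve is compact in the domain, where
      \<open>G\<close> converges uniformly; this permits \<open>m\<close> to tend to infinity in
      \<open>GG\<close>.\<close>
    have "null_multiplier I01 sequentially (\<lambda>m t. ?F (sh k e t) - G m (sh k e t))"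
      unfolding null_multiplier_def
    proof (intro allI impI)
      fix \<eta> :: real assume "\<eta> > 0"
      have "\<forall>\<^sub>F m in sequentially. \<forall>w\<in>sh k e ` {0..1}. dist (G m w) (?F w) < \<eta>"
        by (rule uniform_limitD[OF ul \<open>\<eta> > 0\<close>])
      then show "\<forall>\<^sub>F m in sequentially. (\<lambda>t. ?F (sh k e t) - G m (sh k e t)) \<in> borel_measurable I01 \<and>
          (\<forall>t\<in>space I01. cmod (?F (sh k e t) - G m (sh k e t)) \<le> \<eta>)"
        by eventually_elim
           (auto simp: dist_norm norm_minus_commute less_imp_le
             intro!: continuous_measurable_I01 continuous_intros sh_comp_cont hol Fhol k e)
    qed
    from null_multiplier_imp_L2_null[OF this]
    have "(\<lambda>m. sqnorm I01 (\<lambda>t. ?F (sh k e t) - G m (sh k e t))) \<longlonglongrightarrow> 0" by (simp add: L2_null_def)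
    then have lim: "(\<lambda>m. 2 * (sqnorm I01 (\<lambda>t. ?F (sh k e t) - G m (sh k e t))) + 2 * (B * (2 * N m + 2 * N j)))
        \<longlonglongrightarrow> 2 * 0 + 2 * (B * (2 * 0 + 2 * N j))"
      by (intro tendsto_intros N)
    have "(sqnorm I01 (\<lambda>t. ?F (sh k e t) - G j (sh k e t))) \<le>
      2 * (sqnorm I01 (\<lambda>t. ?F (sh k e t) - G m (sh k e t))) + 2 * (B * (2 * N m + 2 * N j))" for m
    proof -
      have s: "square_integrable I01 (\<lambda>t. ?F (sh k e t) - G m (sh k e t))" "square_integrable I01 (\<lambda>t. G m (sh k e t) - G j (sh k e t))"
        by (intro square_integrable_diff shsq hol Fhol k e)+
      show ?thesis using square_integrable_add(2)[OF s] GG[OF e, of m j] by simp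
    qed
    then have "(sqnorm I01 (\<lambda>t. ?F (sh k e t) - G j (sh k e t))) \<le> 2 * 0 + 2 * (B * (2 * 0 + 2 * N j))"
      by (intro LIMSEQ_le_const[OF lim]) auto
    then show ?thesis by simp
  qed
  have sqall: "square_integrable I01 (\<lambda>t. ?F (sh k e t) - h (\<gamma> k t))" if e: "0 < e" "e \<le> \<epsilon>" for e
    by (intro square_integrable_diff shsq Fhol hsq k e)
  show ?thesis unfolding L2_null_def
  proof
    show "\<forall>\<^sub>F e in at_right 0. square_integrable I01 (\<lambda>t. ?F (sh k e t) - h (\<gamma> k t))"
      using eventually_shift by eventually_elim (use sqall in auto)
    show "((\<lambda>e. sqnorm I01 (\<lambda>t. ?F (sh k e t) - h (\<gamma> k t))) \<longlongrightarrow> 0) (at_right 0)"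
    proof (rule tendstoI)
      fix r :: real assume r: "r > 0"
      \<comment> \<open>\<open>8 * B + 4\<close> collects the outer two errors after two uses of
        \<open>square_integrable_add\<close>; the middle error, taken below \<open>r / 8\<close> and
        multiplied by 4, supplies the other \<open>r / 2\<close>.\<close>
      have "(\<lambda>j. (8 * B + 4) * N j) \<longlonglongrightarrow> (8 * B + 4) * 0" by (intro tendsto_intros N)
      then have "\<forall>\<^sub>F j in sequentially. (8 * B + 4) * N j < r / 2"
        using r by (auto dest: order_tendstoD(2)[where a = "r / 2"])
      then obtain j where j: "(8 * B + 4) * N j < r / 2" by (auto simp: eventually_sequentially)
      have "continuous_on ({0..\<epsilon>} \<times> {0..1}) (\<lambda>(e, t). G j (sh k e t))"
        unfolding case_prod_unfold
        by (intro continuous_on_compose2[OF cont] continuous_intros k) (auto intro!: sh_closure k)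
      from null_multiplier_imp_L2_null[OF uniform_tendsto_param[OF eps this]]
      have "((\<lambda>e. sqnorm I01 (\<lambda>t. G j (sh k e t) - G j (\<gamma> k t))) \<longlongrightarrow> 0) (at_right 0)"
        by (simp add: L2_null_def)
      then have "\<forall>\<^sub>F e in at_right 0. (sqnorm I01 (\<lambda>t. G j (sh k e t) - G j (\<gamma> k t))) < r / 8"
        using r by (auto dest: order_tendstoD(2)[where a = "r / 8"])
      then show "\<forall>\<^sub>F e in at_right 0. dist (sqnorm I01 (\<lambda>t. ?F (sh k e t) - h (\<gamma> k t))) 0 < r"
        using eventually_shift
      proof eventually_elim
        case (elim e)
        have s: "square_integrable I01 (\<lambda>t. ?F (sh k e t) - G j (sh k e t))"
          "square_integrable I01 (\<lambda>t. G j (sh k e t) - G j (\<gamma> k t))"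
          "square_integrable I01 (\<lambda>t. G j (\<gamma> k t) - h (\<gamma> k t))"
          by (intro square_integrable_diff shsq hol Fhol k bdry_square_integrable cont hsq; use elim in simp)+
        have Nk: "(sqnorm I01 (\<lambda>t. G j (\<gamma> k t) - h (\<gamma> k t))) \<le> N j"
          unfolding N_def using k by (intro member_le_sum[where f = "\<lambda>k. sqnorm I01 (\<lambda>t. G j (\<gamma> k t) - h (\<gamma> k t))"]) auto
        have "(sqnorm I01 (\<lambda>t. ?F (sh k e t) - h (\<gamma> k t))) \<le>
           2 * (sqnorm I01 (\<lambda>t. ?F (sh k e t) - G j (sh k e t))) +
           2 * (2 * (sqnorm I01 (\<lambda>t. G j (sh k e t) - G j (\<gamma> k t))) + 2 * (sqnorm I01 (\<lambda>t. G j (\<gamma> k t) - h (\<gamma> k t))))"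
          using square_integrable_add(2)[OF s(1) square_integrable_add(1)[OF s(2,3)]] square_integrable_add(2)[OF s(2,3)]
          by simp
        also have "\<dots> < 2 * (4 * B * N j) + 2 * (2 * (r / 8) + 2 * N j)"
          by (intro add_le_less_mono add_less_le_mono mult_left_mono mult_strict_left_mono)
             (use FG[of e j] elim Nk in auto)
        also have "\<dots> \<le> r" using j by (simp add: algebra_simps)
        finally show ?case by simp
      qed
    qed
  qed
qed

section \<open>The weighted inner product and the symmetry of the Szego kernel\<close>

lemma weight_cont:
  assumes "\<forall>k<n. C_inf (\<lambda>t. \<phi> (\<gamma> k t))" "k < n"
  shows "continuous_on A (\<lambda>t. complex_of_real (\<phi> (\<gamma> k t) * cmod (vd (\<gamma> k) t)))"
proof -
  have "continuous_on A (\<lambda>t. \<phi> (\<gamma> k t))" by (rule C_inf_continuous) (use assms in blast)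
  then show ?thesis by (intro continuous_intros loop_cont loops assms)
qed

lemma continuous_I01_bound:
  fixes b :: "real \<Rightarrow> complex"
  assumes "continuous_on {0..1} b"
  obtains B where "\<And>t. t \<in> space I01 \<Longrightarrow> cmod (b t) \<le> B"
proof -
  have "compact (b ` {0..1})" using assms by (intro compact_continuous_image) auto
  then obtain B where "\<forall>x\<in>b ` {0..1}. cmod x \<le> B" using compact_imp_bounded bounded_iff by metis
  then show ?thesis by (intro that[of B]) simp
qed

lemma continuous_multiplier:
  assumes "continuous_on {0..1} b"
  shows "multiplier I01 F (\<lambda>e. b)"
proof -
  obtain B where "\<And>t. t \<in> space I01 \<Longrightarrow> cmod (b t) \<le> B" using continuous_I01_bound[OF assms] by blast
  then show ?thesis unfolding multiplier_def
    by (intro exI[of _ B]) (use continuous_measurable_I01[OF assms] in auto)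
qed

lemma winner_eq:
  assumes "\<forall>k<n. C_inf (\<lambda>t. \<phi> (\<gamma> k t))"
    and g: "\<And>k. k < n \<Longrightarrow> square_integrable I01 (\<lambda>t. g (\<gamma> k t))"
    and h: "\<And>k. k < n \<Longrightarrow> square_integrable I01 (\<lambda>t. h (\<gamma> k t))"
  shows "winner n \<gamma> \<phi> g h = (\<Sum>k<n. \<integral>t. g (\<gamma> k t) * (complex_of_real (\<phi> (\<gamma> k t) * cmod (vd (\<gamma> k) t)) * cnj (h (\<gamma> k t))) \<partial>I01)"
proof -
  have "integral {0..1} (\<lambda>t. g (\<gamma> k t) * cnj (h (\<gamma> k t)) * complex_of_real (\<phi> (\<gamma> k t)) * complex_of_real (cmod (vd (\<gamma> k) t))) =
    (\<integral>t. g (\<gamma> k t) * (complex_of_real (\<phi> (\<gamma> k t) * cmod (vd (\<gamma> k) t)) * cnj (h (\<gamma> k t))) \<partial>I01)" if k: "k < n" for k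
  proof -
    have m: "(\<lambda>t. complex_of_real (\<phi> (\<gamma> k t) * cmod (vd (\<gamma> k) t))) \<in> borel_measurable I01"
      by (intro continuous_measurable_I01 weight_cont assms(1) k)
    obtain B where B: "\<And>t. t \<in> space I01 \<Longrightarrow> cmod (complex_of_real (\<phi> (\<gamma> k t) * cmod (vd (\<gamma> k) t))) \<le> B"
      using continuous_I01_bound[OF weight_cont[OF assms(1) k, of "{0..1}"]] by blast
    have "square_integrable I01 (\<lambda>t. complex_of_real (\<phi> (\<gamma> k t) * cmod (vd (\<gamma> k) t)) * cnj (h (\<gamma> k t)))"
      by (rule square_integrable_bounded_mult(1)[OF square_integrable_cnj[OF h[OF k]] m B])
    from I01_integral(1)[OF square_integrable_mult_integrable[OF g[OF k] this]]
    show ?thesis by (simp add: mult_ac)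
  qed
  then show ?thesis by (simp add: winner_def bint_def)
qed

text \<open>The reproducing property is given on \<open>Ainf\<close> only. Along approximants of
  \<open>S a\<close>, the values at \<open>w\<close> converge to the Cauchy extension and the inner
  products converge by \<open>L^2\<close> continuity, so it extends to \<open>S a\<close>.\<close>

lemma szego_inner_product:
  assumes \<phi>: "\<forall>k<n. C_inf (\<lambda>t. \<phi> (\<gamma> k t))" and S: "is_wszego \<Omega> n \<gamma> \<phi> S"
    and aw: "a \<in> \<Omega>" "w \<in> \<Omega>"
  shows "wsigma n \<gamma> S w a = winner n \<gamma> \<phi> (S a) (S w)"
proof -
  have H: "S a \<in> H2 \<Omega> n \<gamma>" "S w \<in> H2 \<Omega> n \<gamma>" using S aw by (auto simp: is_wszego_def)
  obtain G where G: "\<And>j. G j \<in> Ainf \<Omega>"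
    "\<And>k. k < n \<Longrightarrow> L2_null I01 sequentially (\<lambda>j t. G j (\<gamma> k t) - S a (\<gamma> k t))"
    using H2_approx[OF H(1)] by blast
  have "uniform_limit {w} G (cext n \<gamma> (S a)) sequentially"
    by (intro H2_approx_uniform[OF H(1)] G) (use aw in auto)
  then have lim1: "(\<lambda>j. G j w) \<longlonglongrightarrow> cext n \<gamma> (S a) w"
    by (rule tendsto_uniform_limitI) simp
  have Gw: "G j w = winner n \<gamma> \<phi> (G j) (S w)" for j
    using S aw G by (auto simp: is_wszego_def)
  let ?W = "\<lambda>k t. complex_of_real (\<phi> (\<gamma> k t) * cmod (vd (\<gamma> k) t)) * cnj (S w (\<gamma> k t))"
  have W: "L2_bounded I01 F (\<lambda>e. ?W k)" if "k < n" for k and F :: "nat filter"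
    by (intro L2_bounded_mult continuous_multiplier weight_cont[OF \<phi> that] L2_bounded_const
          square_integrable_cnj H2_square_integrable[OF H(2)] that)
  have Wsq: "square_integrable I01 (?W k)" if "k < n" for k
    using W[OF that, of sequentially] by (auto simp: L2_bounded_def)
  have lim2: "(\<lambda>j. \<Sum>k<n. \<integral>t. (G j (\<gamma> k t) - S a (\<gamma> k t)) * ?W k t \<partial>I01) \<longlonglongrightarrow> (\<Sum>k<n. 0)"
    by (intro tendsto_sum L2_inner_null G(2) W) auto
  have diff: "(\<integral>t. (G j (\<gamma> k t) - S a (\<gamma> k t)) * ?W k t \<partial>I01) =
    (\<integral>t. G j (\<gamma> k t) * ?W k t \<partial>I01) - (\<integral>t. S a (\<gamma> k t) * ?W k t \<partial>I01)" if k: "k < n" for k j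
    unfolding left_diff_distrib
    by (intro Bochner_Integration.integral_diff square_integrable_mult_integrable Wsq[OF k]
          bdry_square_integrable AinfD(2)[OF G(1)] H2_square_integrable[OF H(1)] k)
  have 1: "winner n \<gamma> \<phi> (G j) (S w) = (\<Sum>k<n. \<integral>t. G j (\<gamma> k t) * ?W k t \<partial>I01)" for j
    by (intro winner_eq[OF \<phi>] bdry_square_integrable AinfD(2)[OF G(1)] H2_square_integrable[OF H(2)])
  have 2: "winner n \<gamma> \<phi> (S a) (S w) = (\<Sum>k<n. \<integral>t. S a (\<gamma> k t) * ?W k t \<partial>I01)"
    by (intro winner_eq[OF \<phi>] H2_square_integrable[OF H(1)] H2_square_integrable[OF H(2)])
  have "winner n \<gamma> \<phi> (G j) (S w) - winner n \<gamma> \<phi> (S a) (S w) =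
     (\<Sum>k<n. \<integral>t. (G j (\<gamma> k t) - S a (\<gamma> k t)) * ?W k t \<partial>I01)" for j
    unfolding 1 2 sum_subtractf[symmetric] by (intro sum.cong refl diff[symmetric]) simp
  with lim2 have "(\<lambda>j. winner n \<gamma> \<phi> (G j) (S w) - winner n \<gamma> \<phi> (S a) (S w)) \<longlonglongrightarrow> 0" by simp
  then have "(\<lambda>j. G j w) \<longlonglongrightarrow> winner n \<gamma> \<phi> (S a) (S w)"
    unfolding Gw by (rule LIM_zero_cancel)
  with lim1 show ?thesis unfolding wsigma_def by (rule LIMSEQ_unique)
qed

text \<open>Conjugate symmetry of the inner product, since the weight is real.\<close>

lemma szego_hermitian:
  assumes \<phi>: "\<forall>k<n. C_inf (\<lambda>t. \<phi> (\<gamma> k t))" and S: "is_wszego \<Omega> n \<gamma> \<phi> S"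
    and aw: "a \<in> \<Omega>" "w \<in> \<Omega>"
  shows "cnj (wsigma n \<gamma> S w a) = wsigma n \<gamma> S a w"
proof -
  have "cnj (winner n \<gamma> \<phi> (S a) (S w)) = winner n \<gamma> \<phi> (S w) (S a)"
    by (simp add: winner_def bint_def integral_cnj mult_ac)
  then show ?thesis
    using szego_inner_product[OF \<phi> S aw] szego_inner_product[OF \<phi> S aw(2,1)] by simp
qed

end

section \<open>The identity for the Garabedian kernel\<close>

lemma param_multiplier:
  fixes F :: "real \<Rightarrow> real \<Rightarrow> complex"
  assumes "\<epsilon> > 0" "continuous_on ({0..\<epsilon>} \<times> {0..1}) (\<lambda>(e, t). F e t)"
  shows "multiplier I01 (at_right 0) F"
proof -
  have "compact ((\<lambda>(e, t). F e t) ` ({0..\<epsilon>} \<times> {0..1}))"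
    by (intro compact_continuous_image assms(2) compact_Times compact_Icc)
  then obtain B where B: "\<forall>x\<in>(\<lambda>(e, t). F e t) ` ({0..\<epsilon>} \<times> {0..1}). cmod x \<le> B"
    using compact_imp_bounded bounded_iff by metis
  have "F e \<in> borel_measurable I01 \<and> (\<forall>t\<in>space I01. cmod (F e t) \<le> B)" if "0 < e" "e < \<epsilon>" for e
  proof
    have "continuous_on {0..1} (\<lambda>t. (\<lambda>(e, t). F e t) (e, t))"
      by (rule continuous_on_compose2[OF assms(2)]) (use that in \<open>auto intro!: continuous_intros\<close>)
    then show "F e \<in> borel_measurable I01" by (intro continuous_measurable_I01) simp
    show "\<forall>t\<in>space I01. cmod (F e t) \<le> B" using B that by force
  qed
  then show ?thesis
    unfolding multiplier_def eventually_at_right_field using assms(1) by blast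
qed

text \<open>Near a zero \<open>p\<close> of \<open>f\<close> both functions are divisible by
  \<open>x - p\<close>; the quotient of their difference quotients is holomorphic there because that
  of \<open>f\<close> takes the nonzero value \<open>deriv f p\<close> at \<open>p\<close>.\<close>

lemma holomorphic_quotient_simple_zeros:
  assumes "open S" "g holomorphic_on S" "f holomorphic_on S"
    and zeros: "\<And>p. p \<in> S \<Longrightarrow> f p = 0 \<Longrightarrow> g p = 0 \<and> deriv f p \<noteq> 0"
  obtains q where "q holomorphic_on S" "\<And>p. p \<in> S \<Longrightarrow> q p * f p = g p"
proof -
  define q where "q p = (if f p = 0 then deriv g p / deriv f p else g p / f p)" for p
  have "q field_differentiable (at p)" if p: "p \<in> S" for p
  proof (cases "f p = 0")
    case False
    have "open (S \<inter> f -` (-{0}))"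
      by (intro continuous_open_preimage holomorphic_on_imp_continuous_on assms) auto
    have "(\<lambda>x. g x / f x) holomorphic_on (S \<inter> f -` (-{0}))"
      by (intro holomorphic_intros holomorphic_on_subset[OF assms(2)] holomorphic_on_subset[OF assms(3)]) auto
    then have "q holomorphic_on (S \<inter> f -` (-{0}))"
      by (rule holomorphic_transform) (auto simp: q_def)
    then show ?thesis
      using False p \<open>open (S \<inter> f -` (-{0}))\<close> by (auto intro: holomorphic_on_imp_differentiable_at)
  next
    case True
    let ?d = "\<lambda>h x. if x = p then deriv h p else (h x - h p) / (x - p)"
    have hol: "?d f holomorphic_on S" "?d g holomorphic_on S"
      by (intro pole_lemma_open assms)+
    let ?U = "S \<inter> ?d f -` (-{0})"
    have U: "open ?U"
      by (intro continuous_open_preimage holomorphic_on_imp_continuous_on assms hol) auto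
    have z: "g p = 0" "deriv f p \<noteq> 0" using zeros[OF p True] by auto
    have "(\<lambda>x. ?d g x / ?d f x) holomorphic_on ?U"
      by (intro holomorphic_on_divide holomorphic_on_subset[OF hol(1)] holomorphic_on_subset[OF hol(2)]) auto
    then have "q holomorphic_on ?U"
    proof (rule holomorphic_transform)
      fix x assume "x \<in> ?U"
      then show "?d g x / ?d f x = q x" using z True by (auto simp: q_def split: if_splits)
    qed
    moreover have "p \<in> ?U" using p z by simp
    ultimately show ?thesis using U holomorphic_on_imp_differentiable_at by blast
  qed
  then have "q holomorphic_on S"
    by (simp add: holomorphic_on_def field_differentiable_at_within)
  moreover have "q p * f p = g p" if "p \<in> S" for p
    using zeros[OF that] by (simp add: q_def)
  ultimately show ?thesis using that by blast
qed

section \<open>Kernels and proper maps along the shifted curves\<close>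

context collared_domain
begin

text \<open>A shift of at most \<open>d / (2 * D)\<close> moves boundary points by at most
  \<open>d / 2\<close>, while \<open>a\<close> is at distance at least \<open>d\<close>. Including
  \<open>e = 0\<close> makes the rectangle compact, as uniform convergence requires.\<close>

lemma shifted_kernel:
  assumes "a \<in> \<Omega>"
  obtains \<delta> where "\<delta> > 0" "\<delta> \<le> \<epsilon>" "\<And>k e t. k < n \<Longrightarrow> e \<in> {0..\<delta>} \<Longrightarrow> sh k e t \<noteq> a"
    "\<And>k. k < n \<Longrightarrow> continuous_on ({0..\<delta>} \<times> {0..1}) (\<lambda>(e, t). 1 / (sh k e t - a))"
proof -
  obtain D where D: "D > 0" "\<And>k t. k < n \<Longrightarrow> cmod (vd (\<gamma> k) t) \<le> D" using vd_bound by blast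
  obtain d where d: "d > 0" "\<And>k t w. k < n \<Longrightarrow> w \<in> {a} \<Longrightarrow> d \<le> cmod (\<gamma> k t - w)"
    using away_from_boundary[of "{a}"] assms by auto
  define \<delta> where "\<delta> = min \<epsilon> (d / (2 * D))"
  have ne: "sh k e t \<noteq> a" if "k < n" "e \<in> {0..\<delta>}" for k e t
  proof -
    have "cmod (complex_of_real (e * \<sigma> k) * (\<i> * vd (\<gamma> k) t)) = e * cmod (vd (\<gamma> k) t)"
      using sgn[of k] that by (simp add: norm_mult)
    also have "\<dots> \<le> d / (2 * D) * D" using that D d by (intro mult_mono) (auto simp: \<delta>_def)
    also have "\<dots> < d" using D d by simp
    also have "d \<le> cmod (\<gamma> k t - a)" using d that by simp
    finally have "cmod (complex_of_real (e * \<sigma> k) * (\<i> * vd (\<gamma> k) t)) \<noteq> cmod (\<gamma> k t - a)" by simp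
    then show ?thesis unfolding sh_def by (metis add.commute add_diff_cancel_left' norm_minus_commute)
  qed
  show ?thesis
  proof (rule that[of \<delta>])
    show "continuous_on ({0..\<delta>} \<times> {0..1}) (\<lambda>(e, t). 1 / (sh k e t - a))" if "k < n" for k
      unfolding case_prod_unfold by (intro continuous_intros that) (use ne that in auto)
  qed (use ne d D eps in \<open>auto simp: \<delta>_def\<close>)
qed

lemma eventually_sh_ne:
  assumes "a \<in> \<Omega>"
  shows "\<forall>\<^sub>F e in at_right 0. \<forall>k<n. \<forall>t. sh k e t \<noteq> a"
proof -
  obtain \<delta> where \<delta>: "\<delta> > 0" "\<delta> \<le> \<epsilon>" "\<And>k e t. k < n \<Longrightarrow> e \<in> {0..\<delta>} \<Longrightarrow> sh k e t \<noteq> a"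
    "\<And>k. k < n \<Longrightarrow> continuous_on ({0..\<delta>} \<times> {0..1}) (\<lambda>(e, t). 1 / (sh k e t - a))"
    using shifted_kernel[OF assms] by blast
  then show ?thesis unfolding eventually_at_right_field
    by (intro exI[of _ \<delta>]) auto
qed

text \<open>Cauchy's formula on the shifted curves: the integral of \<open>L\<close> against the
  Cauchy kernel equals \<open>L w\<close> times the integral of the kernel. The former tends to 0,
  the latter to \<open>2 * pi * \<i>\<close> times the total winding number 1.\<close>

lemma L2_null_imp_zero:
  assumes L: "L holomorphic_on \<Omega>" and null: "\<And>k. k < n \<Longrightarrow> L2_null I01 (at_right 0) (\<lambda>e t. L (sh k e t))"
    and w: "w \<in> \<Omega>"
  shows "L w = 0"
proof -
  obtain \<delta> where \<delta>: "\<delta> > 0" "\<delta> \<le> \<epsilon>" "\<And>k e t. k < n \<Longrightarrow> e \<in> {0..\<delta>} \<Longrightarrow> sh k e t \<noteq> w"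
    "\<And>k. k < n \<Longrightarrow> continuous_on ({0..\<delta>} \<times> {0..1}) (\<lambda>(e, t). 1 / (sh k e t - w))"
    using shifted_kernel[OF w] by blast
  have jc: "continuous_on ({0..\<delta>} \<times> {0..1}) (\<lambda>(e, t). dsh k e t / (sh k e t - w))" if "k < n" for k
    unfolding case_prod_unfold by (intro continuous_intros that) (use \<delta>(3)[OF that] in auto)
  have one: "L2_bounded I01 (at_right (0::real)) (\<lambda>e t. 1)"
    by (intro L2_bounded_const continuous_square_integrable continuous_intros)
  \<comment> \<open>The factor 1 is the constant \<open>L^2\<close> function to which the Cauchy
    kernel is applied as a multiplier.\<close>
  have lim1: "((\<lambda>e. \<Sum>k<n. \<integral>t. L (sh k e t) * (dsh k e t / (sh k e t - w) * 1) \<partial>I01) \<longlongrightarrow> (\<Sum>k<n. 0)) (at_right 0)"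
    by (intro tendsto_sum L2_inner_null null L2_bounded_mult one param_multiplier[OF \<delta>(1) jc]) auto
  have lim2: "((\<lambda>e. \<Sum>k<n. integral {0..1} (\<lambda>t. dsh k e t / (sh k e t - w))) \<longlongrightarrow>
     (\<Sum>k<n. integral {0..1} (\<lambda>t. dsh k 0 t / (sh k 0 t - w)))) (at_right 0)"
    by (intro tendsto_sum integral_tendsto_param[OF \<delta>(1) jc]) auto
  have ev: "\<forall>\<^sub>F e in at_right 0. (\<Sum>k<n. \<integral>t. L (sh k e t) * (dsh k e t / (sh k e t - w) * 1) \<partial>I01) =
     L w * (\<Sum>k<n. integral {0..1} (\<lambda>t. dsh k e t / (sh k e t - w)))"
  proof -
    have "(\<Sum>k<n. \<integral>t. L (sh k e t) * (dsh k e t / (sh k e t - w) * 1) \<partial>I01) =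
     L w * (\<Sum>k<n. integral {0..1} (\<lambda>t. dsh k e t / (sh k e t - w)))" if e: "0 < e" "e < \<delta>" for e
    proof -
      have e': "e \<le> \<epsilon>" using e \<delta> by simp
      have ne: "sh k e t - w \<noteq> 0" if "k < n" for k t using \<delta>(3)[OF that, of e t] e by auto
      have c1: "continuous_on {0..1} (\<lambda>t. dsh k e t / (sh k e t - w))" if "k < n" for k
        by (intro continuous_intros that) (use ne[OF that] in auto)
      have c2: "continuous_on {0..1} (\<lambda>t. L (sh k e t) * (dsh k e t / (sh k e t - w)))" if "k < n" for k
        by (intro continuous_on_mult c1 sh_comp_cont L that e e')
      have I: "(\<integral>t. L (sh k e t) * (dsh k e t / (sh k e t - w) * 1) \<partial>I01) =
         integral {0..1} (\<lambda>t. L (sh k e t) * (dsh k e t / (sh k e t - w)))" if "k < n" for k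
        using I01_integral(1)[OF square_integrable_I01_norm(1)[OF continuous_square_integrable[OF c2[OF that]]]] by simp
      have "0 = (\<Sum>k<n. integral {0..1} (\<lambda>t. dq L w (sh k e t) * dsh k e t))"
        by (rule Cauchy_shifted[symmetric]) (intro e e' dq_holomorphic L)+
      also have "\<dots> = (\<Sum>k<n. integral {0..1} (\<lambda>t. L (sh k e t) * (dsh k e t / (sh k e t - w))) -
          L w * integral {0..1} (\<lambda>t. dsh k e t / (sh k e t - w)))"
      proof (rule sum.cong[OF refl])
        fix k assume "k \<in> {..<n}"
        then have k: "k < n" by simp
        have "integral {0..1} (\<lambda>t. dq L w (sh k e t) * dsh k e t) =
          integral {0..1} (\<lambda>t. L (sh k e t) * (dsh k e t / (sh k e t - w)) - L w * (dsh k e t / (sh k e t - w)))"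
          using ne[OF k] by (intro integral_cong) (auto simp: dq_def diff_divide_distrib algebra_simps)
        also have "\<dots> = integral {0..1} (\<lambda>t. L (sh k e t) * (dsh k e t / (sh k e t - w))) -
            integral {0..1} (\<lambda>t. L w * (dsh k e t / (sh k e t - w)))"
          by (intro Henstock_Kurzweil_Integration.integral_diff integrable_continuous_interval
              continuous_on_mult continuous_on_const c1 c2 k)
        finally show "integral {0..1} (\<lambda>t. dq L w (sh k e t) * dsh k e t) =
          integral {0..1} (\<lambda>t. L (sh k e t) * (dsh k e t / (sh k e t - w))) -
          L w * integral {0..1} (\<lambda>t. dsh k e t / (sh k e t - w))"
          by (simp only: Henstock_Kurzweil_Integration.integral_mult_right)
      qed
      finally show ?thesis using I by (simp add: sum_subtractf sum_distrib_left)
    qed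
    then show ?thesis unfolding eventually_at_right_field using \<delta>(1) by blast
  qed
  have "((\<lambda>e. \<Sum>k<n. \<integral>t. L (sh k e t) * (dsh k e t / (sh k e t - w) * 1) \<partial>I01) \<longlongrightarrow> L w * (2 * pi * \<i>)) (at_right 0)"
  proof (rule Lim_transform_eventually)
    show "((\<lambda>e. L w * (\<Sum>k<n. integral {0..1} (\<lambda>t. dsh k e t / (sh k e t - w)))) \<longlongrightarrow> L w * (2 * pi * \<i>)) (at_right 0)"
      using tendsto_mult_left[OF lim2, of "L w"] winding_integral[OF w] by simp
    show "\<forall>\<^sub>F e in at_right 0. L w * (\<Sum>k<n. integral {0..1} (\<lambda>t. dsh k e t / (sh k e t - w))) =
      (\<Sum>k<n. \<integral>t. L (sh k e t) * (dsh k e t / (sh k e t - w) * 1) \<partial>I01)"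
      using ev by eventually_elim (rule sym)
  qed
  from tendsto_unique[OF _ this lim1] show ?thesis by simp
qed

lemma H2_shift_bounded:
  assumes "h \<in> H2 \<Omega> n \<gamma>" "k < n"
  shows "L2_bounded I01 (at_right 0) (\<lambda>e t. cext n \<gamma> h (sh k e t))"
proof -
  have "L2_bounded I01 (at_right 0) (\<lambda>e t. (cext n \<gamma> h (sh k e t) - h (\<gamma> k t)) + h (\<gamma> k t))"
    by (intro L2_bounded_add L2_null_imp_bounded H2_boundary_values L2_bounded_const H2_square_integrable assms)
  then show ?thesis by simp
qed

text \<open>The decomposition defining \<open>Hg a\<close>, conjugated and multiplied by weight and
  speed, is the exact boundary relation \<open>rel\<close>. Replacing boundary values by shifted
  ones costs null errors; weight and tangent stay at the boundary point.\<close>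

lemma garabedian_boundary_relation:
  assumes \<phi>: "\<forall>k<n. C_inf (\<lambda>t. \<phi> (\<gamma> k t))" and pos: "\<forall>w\<in>frontier \<Omega>. \<phi> w > 0"
    and S: "is_wszego \<Omega> n \<gamma> \<phi> S" and G: "is_wgarab \<Omega> n \<gamma> \<phi> S Hg" and a: "a \<in> \<Omega>" and k: "k < n"
  shows "L2_null I01 (at_right 0) (\<lambda>e t. complex_of_real (\<phi> (\<gamma> k t) * cmod (vd (\<gamma> k) t)) * cnj (wsigma n \<gamma> S (sh k e t) a)
      + \<i> * vd (\<gamma> k) t * wlambda n \<gamma> Hg (sh k e t) a)"
    and "L2_bounded I01 (at_right 0) (\<lambda>e t. wlambda n \<gamma> Hg (sh k e t) a)"
proof -
  have H: "S a \<in> H2 \<Omega> n \<gamma>" "Hg a \<in> H2 \<Omega> n \<gamma>"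
    using S G a by (auto simp: is_wszego_def is_wgarab_def)
  obtain \<delta> where \<delta>: "\<delta> > 0" "\<delta> \<le> \<epsilon>" "\<And>k e t. k < n \<Longrightarrow> e \<in> {0..\<delta>} \<Longrightarrow> sh k e t \<noteq> a"
    "\<And>k. k < n \<Longrightarrow> continuous_on ({0..\<delta>} \<times> {0..1}) (\<lambda>(e, t). 1 / (sh k e t - a))"
    using shifted_kernel[OF a] by blast
  let ?\<omega> = "\<lambda>t. complex_of_real (\<phi> (\<gamma> k t) * cmod (vd (\<gamma> k) t))"
  have rel: "?\<omega> t * cnj (S a (\<gamma> k t)) + \<i> * vd (\<gamma> k) t * (1 / (2 * complex_of_real pi * (\<gamma> k t - a))) + vd (\<gamma> k) t * Hg a (\<gamma> k t) = 0"
    if t: "t \<in> {0..1}" for t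
  proof -
    have g: "cnj ((1 / (2 * pi * \<i>)) * (utan (\<gamma> k) t / complex_of_real (\<phi> (\<gamma> k t))) / (\<gamma> k t - a))
         = S a (\<gamma> k t) + cnj (Hg a (\<gamma> k t) * utan (\<gamma> k) t) / complex_of_real (\<phi> (\<gamma> k t))"
      using G a k t by (auto simp: is_wgarab_def)
    have nz: "complex_of_real (\<phi> (\<gamma> k t)) \<noteq> 0" "\<gamma> k t - a \<noteq> 0" "vd (\<gamma> k) t \<noteq> 0"
      using pos bdry_in_frontier[OF k, of t] bdry_notin[OF k, of t] a loop_vd_nz[OF loops[OF k]] by force+
    have T: "vd (\<gamma> k) t = utan (\<gamma> k) t * complex_of_real (cmod (vd (\<gamma> k) t))"
      using nz by (simp add: utan_def)
    have alg1: "p * m * (c * (T / p) / r - H * T / p) = c * (T * m) / r - H * (T * m)"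
      if "p \<noteq> 0" "r \<noteq> 0" for p m c T r H :: complex
      using that by (simp add: field_simps)
    have alg2: "(1 / (2 * pi * \<i>)) * v / r - H * v + \<i> * v * (1 / (2 * complex_of_real pi * r)) + v * H = 0"
      if "r \<noteq> 0" for v r H :: complex
      using that by (simp add: field_simps)
    let ?p = "complex_of_real (\<phi> (\<gamma> k t))" and ?T = "utan (\<gamma> k) t" and ?m = "complex_of_real (cmod (vd (\<gamma> k) t))"
    have eqS: "cnj (S a (\<gamma> k t)) = (1 / (2 * pi * \<i>)) * (?T / ?p) / (\<gamma> k t - a) - Hg a (\<gamma> k t) * ?T / ?p"
      using arg_cong[OF g, of cnj] by (simp add: algebra_simps)
    have "?p * ?m * cnj (S a (\<gamma> k t)) = (1 / (2 * pi * \<i>)) * (?T * ?m) / (\<gamma> k t - a) - Hg a (\<gamma> k t) * (?T * ?m)"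
      unfolding eqS by (rule alg1[OF nz(1,2)])
    then have eqS': "?p * ?m * cnj (S a (\<gamma> k t)) = (1 / (2 * pi * \<i>)) * vd (\<gamma> k) t / (\<gamma> k t - a) - Hg a (\<gamma> k t) * vd (\<gamma> k) t"
      unfolding T[symmetric] .
    show ?thesis unfolding of_real_mult eqS' by (rule alg2[OF nz(2), unfolded of_real_mult])
  qed
  have vm: "multiplier I01 (at_right (0::real)) (\<lambda>e. vd (\<gamma> k))"
    by (intro continuous_multiplier loop_cont loops k)
  have wm: "multiplier I01 (at_right (0::real)) (\<lambda>e. ?\<omega>)"
    by (intro continuous_multiplier weight_cont \<phi> k)
  have im: "multiplier I01 (at_right (0::real)) (\<lambda>e t. \<i> * vd (\<gamma> k) t / (2 * complex_of_real pi))"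
    by (intro continuous_multiplier continuous_intros loop_cont loops k) auto
  have n1: "L2_null I01 (at_right 0) (\<lambda>e t. 1 / (sh k e t - a) - 1 / (sh k 0 t - a))"
    by (intro null_multiplier_imp_L2_null uniform_tendsto_param[OF \<delta>(1) \<delta>(4)[OF k]])
  have "L2_null I01 (at_right 0) (\<lambda>e t. ?\<omega> t * cnj (cext n \<gamma> (S a) (sh k e t) - S a (\<gamma> k t)) +
      (vd (\<gamma> k) t * (cext n \<gamma> (Hg a) (sh k e t) - Hg a (\<gamma> k t)) +
      \<i> * vd (\<gamma> k) t / (2 * complex_of_real pi) * (1 / (sh k e t - a) - 1 / (sh k 0 t - a))))"
    by (intro L2_null_add L2_null_mult[OF wm] L2_null_mult[OF vm] L2_null_mult[OF im] L2_null_cnj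
        H2_boundary_values H k n1)
  then show "L2_null I01 (at_right 0) (\<lambda>e t. ?\<omega> t * cnj (wsigma n \<gamma> S (sh k e t) a)
      + \<i> * vd (\<gamma> k) t * wlambda n \<gamma> Hg (sh k e t) a)"
  proof (rule L2_null_cong, intro always_eventually allI ballI)
    fix e t assume t: "t \<in> space I01"
    show "?\<omega> t * cnj (cext n \<gamma> (S a) (sh k e t) - S a (\<gamma> k t)) +
      (vd (\<gamma> k) t * (cext n \<gamma> (Hg a) (sh k e t) - Hg a (\<gamma> k t)) +
      \<i> * vd (\<gamma> k) t / (2 * complex_of_real pi) * (1 / (sh k e t - a) - 1 / (sh k 0 t - a)))
     = ?\<omega> t * cnj (wsigma n \<gamma> S (sh k e t) a) + \<i> * vd (\<gamma> k) t * wlambda n \<gamma> Hg (sh k e t) a" (is "?l = ?r")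
    proof -
      \<comment> \<open>The subtracted bracket is the left side of \<open>rel\<close>, hence 0; so
        \<open>?r\<close> consists of differences between shifted and boundary values.\<close>
      have "?l = ?r - (?\<omega> t * cnj (S a (\<gamma> k t)) + \<i> * vd (\<gamma> k) t * (1 / (2 * complex_of_real pi * (\<gamma> k t - a))) + vd (\<gamma> k) t * Hg a (\<gamma> k t))"
      proof -
        have "w * cnj (x - y) + (v * (h - g) + \<i> * v / (2 * complex_of_real pi) * (p - q)) =
          w * cnj x + \<i> * v * (1 / (2 * complex_of_real pi) * p - \<i> * h) -
          (w * cnj y + \<i> * v * (1 / (2 * complex_of_real pi) * q) + v * g)" for w x y v h g p q :: complex
          by (simp add: field_simps)
        from this[of "?\<omega> t" "cext n \<gamma> (S a) (sh k e t)" "S a (\<gamma> k t)" "vd (\<gamma> k) t" "cext n \<gamma> (Hg a) (sh k e t)"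
          "Hg a (\<gamma> k t)" "1 / (sh k e t - a)" "1 / (\<gamma> k t - a)"]
        show ?thesis unfolding wsigma_def wlambda_def by (simp only: sh_0 times_divide_times_eq mult_1_left)
      qed
      then show ?thesis using rel t by simp
    qed
  qed
  have one: "L2_bounded I01 (at_right (0::real)) (\<lambda>e t. 1 / (2 * complex_of_real pi))"
    by (intro L2_bounded_const continuous_square_integrable continuous_intros) auto
  have "L2_bounded I01 (at_right 0) (\<lambda>e t. 1 / (sh k e t - a) * (1 / (2 * complex_of_real pi)) + (- \<i>) * cext n \<gamma> (Hg a) (sh k e t))"
    by (intro L2_bounded_add L2_bounded_mult one multiplier_const H2_shift_bounded H k param_multiplier[OF \<delta>(1) \<delta>(4)])
  then show "L2_bounded I01 (at_right 0) (\<lambda>e t. wlambda n \<gamma> Hg (sh k e t) a)"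
    by (simp add: wlambda_def mult_ac)
qed

text \<open>The preimage of the disc of radius \<open>r\<close> is compact, hence at a positive
  distance from the boundary, and curves with a small shift miss it.\<close>

lemma proper_map_boundary:
  assumes f: "f ` \<Omega> = ball 0 1" and hol: "f holomorphic_on \<Omega>"
    and proper: "\<forall>K. compact K \<and> K \<subseteq> ball 0 1 \<longrightarrow> compact {w\<in>\<Omega>. f w \<in> K}"
    and r: "0 \<le> r" "r < 1"
  shows "\<forall>\<^sub>F e in at_right 0. \<forall>k<n. \<forall>t. r \<le> cmod (f (sh k e t)) \<and> cmod (f (sh k e t)) \<le> 1"
proof -
  define K where "K = {w\<in>\<Omega>. f w \<in> cball 0 r}"
  have K: "compact K" "K \<subseteq> \<Omega>" unfolding K_def by (intro proper[rule_format]) (use r in auto)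
  obtain d where d: "d > 0" "\<And>k t w. k < n \<Longrightarrow> w \<in> K \<Longrightarrow> d \<le> cmod (\<gamma> k t - w)"
    using away_from_boundary[OF K] by blast
  obtain D where D: "D > 0" "\<And>k t. k < n \<Longrightarrow> cmod (vd (\<gamma> k) t) \<le> D" using vd_bound by blast
  have "r \<le> cmod (f (sh k e t)) \<and> cmod (f (sh k e t)) \<le> 1" if e: "0 < e" "e < min \<epsilon> (d / D)" and k: "k < n" for e k t
  proof
    have "f (sh k e t) \<in> ball 0 1" using f sh_in[OF k e(1)] e by auto
    then show "cmod (f (sh k e t)) \<le> 1" by simp
    have "cmod (\<gamma> k t - sh k e t) = e * cmod (vd (\<gamma> k) t)"
      using sgn[of k] e by (simp add: sh_def norm_mult)
    also have "\<dots> \<le> e * D" using D k e by (intro mult_left_mono) auto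
    also have "\<dots> < d" using e D by (simp add: field_simps)
    finally have "sh k e t \<notin> K" using d(2)[OF k, of "sh k e t" t] by force
    then show "r \<le> cmod (f (sh k e t))" using sh_in[OF k e(1), of t] e by (simp add: K_def)
  qed
  then show ?thesis unfolding eventually_at_right_field using eps d D
    by (intro exI[of _ "min \<epsilon> (d / D)"]) auto
qed

end

section \<open>The auxiliary functions \<open>K\<close> and \<open>L\<close> and the Garabedian
  identity\<close>

lemma continuous_I01_integrable:
  fixes g :: "real \<Rightarrow> complex"
  assumes "continuous_on {0..1} g"
  shows "integrable I01 g" "integral\<^sup>L I01 g = integral {0..1} g"
  using square_integrable_I01_norm(1)[OF continuous_square_integrable[OF assms]] I01_integral(1) by auto

lemma (in collared_domain) garabedian_identity:
  fixes N :: nat and a :: "nat \<Rightarrow> complex" and c :: "nat \<Rightarrow> nat \<Rightarrow> complex"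
  assumes wsmooth: "\<forall>k<n. C_inf (\<lambda>t. \<phi> (\<gamma> k t))"
    and wpos: "\<forall>w\<in>frontier \<Omega>. \<phi> w > 0"
    and fhol: "f holomorphic_on \<Omega>"
    and fonto: "f ` \<Omega> = ball 0 1"
    and fproper: "\<forall>K. compact K \<and> K \<subseteq> ball 0 1 \<longrightarrow> compact {w\<in>\<Omega>. f w \<in> K}"
    and zeros: "{w\<in>\<Omega>. f w = 0} = a ` {..<N}"
    and simple: "\<forall>j<N. deriv f (a j) \<noteq> 0"
    and szego: "is_wszego \<Omega> n \<gamma> \<phi> S"
    and garab: "is_wgarab \<Omega> n \<gamma> \<phi> S Hg"
    and cinv: "\<forall>i<N. \<forall>j<N. (\<Sum>k<N. c i k * wsigma n \<gamma> S (a k) (a j)) = (if i = j then 1 else 0)"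
    and z: "z \<in> \<Omega>" and w: "w \<in> \<Omega>" "f w \<noteq> f z" "w \<notin> a ` {..<N}"
  shows "wlambda n \<gamma> Hg w z = f w / (f w - f z) *
    (\<Sum>i<N. \<Sum>j<N. c i j * wsigma n \<gamma> S z (a i) * wlambda n \<gamma> Hg w (a j))"
proof -
  let ?F = "at_right (0::real)"
  define s where "s p x = wsigma n \<gamma> S x p" for p x
  define h where "h p = cext n \<gamma> (Hg p)" for p
  define l where "l p x = wlambda n \<gamma> Hg x p" for p x
  have aj: "a j \<in> \<Omega>" "f (a j) = 0" if "j < N" for j using zeros that by auto
  have HS: "S p \<in> H2 \<Omega> n \<gamma>" "Hg p \<in> H2 \<Omega> n \<gamma>" if "p \<in> \<Omega>" for p
    using szego garab that by (auto simp: is_wszego_def is_wgarab_def)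
  have shol: "s p holomorphic_on \<Omega>" and hhol: "h p holomorphic_on \<Omega>" if "p \<in> \<Omega>" for p
    using cext_holomorphic[OF HS(1)[OF that]] cext_holomorphic[OF HS(2)[OF that]]
    by (simp_all add: s_def[abs_def] wsigma_def h_def)
  have herm: "cnj (s p x) = s x p" if "p \<in> \<Omega>" "x \<in> \<Omega>" for p x
    unfolding s_def by (rule szego_hermitian[OF wsmooth szego that])
  have leq: "l p x = 1 / (2 * complex_of_real pi * (x - p)) - \<i> * h p x" for p x
    by (simp add: l_def h_def wlambda_def)
  define c' where "c' j = (\<Sum>i<N. c i j * s (a i) z)" for j
  define K where "K x = s z x * (1 - cnj (f z) * f x) - (\<Sum>j<N. cnj (c' j) * s (a j) x)" for x
  \<comment> \<open>The poles are cancelled already in the definition: \<open>dq\<close> stands for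
    \<open>(f x - f z) / (x - z)\<close> and, as \<open>f\<close> vanishes at \<open>a j\<close>,
    for \<open>f x / (x - a j)\<close>. Thus \<open>L\<close> is holomorphic on the whole
    domain.\<close>
  define L where "L x = 1 / (2 * complex_of_real pi) * dq f z x - \<i> * h z x * (f x - f z) -
      (\<Sum>j<N. c' j * (1 / (2 * complex_of_real pi) * dq f (a j) x - \<i> * f x * h (a j) x))" for x
  have Khol: "K holomorphic_on \<Omega>"
    unfolding K_def[abs_def] using aj z by (auto intro!: holomorphic_intros shol fhol)
  have Lhol: "L holomorphic_on \<Omega>"
    unfolding L_def[abs_def] using aj z by (auto intro!: holomorphic_intros hhol fhol dq_holomorphic)
  have Leq: "L x = l z x * (f x - f z) - f x * (\<Sum>j<N. c' j * l (a j) x)"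
    if "x \<noteq> z" "x \<notin> a ` {..<N}" for x
  proof -
    have "(\<Sum>j<N. c' j * (1 / (2 * complex_of_real pi) * dq f (a j) x - \<i> * f x * h (a j) x)) =
      (\<Sum>j<N. f x * (c' j * l (a j) x))"
      using that aj by (intro sum.cong) (auto simp: dq_def leq algebra_simps)
    moreover have "1 / (2 * complex_of_real pi) * dq f z x - \<i> * h z x * (f x - f z) = l z x * (f x - f z)"
      using that by (simp add: dq_def leq algebra_simps diff_divide_distrib)
    ultimately show ?thesis unfolding L_def by (simp add: sum_distrib_left)
  qed
  have Ka: "K (a k) = 0" if k: "k < N" for k
  proof -
    \<comment> \<open>Conjugation and the symmetry of the Szego kernel produce \<open>c\<close>
      times the kernel matrix, so the double sum collapses to \<open>s (a k) z\<close>. At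
      \<open>a k\<close> the other factor of \<open>K\<close> is 1.\<close>
    have "cnj (\<Sum>j<N. cnj (c' j) * s (a j) (a k)) = (\<Sum>j<N. c' j * s (a k) (a j))"
      using herm aj k by simp
    also have "\<dots> = (\<Sum>j<N. \<Sum>i<N. s (a i) z * (c i j * s (a k) (a j)))"
      unfolding c'_def sum_distrib_right by (simp add: mult_ac)
    also have "\<dots> = (\<Sum>i<N. s (a i) z * (\<Sum>j<N. c i j * s (a k) (a j)))"
      by (subst sum.swap) (simp add: sum_distrib_left)
    also have "\<dots> = (\<Sum>i<N. s (a i) z * (if i = k then 1 else 0))"
      using cinv k by (intro sum.cong) (auto simp: s_def)
    also have "\<dots> = (\<Sum>i<N. if i = k then s (a i) z else 0)" by (intro sum.cong) auto
    also have "\<dots> = s (a k) z" using k by (simp add: sum.delta)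
    also have "\<dots> = cnj (s z (a k))" using herm[OF z aj(1)[OF k]] by simp
    finally have "(\<Sum>j<N. cnj (c' j) * s (a j) (a k)) = s z (a k)"
      by (simp only: complex_cnj_cancel_iff)
    then show ?thesis using aj(2)[OF k] by (simp add: K_def)
  qed
  obtain Q where Q: "Q holomorphic_on \<Omega>" "\<And>p. p \<in> \<Omega> \<Longrightarrow> Q p * f p = K p"
  proof (rule holomorphic_quotient_simple_zeros[OF open_\<Omega> Khol fhol])
    fix p assume "p \<in> \<Omega>" "f p = 0"
    then obtain k where "k < N" "p = a k" using zeros by auto
    then show "K p = 0 \<and> deriv f p \<noteq> 0" using Ka simple by simp
  qed blast
  have fbd: "\<forall>\<^sub>F e in ?F. \<forall>k<n. \<forall>t. r \<le> cmod (f (sh k e t)) \<and> cmod (f (sh k e t)) \<le> 1"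
    if "0 \<le> r" "r < 1" for r
    by (rule proper_map_boundary[OF fonto fhol fproper that])
  have fz: "cmod (f z) \<le> 1" using fonto z by force
  have fc: "continuous_on A (\<lambda>t. f (sh k e t))" if "k < n" "0 < e \<and> e \<le> \<epsilon>" for k e A
    using that by (intro sh_comp_cont fhol) auto
  have m_f: "multiplier I01 ?F (\<lambda>e t. f (sh k e t))" if k: "k < n" for k
    unfolding multiplier_def
  proof (rule exI[of _ 1])
    show "\<forall>\<^sub>F e in ?F. (\<lambda>t. f (sh k e t)) \<in> borel_measurable I01 \<and> (\<forall>t\<in>space I01. cmod (f (sh k e t)) \<le> 1)"
      using fbd[of 0, simplified] eventually_shift
      by eventually_elim (use k in \<open>auto intro!: continuous_measurable_I01 fc\<close>)
  qed
  have m_1f: "multiplier I01 ?F (\<lambda>e t. 1 / f (sh k e t))" if k: "k < n" for k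
    unfolding multiplier_def
  proof (rule exI[of _ 2])
    have "\<forall>\<^sub>F e in ?F. \<forall>k<n. \<forall>t. 1/2 \<le> cmod (f (sh k e t)) \<and> cmod (f (sh k e t)) \<le> 1" by (rule fbd) auto
    then show "\<forall>\<^sub>F e in ?F. (\<lambda>t. 1 / f (sh k e t)) \<in> borel_measurable I01 \<and> (\<forall>t\<in>space I01. cmod (1 / f (sh k e t)) \<le> 2)"
      using eventually_shift
    proof eventually_elim
      case (elim e)
      then have b: "1/2 \<le> cmod (f (sh k e t))" for t using k by blast
      have "f (sh k e t) \<noteq> 0" for t
      proof
        assume "f (sh k e t) = 0"
        with b[of t] show False by simp
      qed
      then have "(\<lambda>t. 1 / f (sh k e t)) \<in> borel_measurable I01"
        using k elim by (intro continuous_measurable_I01 continuous_intros fc) auto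
      moreover have "cmod (1 / f (sh k e t)) \<le> 2" for t
        using frac_le[of 1 1 "1/2" "cmod (f (sh k e t))"] b[of t] by (simp add: norm_divide)
      ultimately show ?case by blast
    qed
  qed
  have m_g: "multiplier I01 ?F (\<lambda>e t. 1 - cnj (f z) * f (sh k e t))" if k: "k < n" for k
    unfolding multiplier_def
  proof (rule exI[of _ 2])
    show "\<forall>\<^sub>F e in ?F. (\<lambda>t. 1 - cnj (f z) * f (sh k e t)) \<in> borel_measurable I01 \<and>
        (\<forall>t\<in>space I01. cmod (1 - cnj (f z) * f (sh k e t)) \<le> 2)"
      using fbd[of 0, simplified] eventually_shift
    proof eventually_elim
      case (elim e)
      have "cmod (1 - cnj (f z) * f (sh k e t)) \<le> 1 + cmod (f z) * cmod (f (sh k e t))" for t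
        using norm_triangle_ineq4[of 1 "cnj (f z) * f (sh k e t)"] by (simp add: norm_mult)
      moreover have "cmod (f z) * cmod (f (sh k e t)) \<le> 1 * 1" for t
        using fz elim k by (intro mult_mono) auto
      ultimately have "cmod (1 - cnj (f z) * f (sh k e t)) \<le> 2" for t by (smt (verit))
      then show ?case using k elim by (auto intro!: continuous_measurable_I01 continuous_intros fc)
    qed
  qed
  have m_cg: "multiplier I01 ?F (\<lambda>e t. 1 - f z * cnj (f (sh k e t)))" if k: "k < n" for k
  proof -
    obtain B where B: "\<forall>\<^sub>F e in ?F. (\<lambda>t. 1 - cnj (f z) * f (sh k e t)) \<in> borel_measurable I01 \<and>
        (\<forall>t\<in>space I01. cmod (1 - cnj (f z) * f (sh k e t)) \<le> B)"
      using m_g[OF k] unfolding multiplier_def by blast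
    show ?thesis unfolding multiplier_def
    proof (rule exI[of _ B])
      show "\<forall>\<^sub>F e in ?F. (\<lambda>t. 1 - f z * cnj (f (sh k e t))) \<in> borel_measurable I01 \<and>
        (\<forall>t\<in>space I01. cmod (1 - f z * cnj (f (sh k e t))) \<le> B)"
        using B eventually_shift
      proof eventually_elim
        case (elim e)
        have "cmod (1 - f z * cnj (f (sh k e t))) = cmod (1 - cnj (f z) * f (sh k e t))" for t
          using complex_mod_cnj[of "1 - cnj (f z) * f (sh k e t)"] by simp
        then show ?case using k elim by (auto intro!: continuous_measurable_I01 continuous_intros fc)
      qed
    qed
  qed
  have n_f: "null_multiplier I01 ?F (\<lambda>e t. f (sh k e t) * cnj (f (sh k e t)) - 1)" if k: "k < n" for k
    unfolding null_multiplier_def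
  proof (intro allI impI)
    fix \<eta> :: real assume \<eta>: "\<eta> > 0"
    \<comment> \<open>With \<open>r = cmod f\<close>, \<open>\<bar>r\<^sup>2 - 1\<bar> = (1 - r) *
      (r + 1) \<le> \<eta> / 2 * 2\<close>. The maximum with 0 keeps the radius admissible when
      \<open>\<eta>\<close> is large.\<close>
    have "\<forall>\<^sub>F e in ?F. \<forall>k<n. \<forall>t. max 0 (1 - \<eta> / 2) \<le> cmod (f (sh k e t)) \<and> cmod (f (sh k e t)) \<le> 1"
      by (rule fbd) (use \<eta> in auto)
    then show "\<forall>\<^sub>F e in ?F. (\<lambda>t. f (sh k e t) * cnj (f (sh k e t)) - 1) \<in> borel_measurable I01 \<and>
        (\<forall>t\<in>space I01. cmod (f (sh k e t) * cnj (f (sh k e t)) - 1) \<le> \<eta>)"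
      using eventually_shift
    proof eventually_elim
      case (elim e)
      have "cmod (f (sh k e t) * cnj (f (sh k e t)) - 1) \<le> \<eta>" for t
      proof -
        let ?r = "cmod (f (sh k e t))"
        have r: "0 \<le> ?r" "?r \<le> 1" "1 - \<eta> / 2 \<le> ?r" using elim k by auto
        have "f (sh k e t) * cnj (f (sh k e t)) - 1 = complex_of_real (?r\<^sup>2 - 1)"
          by (simp add: complex_norm_square[symmetric])
        then have "cmod (f (sh k e t) * cnj (f (sh k e t)) - 1) = \<bar>?r\<^sup>2 - 1\<bar>"
          by (metis norm_of_real)
        also have "?r\<^sup>2 - 1 = (?r - 1) * (?r + 1)" by (simp add: power2_eq_square algebra_simps)
        also have "\<bar>(?r - 1) * (?r + 1)\<bar> = (1 - ?r) * (?r + 1)" using r by (simp add: abs_mult)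
        also have "\<dots> \<le> (\<eta> / 2) * 2" using r by (intro mult_mono) auto
        finally show ?thesis by simp
      qed
      then show ?case using k elim by (auto intro!: continuous_measurable_I01 continuous_intros fc)
    qed
  qed
  define \<omega> where "\<omega> k t = complex_of_real (\<phi> (\<gamma> k t) * cmod (vd (\<gamma> k) t))" for k t
  have \<omega>c: "continuous_on A (\<omega> k)" if "k < n" for k A
    unfolding \<omega>_def using weight_cont[OF wsmooth that] .
  have m_\<omega>: "multiplier I01 ?F (\<lambda>e. \<omega> k)" if "k < n" for k
    by (intro continuous_multiplier \<omega>c that)
  have m_v: "multiplier I01 ?F (\<lambda>e t. \<i> * vd (\<gamma> k) t * f z)" if "k < n" for k
    by (intro continuous_multiplier continuous_intros loop_cont loops that)
  have m_1v: "multiplier I01 ?F (\<lambda>e t. 1 / (\<i> * vd (\<gamma> k) t))" if "k < n" for k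
    by (intro continuous_multiplier continuous_intros loop_cont loops that)
       (use loop_vd_nz[OF loops[OF that]] in auto)
  \<comment> \<open>The defect in the boundary relation between \<open>K\<close> and
    \<open>L\<close>, with weight and tangent taken at the boundary point.\<close>
  define R where "R k e t = f (sh k e t) * \<omega> k t * cnj (K (sh k e t)) + \<i> * vd (\<gamma> k) t * L (sh k e t)" for k e t
  have lb: "L2_bounded I01 ?F (\<lambda>e t. l p (sh k e t))" if "p \<in> \<Omega>" "k < n" for p k
    unfolding l_def by (rule garabedian_boundary_relation(2)[OF wsmooth wpos szego garab that])
  have Dn: "L2_null I01 ?F (\<lambda>e t. \<omega> k t * cnj (s p (sh k e t)) + \<i> * vd (\<gamma> k) t * l p (sh k e t))"
    if "p \<in> \<Omega>" "k < n" for p k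
    unfolding l_def s_def \<omega>_def by (rule garabedian_boundary_relation(1)[OF wsmooth wpos szego garab that])
  have Rn: "L2_null I01 ?F (R k)" if k: "k < n" for k
  proof -
    let ?D = "\<lambda>p e t. \<omega> k t * cnj (s p (sh k e t)) + \<i> * vd (\<gamma> k) t * l p (sh k e t)"
    \<comment> \<open>\<open>R\<close> splits into the defects of the kernels at \<open>z\<close>
      and at the \<open>a j\<close>, with bounded factors, and a term with
      \<open>f * cnj f - 1\<close>, the error in replacing \<open>f * (1 - f z * cnj f)\<close> by
      \<open>f - f z\<close>.\<close>
    have "L2_null I01 ?F (\<lambda>e t. f (sh k e t) * ((1 - f z * cnj (f (sh k e t))) * ?D z e t) +
        ((-1) * (\<Sum>j<N. c' j * (f (sh k e t) * ?D (a j) e t)) +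
         \<i> * vd (\<gamma> k) t * f z * ((f (sh k e t) * cnj (f (sh k e t)) - 1) * l z (sh k e t))))"
      by (intro L2_null_add L2_null_mult[OF m_f[OF k]] L2_null_mult[OF m_cg[OF k]] L2_null_mult[OF multiplier_const]
          L2_null_sum L2_null_mult[OF m_v[OF k]] L2_null_mult_bounded[OF n_f[OF k]] Dn lb z k aj) auto
    moreover have "\<forall>\<^sub>F e in ?F. \<forall>t\<in>space I01. f (sh k e t) * ((1 - f z * cnj (f (sh k e t))) * ?D z e t) +
        ((-1) * (\<Sum>j<N. c' j * (f (sh k e t) * ?D (a j) e t)) +
         \<i> * vd (\<gamma> k) t * f z * ((f (sh k e t) * cnj (f (sh k e t)) - 1) * l z (sh k e t))) = R k e t"
    proof -
      have "\<forall>\<^sub>F e in ?F. \<forall>j\<in>{..<N}. \<forall>k<n. \<forall>t. sh k e t \<noteq> a j"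
        by (intro eventually_ball_finite ballI eventually_sh_ne aj) auto
      then show ?thesis using eventually_sh_ne[OF z]
      proof eventually_elim
        case (elim e)
        show ?case
        proof
          fix t
          let ?x = "sh k e t"
          have ne: "?x \<noteq> z" "?x \<notin> a ` {..<N}" using elim k by auto
          have S1: "(\<Sum>j<N. c' j * (f ?x * ?D (a j) e t)) =
            f ?x * \<omega> k t * (\<Sum>j<N. c' j * cnj (s (a j) ?x)) + \<i> * vd (\<gamma> k) t * f ?x * (\<Sum>j<N. c' j * l (a j) ?x)"
            unfolding sum_distrib_left sum.distrib[symmetric] by (intro sum.cong) (auto simp: algebra_simps)
          have S2: "cnj (K ?x) = cnj (s z ?x) * (1 - f z * cnj (f ?x)) - (\<Sum>j<N. c' j * cnj (s (a j) ?x))"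
            by (simp add: K_def)
          have alg: "F * ((1 - Fz * Fb) * (om * cz + \<i> * v * lz)) + ((-1) * (F * om * A + \<i> * v * F * B) + \<i> * v * Fz * ((F * Fb - 1) * lz))
            = F * om * (cz * (1 - Fz * Fb) - A) + \<i> * v * (lz * (F - Fz) - F * B)" for F Fz Fb om cz v lz A B :: complex
            by (simp add: algebra_simps)
          show "f ?x * ((1 - f z * cnj (f ?x)) * ?D z e t) + ((-1) * (\<Sum>j<N. c' j * (f ?x * ?D (a j) e t)) +
              \<i> * vd (\<gamma> k) t * f z * ((f ?x * cnj (f ?x) - 1) * l z ?x)) = R k e t"
            unfolding R_def S1 S2 Leq[OF ne] by (rule alg)
        qed
      qed
    qed
    ultimately show ?thesis by (rule L2_null_cong)
  qed
  have sb: "L2_bounded I01 ?F (\<lambda>e t. s p (sh k e t))" if "p \<in> \<Omega>" "k < n" for p k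
    unfolding s_def wsigma_def by (rule H2_shift_bounded[OF HS(1)[OF that(1)] that(2)])
  have Kb: "L2_bounded I01 ?F (\<lambda>e t. K (sh k e t))" if k: "k < n" for k
  proof -
    have "L2_bounded I01 ?F (\<lambda>e t. (1 - cnj (f z) * f (sh k e t)) * s z (sh k e t) +
        (-1) * (\<Sum>j<N. cnj (c' j) * s (a j) (sh k e t)))"
      by (intro L2_bounded_add L2_bounded_mult[OF m_g[OF k]] L2_bounded_mult[OF multiplier_const] L2_bounded_sum sb z aj k) auto
    then show ?thesis by (simp add: K_def mult.commute)
  qed
  \<comment> \<open>The definition of \<open>R\<close> solved for \<open>L\<close>. It transfers
    estimates from \<open>K\<close> to \<open>L\<close>: boundedness now, convergence to 0 at the
    end.\<close>
  have L_via: "L (sh k e t) = 1 / (\<i> * vd (\<gamma> k) t) * (R k e t + (-1) * (f (sh k e t) * (\<omega> k t * cnj (K (sh k e t)))))"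
    if "k < n" for k e t
    using loop_vd_nz[OF loops[OF that], of t] by (simp add: R_def)
  have Lb: "L2_bounded I01 ?F (\<lambda>e t. L (sh k e t))" if k: "k < n" for k
    unfolding L_via[OF k]
    by (intro L2_bounded_mult[OF m_1v[OF k]] L2_bounded_add L2_bounded_mult[OF multiplier_const]
        L2_bounded_mult[OF m_f[OF k]] L2_bounded_mult[OF m_\<omega>[OF k]] L2_bounded_cnj Kb L2_null_imp_bounded Rn k)
  have Kfb: "L2_bounded I01 ?F (\<lambda>e t. 1 / f (sh k e t) * K (sh k e t))" if k: "k < n" for k
    by (intro L2_bounded_mult[OF m_1f[OF k]] Kb k)
  \<comment> \<open>The contour integral carries the tangent \<open>dsh k e t\<close> of the shifted
    curve, but \<open>R\<close> that of the boundary; \<open>E\<close> is the difference.\<close>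
  define E where "E k e t = \<i> * ((dsh k e t - dsh k 0 t) * L (sh k e t))" for k e t
  have En: "L2_null I01 ?F (E k)" if k: "k < n" for k
  proof -
    have "continuous_on ({0..\<epsilon>} \<times> {0..1}) (\<lambda>(e, t). dsh k e t)"
      unfolding case_prod_unfold by (intro continuous_intros k)
    then show ?thesis unfolding E_def
      by (intro L2_null_mult[OF multiplier_const] L2_null_mult_bounded Lb k uniform_tendsto_param[OF eps])
  qed
  let ?W = "\<lambda>k e. \<integral>t. \<phi> (\<gamma> k t) * cmod (vd (\<gamma> k) t) * (cmod (K (sh k e t)))\<^sup>2 \<partial>I01"
    and ?RK = "\<lambda>k e. \<integral>t. R k e t * (1 / f (sh k e t) * K (sh k e t)) \<partial>I01"
    and ?EK = "\<lambda>k e. \<integral>t. E k e t * (1 / f (sh k e t) * K (sh k e t)) \<partial>I01"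
    and ?QI = "\<lambda>k e. integral {0..1} (\<lambda>t. Q (sh k e t) * L (sh k e t) * dsh k e t)"
  have lim: "((\<lambda>e. \<Sum>k<n. (?RK k e +
      ?EK k e)) \<longlongrightarrow> (\<Sum>k<n. 0 + 0)) ?F"
    by (intro tendsto_sum tendsto_add L2_inner_null Rn En Kfb) auto
  have "\<forall>\<^sub>F e in ?F. (\<Sum>k<n. (?RK k e +
      ?EK k e)) =
      complex_of_real (\<Sum>k<n. ?W k e)"
  proof -
    have "\<forall>\<^sub>F e in ?F. \<forall>k<n. \<forall>t. 1/2 \<le> cmod (f (sh k e t)) \<and> cmod (f (sh k e t)) \<le> 1" by (rule fbd) auto
    then show ?thesis using eventually_shift
    proof eventually_elim
      case (elim e)
      have e: "0 < e" "e \<le> \<epsilon>" using elim by auto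
      have fnz: "f (sh k e t) \<noteq> 0" if "k < n" for k t
      proof -
        have "1/2 \<le> cmod (f (sh k e t))" using elim that by blast
        then show ?thesis by auto
      qed
      have cont: "continuous_on {0..1} (\<lambda>t. K (sh k e t))" "continuous_on {0..1} (\<lambda>t. L (sh k e t))"
        "continuous_on {0..1} (\<lambda>t. f (sh k e t))" "continuous_on {0..1} (vd (\<gamma> k))" if k: "k < n" for k
        by (rule sh_comp_cont[OF Khol k e] sh_comp_cont[OF Lhol k e] sh_comp_cont[OF fhol k e]
              loop_cont(2)[OF loops[OF k]])+
      have contd: "continuous_on {0..1} (dsh k x)" if k: "k < n" for k x
        using sh_cont(2)[OF k continuous_on_const continuous_on_id] by simp
      note ci = continuous_I01_integrable
      have Rc: "continuous_on {0..1} (\<lambda>t. R k e t * (1 / f (sh k e t) * K (sh k e t)))"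
        and Ec: "continuous_on {0..1} (\<lambda>t. E k e t * (1 / f (sh k e t) * K (sh k e t)))"
        and Qc: "continuous_on {0..1} (\<lambda>t. \<i> * (Q (sh k e t) * L (sh k e t) * dsh k e t))"
        and Wc: "continuous_on {0..1} (\<lambda>t. \<omega> k t * (K (sh k e t) * cnj (K (sh k e t))))" if k: "k < n" for k
        unfolding R_def E_def
        using fnz[OF k] by (auto intro!: continuous_intros cont[OF k] contd[OF k] \<omega>c[OF k] sh_comp_cont[OF Q(1) k e])
      have main: "?RK k e +
          ?EK k e =
          complex_of_real (?W k e) +
          \<i> * ?QI k e" if k: "k < n" for k
      proof -
        \<comment> \<open>Multiplying by \<open>K / f = Q\<close> turns
          \<open>f * \<omega> * cnj K\<close> into \<open>\<omega> * |K|^2\<close>; adding the error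
          \<open>E\<close> completes the rest to the integrand of the contour integral of
          \<open>Q * L\<close>, which vanishes after summation over the curves.\<close>
        have "R k e t * (1 / f (sh k e t) * K (sh k e t)) + E k e t * (1 / f (sh k e t) * K (sh k e t)) =
          \<omega> k t * (K (sh k e t) * cnj (K (sh k e t))) + \<i> * (Q (sh k e t) * L (sh k e t) * dsh k e t)" for t
        proof -
          have "Q (sh k e t) = 1 / f (sh k e t) * K (sh k e t)"
            using Q(2)[OF sh_in[OF k e, of t]] fnz[OF k, of t] by (simp add: field_simps)
          moreover have "(F * om * cK + \<i> * v * Lx) * (1 / F * Kx) + \<i> * ((d - v) * Lx) * (1 / F * Kx) =
            om * (Kx * cK) + \<i> * (1 / F * Kx * Lx * d)" if "F \<noteq> 0" for F om cK v Lx Kx d :: complex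
            using that by (simp add: field_simps)
          ultimately show ?thesis
            using fnz[OF k, of t] unfolding R_def E_def sh_0 by (simp only: not_False_eq_True)
        qed
        then have "?RK k e +
          ?EK k e =
          (\<integral>t. \<omega> k t * (K (sh k e t) * cnj (K (sh k e t))) \<partial>I01) +
          (\<integral>t. \<i> * (Q (sh k e t) * L (sh k e t) * dsh k e t) \<partial>I01)"
          using Bochner_Integration.integral_add[OF ci(1)[OF Rc[OF k]] ci(1)[OF Ec[OF k]]]
            Bochner_Integration.integral_add[OF ci(1)[OF Wc[OF k]] ci(1)[OF Qc[OF k]]] by simp
        moreover have "\<omega> k t * (K (sh k e t) * cnj (K (sh k e t))) =
            complex_of_real (\<phi> (\<gamma> k t) * cmod (vd (\<gamma> k) t) * (cmod (K (sh k e t)))\<^sup>2)" for t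
          by (simp add: \<omega>_def complex_norm_square[symmetric])
        then have "(\<integral>t. \<omega> k t * (K (sh k e t) * cnj (K (sh k e t))) \<partial>I01) =
            complex_of_real (?W k e)"
          by (simp only: integral_complex_of_real)
        moreover have "(\<integral>t. \<i> * (Q (sh k e t) * L (sh k e t) * dsh k e t) \<partial>I01) =
            \<i> * ?QI k e"
          unfolding ci(2)[OF Qc[OF k]] by (rule Henstock_Kurzweil_Integration.integral_mult_right)
        ultimately show ?thesis by (simp only:)
      qed
      have zero: "(\<Sum>k<n. ?QI k e) = 0"
        by (rule Cauchy_shifted[OF e, of "\<lambda>x. Q x * L x"]) (intro holomorphic_intros Q(1) Lhol)
      have "(\<Sum>k<n. (?RK k e +
          ?EK k e)) =
        (\<Sum>k<n. complex_of_real (?W k e) +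
          \<i> * ?QI k e)"
        by (rule sum.cong[OF refl]) (simp only: main lessThan_iff)
      also have "\<dots> = complex_of_real (\<Sum>k<n. ?W k e) +
          \<i> * (\<Sum>k<n. ?QI k e)"
        by (simp only: sum.distrib sum_distrib_left of_real_sum)
      finally show ?case unfolding zero by (simp only: mult_zero_right add_0_right)
    qed
  qed
  from Lim_transform_eventually[OF lim this]
  have "((\<lambda>e. complex_of_real (\<Sum>k<n. ?W k e)) \<longlongrightarrow> complex_of_real 0) ?F"
    by simp
  then have Wlim: "((\<lambda>e. \<Sum>k<n. ?W k e) \<longlongrightarrow> 0) ?F"
    by (simp only: tendsto_of_real_iff)
  have Kn: "L2_null I01 ?F (\<lambda>e t. K (sh k e t))" if k: "k < n" for k
  proof -
    have wc: "continuous_on A (\<lambda>t. \<phi> (\<gamma> j t) * cmod (vd (\<gamma> j) t))" if "j < n" for j A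
      by (intro continuous_intros loop_cont loops that C_inf_continuous) (use wsmooth that in auto)
    have wp: "0 < \<phi> (\<gamma> j t) * cmod (vd (\<gamma> j) t)" if "j < n" for j t
      using wpos bdry_in_frontier[OF that] loop_vd_nz[OF loops[OF that]] by simp
    \<comment> \<open>The positive minimum of weight times speed on \<open>\<gamma> k\<close> lets
      the weighted integral control the unweighted one; the other curves contribute nonnegative
      terms.\<close>
    have "\<exists>x\<in>{0..1}. \<forall>t\<in>{0..1}. \<phi> (\<gamma> k x) * cmod (vd (\<gamma> k) x) \<le> \<phi> (\<gamma> k t) * cmod (vd (\<gamma> k) t)"
      by (rule continuous_attains_inf[OF compact_Icc _ wc[OF k]]) simp
    then obtain t0 where t0: "\<forall>t\<in>{0..1}. \<phi> (\<gamma> k t0) * cmod (vd (\<gamma> k) t0) \<le> \<phi> (\<gamma> k t) * cmod (vd (\<gamma> k) t)"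
      by blast
    have nonneg: "0 \<le> \<phi> (\<gamma> j t) * cmod (vd (\<gamma> j) t) * r\<^sup>2" if "j < n" for j t and r :: real
      by (rule mult_nonneg_nonneg[OF less_imp_le[OF wp[OF that]] zero_le_power2])
    define m where "m = \<phi> (\<gamma> k t0) * cmod (vd (\<gamma> k) t0)"
    have m: "m > 0" using wp[OF k] by (simp add: m_def)
    have Kc: "continuous_on {0..1} (\<lambda>t. K (sh j e t))" if "j < n" "0 < e" "e \<le> \<epsilon>" for j e
      by (intro sh_comp_cont Khol that)
    have "\<forall>\<^sub>F e in ?F. norm (sqnorm I01 (\<lambda>t. K (sh k e t))) \<le>
        1 / m * (\<Sum>k<n. ?W k e)"
      using eventually_shift
    proof eventually_elim
      case (elim e)
      have i: "integrable I01 (\<lambda>t. (cmod (K (sh k e t)))\<^sup>2)"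
        using continuous_square_integrable[OF Kc[OF k]] elim by (auto simp: square_integrable_def)
      have i': "integrable I01 (\<lambda>t. \<phi> (\<gamma> k t) * cmod (vd (\<gamma> k) t) * (cmod (K (sh k e t)))\<^sup>2)"
        by (rule absolutely_integrable_imp_integrable[OF absolutely_integrable_continuous_real])
           (use elim k in \<open>auto intro!: continuous_on_mult wc continuous_intros Kc\<close>)
      have "m * (sqnorm I01 (\<lambda>t. K (sh k e t))) = (\<integral>t. m * (cmod (K (sh k e t)))\<^sup>2 \<partial>I01)" by simp
      also have "\<dots> \<le> ?W k e"
        using i i' t0 by (intro integral_mono) (auto simp: m_def intro!: mult_right_mono)
      also have "\<dots> \<le> (\<Sum>k<n. ?W k e)"
        by (rule member_le_sum[where f = "\<lambda>k. ?W k e"])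
           (use k in \<open>simp_all add: Bochner_Integration.integral_nonneg nonneg\<close>)
      finally show ?case using m by (simp add: field_simps)
    qed
    from Lim_null_comparison[OF this tendsto_mult_right_zero[OF Wlim]]
    show ?thesis unfolding L2_null_def
      using eventually_mono[OF eventually_shift, of "\<lambda>e. square_integrable I01 (\<lambda>t. K (sh k e t))"]
        continuous_square_integrable[OF Kc[OF k]] by auto
  qed
  have "L2_null I01 ?F (\<lambda>e t. L (sh k e t))" if k: "k < n" for k
    unfolding L_via[OF k]
    by (intro L2_null_mult[OF m_1v[OF k]] L2_null_add L2_null_mult[OF multiplier_const]
        L2_null_mult[OF m_f[OF k]] L2_null_mult[OF m_\<omega>[OF k]] L2_null_cnj Kn Rn k)
  from L2_null_imp_zero[OF Lhol this w(1)] have "L w = 0" by blast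
  then have "l z w * (f w - f z) = f w * (\<Sum>j<N. c' j * l (a j) w)"
    using Leq[of w] w by auto
  moreover have "(\<Sum>j<N. c' j * l (a j) w) = (\<Sum>i<N. \<Sum>j<N. c i j * wsigma n \<gamma> S z (a i) * wlambda n \<gamma> Hg w (a j))"
    unfolding c'_def s_def l_def sum_distrib_right by (rule sum.swap)
  ultimately show ?thesis using w(2) by (simp add: l_def field_simps)
qed

theorem theorem8p3:
  fixes \<Omega> :: "complex set" and n :: nat and \<gamma> :: "nat \<Rightarrow> real \<Rightarrow> complex"
    and \<phi> :: "complex \<Rightarrow> real" and f :: "complex \<Rightarrow> complex"
    and N :: nat and a :: "nat \<Rightarrow> complex" and c :: "nat \<Rightarrow> nat \<Rightarrow> complex"
    and S Hg :: "complex \<Rightarrow> complex \<Rightarrow> complex" and z :: complex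
  assumes dom: "smooth_bdry_domain \<Omega> n \<gamma>"
    and wsmooth: "\<forall>k<n. C_inf (\<lambda>t. \<phi> (\<gamma> k t))"
    and wpos: "\<forall>w\<in>frontier \<Omega>. \<phi> w > 0"
    and fhol: "f holomorphic_on \<Omega>"
    and fonto: "f ` \<Omega> = ball 0 1"
    and fproper: "\<forall>K. compact K \<and> K \<subseteq> ball 0 1 \<longrightarrow> compact {w\<in>\<Omega>. f w \<in> K}"
    and zeros: "{w\<in>\<Omega>. f w = 0} = a ` {..<N}"
    and ainj: "inj_on a {..<N}"
    and simple: "\<forall>j<N. deriv f (a j) \<noteq> 0"
    and szego: "is_wszego \<Omega> n \<gamma> \<phi> S"
    and garab: "is_wgarab \<Omega> n \<gamma> \<phi> S Hg"
    and cinv1: "\<forall>i<N. \<forall>j<N. (\<Sum>k<N. c i k * wsigma n \<gamma> S (a k) (a j)) = (if i = j then 1 else 0)"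
    and cinv2: "\<forall>i<N. \<forall>j<N. (\<Sum>k<N. wsigma n \<gamma> S (a i) (a k) * c k j) = (if i = j then 1 else 0)"
    and z: "z \<in> \<Omega>"
  shows "\<forall>w\<in>\<Omega>. f w \<noteq> f z \<and> w \<notin> a ` {..<N} \<longrightarrow>
           wlambda n \<gamma> Hg w z
             = f w / (f w - f z) *
               (\<Sum>i<N. \<Sum>j<N. c i j * wsigma n \<gamma> S z (a i) * wlambda n \<gamma> Hg w (a j))"
proof (intro ballI impI, elim conjE)
  fix w assume w: "w \<in> \<Omega>" "f w \<noteq> f z" "w \<notin> a ` {..<N}"
  obtain \<epsilon> C and \<sigma> :: "nat \<Rightarrow> real" where "collared_domain \<Omega> n \<gamma> \<epsilon> C \<sigma>"
    using domain_collar[OF dom] .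
  then interpret collared_domain \<Omega> n \<gamma> \<epsilon> C \<sigma> .
  show "wlambda n \<gamma> Hg w z = f w / (f w - f z) *
    (\<Sum>i<N. \<Sum>j<N. c i j * wsigma n \<gamma> S z (a i) * wlambda n \<gamma> Hg w (a j))"
    by (rule garabedian_identity[OF wsmooth wpos fhol fonto fproper zeros simple szego garab cinv1 z w])
qed

end
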